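(* There exists a universal constant $c>0$ such that the following holds. Let $P,Q$ be probability measures (joint laws of $(X,Y)\in\mathcal X\times\{0,1\}$) and let $f:\mathcal X\to[0,1]$ be a measurable function. Let $\mathcal D_P=(x_i,y_i)_{i=1}^{n_P}$ be an IID sample from $P$ and $\mathcal D_Q=(x_i',y_i')_{i=1}^{n_Q}$ an IID sample from $Q$. Suppose that (B1) $P[X\in A\mid Y=k]=Q[X\in A\mid Y=k]$ for all $k\in\{0,1\}$ and all Borel $A\subset\mathcal X$; (B2) $P[Y=1]\in(0,1)$ and $Q[Y=1]\in(0,1)$. Let $\mathcal B$ be the uniform-mass binning scheme induced by $\mathcal D_P$ (i.e. by $z_i=f(x_i)$, $i\in[n_P]$), let $\hat h_P$ be the recalibration function based on $\mathcal B$ and $\mathcal D_P$, and let $\hat g$ be the estimated shift correction function. Then $$R_Q\big(\hat g\circ\hat h_P;f\big)\le 2\left\{\left(\frac{\rho_0-\rho_1}{\rho_0+\rho_1}\right)^2+\frac{(w^*_{\max})^3}{(w^*_{\min})^2}\cdot R_P\big(\hat h_P;f\big)\right\},\qquad \rho_k:=\frac{\hat w_k}{w_k^*},\ k\in\{0,1\}.$$ Furthermore, suppose that, with $Z=f(X)$ under $P$ and $F_Z$ its cumulative distribution function: (A1) $F_Z$ is absolutely continuous; (A2) $h^*_{f,P}$ is monotonically non-decreasing on $\operatorname{supp}P_Z$; (A3) $K>0$ is a constant such that whenever $z_1\le z_2$, $h^*_{f,P}(z_2)-h^*_{f,P}(z_1)\le K\cdot(F_Z(z_2)-F_Z(z_1))$.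 Then for every $\delta\in(0,1)$, if $$n_P\ge\max\left\{c,\frac{27}{p_{\min}}\right\}\cdot|\mathcal B|\log\left(\frac{4|\mathcal B|}{\delta}\right)\qquad\text{and}\qquad n_Q\ge\frac{27}{q_{\min}}\log\left(\frac{16}{\delta}\right),$$ then with probability at least $1-\delta$, $$R_Q\big(\hat g\circ\hat h_P;f\big)\le 2\frac{(w^*_{\max})^3}{(w^*_{\min})^2}\left\{\left(\sqrt{\frac{1}{2(\lfloor n_P/|\mathcal B|\rfloor-1)}\log\left(\frac{8|\mathcal B|}{\delta}\right)}+\frac{1}{\lfloor n_P/|\mathcal B|\rfloor}\right)^2+\frac{8K^2}{|\mathcal B|^2}\right\}+54\max\left\{\frac{1}{p_{\min}\,n_P},\frac{1}{q_{\min}\,n_Q}\right\}\log\left(\frac{16}{\delta}\right).$$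
   Context: $\mathcal X\subset\mathbb R^d$, $[n]=\{1,\dots,n\}$. Notation: $p_k=P[Y=k]$, $q_k=Q[Y=k]$, $w_k^*=q_k/p_k$ for $k\in\{0,1\}$; $p_{\min}=\min_k p_k$, $q_{\min}=\min_k q_k$, $w^*_{\min}=\min_k w^*_k$, $w^*_{\max}=\max_k w^*_k$. Optimal recalibration function: $h^*_{f,P}(z)=\mathbb E_P[Y\mid f(X)=z]$ if $z\in\operatorname{supp}P_{f(X)}$, and $0$ otherwise. $P_Z$ is the law of $Z=f(X)$ under $P$. Recalibration risk: for a probability measure $\mu\in\{P,Q\}$ and $h:[0,1]\to[0,1]$, $R_\mu(h;f)=\mathbb E_\mu\big[(h\circ f(X)-\mathbb E_\mu[Y\mid f(X)])^2\big]$. For data-dependent $h$ the risk is computed with $h$ held fixed (expectation over a fresh $(X,Y)\sim\mu$), so it is a random variable depending on the samples. Uniform-mass binning (UMB): given $z_1,\dots,z_n\in[0,1]$ and $B\in\mathbb N$, the UMB scheme of size $B$ induced by $\{z_i\}$ is $\mathcal B=\{I_1,\dots,I_B\}$ with $I_1=[u_0,u_1]$ and $I_b=(u_{b-1},u_b]$ for $b=2,\dots,B$, where $u_0=0$, $u_B=1$, and $u_b=z_{(\lfloor nb/B\rfloor)}$ for $b\in[B-1]$; $z_{(k)}$ is the $k$-th smallest of the $z_i$. Recalibration function based on $\mathcal B$ and $\mathcal D_P$ (with $z_i=f(x_i)$): $\hat h_P(z)=\sum_{I\in\mathcal B}\hat\mu_I\mathbf 1_I(z)$ with $\hat\mu_I=\dfrac{\sum_{i=1}^{n_P}y_i\mathbf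 1_I(z_i)}{\sum_{i=1}^{n_P}\mathbf 1_I(z_i)}$. Estimated shift correction function: $\hat g(z)=\dfrac{\hat w_1z}{\hat w_1z+\hat w_0(1-z)}$, where $\hat w_k=\hat Q[Y=k]/\hat P[Y=k]$, $\hat P[Y=k]=\frac1{n_P}\sum_{i=1}^{n_P}\mathbf 1[y_i=k]$ and $\hat Q[Y=k]=\frac1{n_Q}\sum_{i=1}^{n_Q}\mathbf 1[y_i'=k]$. The first inequality is asserted whenever the empirical quantities entering it (the ratios $\hat w_k$, $\hat\mu_I$ and the function $\hat g$) are well defined. *)

theory Defs
  imports "HOL-Probability.Probability"
begin

type_synonym labelled = "(nat \<Rightarrow> real) \<times> nat"

text \<open>
  The dimension \<open>d\<close> is a value and not a type, so that the universal constant of the main theorem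
  can be quantified before it. Points of \<open>d\<close>-dimensional real space are extensional functions on
  \<open>{..<d}\<close>; the finite product of the Borel sigma-algebras is the Borel sigma-algebra of that space.
\<close>

definition feature_space :: "nat \<Rightarrow> (nat \<Rightarrow> real) set \<Rightarrow> (nat \<Rightarrow> real) measure" where
  "feature_space d S = restrict_space (\<Pi>\<^sub>M i\<in>{..<d}. borel) S"

definition labelled_law :: "nat \<Rightarrow> (nat \<Rightarrow> real) set \<Rightarrow> labelled measure \<Rightarrow> bool" where
  "labelled_law d S M \<longleftrightarrow>
     prob_space M \<and> sets M = sets (feature_space d S \<Otimes>\<^sub>M count_space {0, 1})"

definition class_prob :: "labelled measure \<Rightarrow> nat \<Rightarrow> real" where
  "class_prob M k = \<P>(\<omega> in M. snd \<omega> = k)"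

definition class_prob_min :: "labelled measure \<Rightarrow> real" where
  "class_prob_min M = min (class_prob M 0) (class_prob M 1)"

definition weight :: "labelled measure \<Rightarrow> labelled measure \<Rightarrow> nat \<Rightarrow> real" where
  "weight P Q k = class_prob Q k / class_prob P k"

definition weight_min :: "labelled measure \<Rightarrow> labelled measure \<Rightarrow> real" where
  "weight_min P Q = min (weight P Q 0) (weight P Q 1)"

definition weight_max :: "labelled measure \<Rightarrow> labelled measure \<Rightarrow> real" where
  "weight_max P Q = max (weight P Q 0) (weight P Q 1)"

definition score_law :: "labelled measure \<Rightarrow> ((nat \<Rightarrow> real) \<Rightarrow> real) \<Rightarrow> real measure" where
  "score_law M f = distr M borel (\<lambda>\<omega>. f (fst \<omega>))"

definition cond_label :: "labelled measure \<Rightarrow> ((nat \<Rightarrow> real) \<Rightarrow> real) \<Rightarrow> labelled \<Rightarrow> real" where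
  "cond_label M f =
     real_cond_exp M (vimage_algebra (space M) (\<lambda>\<omega>. f (fst \<omega>)) borel) (\<lambda>\<omega>. real (snd \<omega>))"

definition recal_risk ::
  "labelled measure \<Rightarrow> (real \<Rightarrow> real) \<Rightarrow> ((nat \<Rightarrow> real) \<Rightarrow> real) \<Rightarrow> real" where
  "recal_risk M h f = (\<integral>\<omega>. (h (f (fst \<omega>)) - cond_label M f \<omega>)\<^sup>2 \<partial>M)"

definition measure_support :: "real measure \<Rightarrow> real set" where
  "measure_support M = {z. \<forall>U. open U \<and> z \<in> U \<longrightarrow> emeasure M U > 0}"

text \<open>
  The map sending \<open>z\<close> to the conditional expectation of the label given the score \<open>z\<close> is determined
  only up to null sets of the score law.  The following predicate says that \<open>h\<close> is one of its
  versions on the support of the score law and \<open>0\<close> elsewhere.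
\<close>

definition optimal_recal ::
  "labelled measure \<Rightarrow> ((nat \<Rightarrow> real) \<Rightarrow> real) \<Rightarrow> (real \<Rightarrow> real) \<Rightarrow> bool" where
  "optimal_recal M f h \<longleftrightarrow>
     h \<in> borel_measurable borel \<and>
     (AE \<omega> in M. h (f (fst \<omega>)) = cond_label M f \<omega>) \<and>
     (\<forall>z. z \<notin> measure_support (score_law M f) \<longrightarrow> h z = 0)"

text \<open>
  Absolute continuity of a real function on the whole line; on \<open>{0..1}\<close> alone it would not exclude
  an atom of the score law at \<open>0\<close>.
\<close>

definition abs_continuous_fun :: "(real \<Rightarrow> real) \<Rightarrow> bool" where
  "abs_continuous_fun F \<longleftrightarrow>
     (\<forall>\<epsilon>>0. \<exists>\<eta>>0. \<forall>(m::nat) (a::nat \<Rightarrow> real) (b::nat \<Rightarrow> real).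
        (\<forall>i<m. a i \<le> b i) \<and> disjoint_family_on (\<lambda>i. {a i<..<b i}) {..<m} \<and>
        (\<Sum>i<m. b i - a i) < \<eta> \<longrightarrow> (\<Sum>i<m. \<bar>F (b i) - F (a i)\<bar>) < \<epsilon>)"

text \<open>
  Uniform-mass binning of \<open>z 0, \<dots>, z (n - 1)\<close>.  Order statistics are numbered from \<open>1\<close>; \<open>umb_bin\<close>
  is meant for \<open>b\<close> between \<open>1\<close> and \<open>B\<close>.
\<close>

definition order_stat :: "nat \<Rightarrow> (nat \<Rightarrow> real) \<Rightarrow> nat \<Rightarrow> real" where
  "order_stat n z k = sort (map z [0..<n]) ! (k - 1)"

definition umb_edge :: "nat \<Rightarrow> (nat \<Rightarrow> real) \<Rightarrow> nat \<Rightarrow> nat \<Rightarrow> real" where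
  "umb_edge n z B b =
     (if b = 0 then 0 else if b = B then 1 else order_stat n z (n * b div B))"

definition umb_bin :: "nat \<Rightarrow> (nat \<Rightarrow> real) \<Rightarrow> nat \<Rightarrow> nat \<Rightarrow> real set" where
  "umb_bin n z B b =
     (if b = 1 then {umb_edge n z B 0..umb_edge n z B 1}
      else {umb_edge n z B (b - 1)<..umb_edge n z B b})"

definition data_bin ::
  "((nat \<Rightarrow> real) \<Rightarrow> real) \<Rightarrow> nat \<Rightarrow> (nat \<Rightarrow> labelled) \<Rightarrow> nat \<Rightarrow> nat \<Rightarrow> real set" where
  "data_bin f n D B b = umb_bin n (\<lambda>i. f (fst (D i))) B b"

definition bin_count ::
  "((nat \<Rightarrow> real) \<Rightarrow> real) \<Rightarrow> nat \<Rightarrow> (nat \<Rightarrow> labelled) \<Rightarrow> nat \<Rightarrow> nat \<Rightarrow> real" where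
  "bin_count f n D B b = (\<Sum>i<n. indicator (data_bin f n D B b) (f (fst (D i))))"

definition bin_mean ::
  "((nat \<Rightarrow> real) \<Rightarrow> real) \<Rightarrow> nat \<Rightarrow> (nat \<Rightarrow> labelled) \<Rightarrow> nat \<Rightarrow> nat \<Rightarrow> real" where
  "bin_mean f n D B b =
     (\<Sum>i<n. real (snd (D i)) * indicator (data_bin f n D B b) (f (fst (D i))))
       / bin_count f n D B b"

definition recal_est ::
  "((nat \<Rightarrow> real) \<Rightarrow> real) \<Rightarrow> nat \<Rightarrow> (nat \<Rightarrow> labelled) \<Rightarrow> nat \<Rightarrow> real \<Rightarrow> real" where
  "recal_est f n D B z = (\<Sum>b=1..B. bin_mean f n D B b * indicator (data_bin f n D B b) z)"

definition emp_class_prob :: "nat \<Rightarrow> (nat \<Rightarrow> labelled) \<Rightarrow> nat \<Rightarrow> real" where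
  "emp_class_prob n D k = (\<Sum>i<n. of_bool (snd (D i) = k)) / real n"

definition weight_est ::
  "nat \<Rightarrow> (nat \<Rightarrow> labelled) \<Rightarrow> nat \<Rightarrow> (nat \<Rightarrow> labelled) \<Rightarrow> nat \<Rightarrow> real" where
  "weight_est nP DP nQ DQ k = emp_class_prob nQ DQ k / emp_class_prob nP DP k"

definition shift_correction :: "(nat \<Rightarrow> real) \<Rightarrow> real \<Rightarrow> real" where
  "shift_correction w z = w 1 * z / (w 1 * z + w 0 * (1 - z))"

text \<open>
  Every denominator in the weight estimates, the bin means and the estimated shift correction (as a
  function on \<open>{0..1}\<close>) is nonzero.
\<close>

definition estimators_defined ::
  "((nat \<Rightarrow> real) \<Rightarrow> real) \<Rightarrow> nat \<Rightarrow> nat \<Rightarrow> (nat \<Rightarrow> labelled) \<Rightarrow> nat \<Rightarrow> (nat \<Rightarrow> labelled) \<Rightarrow> bool" where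
  "estimators_defined f B nP DP nQ DQ \<longleftrightarrow>
     nP > 0 \<and> nQ > 0 \<and>
     (\<forall>k\<in>{0, 1}. emp_class_prob nP DP k \<noteq> 0) \<and>
     (\<forall>b\<in>{1..B}. bin_count f nP DP B b \<noteq> 0) \<and>
     (\<forall>z\<in>{0..1}. weight_est nP DP nQ DQ 1 * z + weight_est nP DP nQ DQ 0 * (1 - z) \<noteq> 0)"

text \<open>
  \<open>J\<close> is the joint law of an IID sample of size \<open>nP\<close> from \<open>P\<close> and an IID sample of size \<open>nQ\<close> from
  \<open>Q\<close>.  Nothing is assumed about the dependence between the two samples.
\<close>

definition iid_samples_law ::
  "labelled measure \<Rightarrow> nat \<Rightarrow> labelled measure \<Rightarrow> nat
     \<Rightarrow> ((nat \<Rightarrow> labelled) \<times> (nat \<Rightarrow> labelled)) measure \<Rightarrow> bool" where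
  "iid_samples_law P nP Q nQ J \<longleftrightarrow>
     prob_space J \<and>
     sets J = sets ((\<Pi>\<^sub>M i\<in>{..<nP}. P) \<Otimes>\<^sub>M (\<Pi>\<^sub>M i\<in>{..<nQ}. Q)) \<and>
     distr J (\<Pi>\<^sub>M i\<in>{..<nP}. P) fst = (\<Pi>\<^sub>M i\<in>{..<nP}. P) \<and>
     distr J (\<Pi>\<^sub>M i\<in>{..<nQ}. Q) snd = (\<Pi>\<^sub>M i\<in>{..<nQ}. Q)"

end

theory Submission
  imports Defs
begin

text \<open>
  Under label shift \<open>Q\<close> has density \<open>w\<^sup>*\<^sub>Y\<close> with respect to \<open>P\<close>, so \<open>E\<^sub>Q[Y | f(X)]\<close> is the exact shift correction
  \<open>g\<close> of \<open>E\<^sub>P[Y | f(X)]\<close>, and the risk of the estimated correction splits into the uniform distance of the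
  two corrections and the \<open>P\<close>-risk transported through \<open>g\<close>.

  For the \<open>P\<close>-risk, fix the sample points at the two edges of a bin.  The remaining points are
  independent, and the event that these two have the prescribed ranks depends on the others only
  through their position relative to the bin.  Multiplying by an exponential tilt that acts inside the bin
  and does not increase its mass therefore does not increase the probability of that event, which is
  Hoeffding's inequality conditionally on the edges.  The bins have mass at most \<open>4/B\<close>
  because each of the \<open>B\<close> deterministic quantile cells of mass \<open>1/B\<close> receives more than half of its expected number
  of points, and inside a bin of mass \<open>p\<close> the regression function varies by at most \<open>K p\<close>.
\<close>

section \<open>Order statistics and uniform-mass bins\<close>

text \<open>The obstacle is that one sample determines both the bins and the averages inside them,
  while the edges take values in a continuum, so that fixing their values is conditioning on null
  events. No conditional law is ever formed: the event is indexed by which sample points are the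
  edges, their coordinates are held fixed by Fubini, and Markov's inequality is applied to a sum of
  weights over all index pairs. A sample point that is the upper edge belongs to its bin, but its
  own label cannot be tilted; leaving it out costs one observation and at most one unit in the label
  sum, which is where floor(n/B) - 1 and the summand 1/floor(n/B) come from. The failure probability
  is spent as \<delta>/4 on the bin averages, \<delta>/4 on the quantile cells and \<delta>/8 on the
  class frequencies of each sample. The frequencies are controlled relative to the rarer class with
  error \<epsilon>, where \<epsilon>^2 is 4 ln (16/\<delta>) times the maximum in the last term of
  the bound; the sample size conditions with 27 keep \<epsilon> below 1. Every failure event lives
  on one sample alone, so a union bound joins them.\<close>

lemma sorted_nth_le_iff:
  fixes xs :: "'a::linorder list"
  assumes "sorted xs" "j < length xs"
  shows "xs ! j \<le> c \<longleftrightarrow> j < length (filter (\<lambda>x. x \<le> c) xs)"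
  using assms
proof (induction xs arbitrary: j)
  case (Cons x xs)
  show ?case
  proof (cases "x \<le> c")
    case True
    then show ?thesis using Cons by (cases j) auto
  next
    case False
    then have "filter (\<lambda>x. x \<le> c) xs = []"
      using Cons.prems by (force simp: filter_empty_conv)
    moreover have "\<not> (x # xs) ! j \<le> c"
    proof (cases j)
      case (Suc i)
      then have "xs ! i \<in> set xs" using Cons.prems by simp
      then show ?thesis using Cons.prems False Suc by (auto simp: not_le intro: less_le_trans)
    qed (use False in simp)
    ultimately show ?thesis using False by simp
  qed
qed simp

lemma sort_map_nth_le_iff:
  fixes z :: "nat \<Rightarrow> real"
  assumes "j < n"
  shows "sort (map z [0..<n]) ! j \<le> c \<longleftrightarrow> j < card {i. i < n \<and> z i \<le> c}"
proof -
  have "length (filter (\<lambda>x. x \<le> c) (sort (map z [0..<n])))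
      = length (filter (\<lambda>x. x \<le> c) (map z [0..<n]))"
    by (metis mset_filter mset_sort size_mset)
  also have "\<dots> = card {i. i < n \<and> z i \<le> c}"
    by (simp add: length_filter_conv_card cong: conj_cong)
  finally show ?thesis
    using sorted_nth_le_iff[of "sort (map z [0..<n])" j c] assms by simp
qed

text \<open>Galois connection between order statistics and counting. The ranks of the edges, and
  through them the bin counts, as well as the measurability of the edges rest on it.\<close>

lemma order_stat_le_iff:
  assumes "1 \<le> k" "k \<le> n"
  shows "order_stat n z k \<le> c \<longleftrightarrow> k \<le> card {i. i < n \<and> z i \<le> c}"
  unfolding order_stat_def using assms by (subst sort_map_nth_le_iff) auto

lemma order_stat_eq_obtain:
  assumes "0 < n" "k \<le> n"
  obtains i where "i < n" "order_stat n z k = z i"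
proof -
  have "order_stat n z k \<in> set (sort (map z [0..<n]))"
    unfolding order_stat_def by (intro nth_mem) (use assms in auto)
  then show ?thesis using that by auto
qed

lemma order_stat_mono:
  assumes "0 < n" "k \<le> l" "l \<le> n"
  shows "order_stat n z k \<le> order_stat n z l"
  unfolding order_stat_def by (intro sorted_nth_mono) (use assms in auto)

lemma order_stat_strict_mono:
  assumes "inj_on z {..<n}" "1 \<le> k" "k < l" "l \<le> n"
  shows "order_stat n z k < order_stat n z l"
proof -
  have "distinct (sort (map z [0..<n]))"
    using assms(1) by (simp add: distinct_map atLeast_upt lessThan_atLeast0)
  then have "order_stat n z k \<noteq> order_stat n z l"
    unfolding order_stat_def using assms by (subst nth_eq_iff_index_eq) auto
  moreover have "order_stat n z k \<le> order_stat n z l"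
    using assms by (intro order_stat_mono) auto
  ultimately show ?thesis by simp
qed

text \<open>If more than \<open>k\<close> points lay at or below the \<open>k\<close>-th one, the
  next order statistic would lie there too, which strict monotonicity excludes. Ties could make the
  count larger, hence the injectivity.\<close>

lemma order_stat_rank:
  assumes inj: "inj_on z {..<n}" and k: "1 \<le> k" "k \<le> n" and i: "order_stat n z k = z i"
  shows "card {l. l < n \<and> z l \<le> z i} = k"
proof (rule antisym)
  show "k \<le> card {l. l < n \<and> z l \<le> z i}"
    using order_stat_le_iff[OF k, of z "z i"] i by simp
  show "card {l. l < n \<and> z l \<le> z i} \<le> k"
  proof (rule ccontr)
    assume *: "\<not> ?thesis"
    have "card {l. l < n \<and> z l \<le> z i} \<le> card {..<n}"
      by (intro card_mono) auto
    then have "order_stat n z (Suc k) \<le> z i" "Suc k \<le> n"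
      using order_stat_le_iff[of "Suc k" n z "z i"] * by auto
    then show False
      using order_stat_strict_mono[OF inj k(1), of "Suc k"] i by simp
  qed
qed

lemma umb_edge_0 [simp]: "umb_edge n z B 0 = 0"
  by (simp add: umb_edge_def)

lemma umb_edge_last [simp]: "0 < B \<Longrightarrow> umb_edge n z B B = 1"
  by (simp add: umb_edge_def)

lemma mult_div_le_self: "b \<le> B \<Longrightarrow> n * b div B \<le> (n::nat)"
  using div_le_mono[of "n * b" "n * B" B] by (cases "B = 0") auto

context
  fixes n B :: nat and z :: "nat \<Rightarrow> real"
  assumes n_pos: "0 < n" and B_pos: "0 < B" and z01: "\<And>i. i < n \<Longrightarrow> z i \<in> {0..1}"
begin

lemma umb_edge_range:
  assumes "b \<le> B"
  shows "umb_edge n z B b \<in> {0..1}"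
proof -
  obtain i where "i < n" "order_stat n z (n * b div B) = z i"
    using order_stat_eq_obtain[OF n_pos mult_div_le_self[OF assms]] .
  then show ?thesis using z01[of i] by (simp add: umb_edge_def)
qed

lemma umb_edge_mono:
  assumes "b \<le> b'" "b' \<le> B"
  shows "umb_edge n z B b \<le> umb_edge n z B b'"
proof (cases "b = 0 \<or> b' = B")
  case True
  then show ?thesis using umb_edge_range[of b'] umb_edge_range[of b] assms B_pos by auto
next
  case False
  then show ?thesis
    unfolding umb_edge_def using assms n_pos
    by (auto intro!: order_stat_mono div_le_mono mult_div_le_self)
qed

text \<open>The bin is the one whose right edge is the first to reach \<open>x\<close>. Together
  with the monotone edges this makes the bins a partition of the unit interval for every nonempty
  sample, also with ties or with fewer points than bins, when some bins are empty.\<close>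

lemma umb_bin_exists:
  assumes "x \<in> {0..1}"
  obtains b where "b \<in> {1..B}" "x \<in> umb_bin n z B b"
proof -
  define b where "b = (LEAST b. 1 \<le> b \<and> x \<le> umb_edge n z B b)"
  have B: "1 \<le> B \<and> x \<le> umb_edge n z B B" using assms B_pos by simp
  have b: "1 \<le> b \<and> x \<le> umb_edge n z B b" unfolding b_def by (rule LeastI[of _ B]) (rule B)
  have "b \<le> B" unfolding b_def by (rule Least_le) (rule B)
  moreover have "x \<in> umb_bin n z B b"
  proof (cases "b = 1")
    case True then show ?thesis using b assms by (simp add: umb_bin_def)
  next
    case False
    then have "\<not> (1 \<le> b - 1 \<and> x \<le> umb_edge n z B (b - 1))"
      using b not_less_Least[of "b - 1" "\<lambda>b. 1 \<le> b \<and> x \<le> umb_edge n z B b"]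
      unfolding b_def[symmetric] by auto
    then show ?thesis using b False by (auto simp: umb_bin_def)
  qed
  ultimately show ?thesis using b that by auto
qed

lemma umb_bin_unique:
  assumes "x \<in> umb_bin n z B b" "x \<in> umb_bin n z B b'" "b \<in> {1..B}" "b' \<in> {1..B}"
  shows "b = b'"
proof -
  have False if "x \<in> umb_bin n z B b" "x \<in> umb_bin n z B b'" "b \<in> {1..B}" "b' \<in> {1..B}" "b < b'"
    for b b'
  proof -
    have "b' \<noteq> 1" using that by auto
    have "b \<le> b' - 1" "b' - 1 \<le> B" using that by auto
    then have "umb_edge n z B b \<le> umb_edge n z B (b' - 1)" by (rule umb_edge_mono)
    moreover have "umb_edge n z B (b' - 1) < x" using that \<open>b' \<noteq> 1\<close> by (simp add: umb_bin_def)
    moreover have "x \<le> umb_edge n z B b" using that by (simp add: umb_bin_def split: if_splits)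
    ultimately show False by simp
  qed
  then show ?thesis using assms by (metis nat_neq_iff)
qed

lemma umb_bin_sum:
  assumes "b \<in> {1..B}" "x \<in> umb_bin n z B b"
  shows "(\<Sum>b=1..B. c b * indicator (umb_bin n z B b) x) = (c b :: real)"
proof -
  have "(\<Sum>b=1..B. c b * indicator (umb_bin n z B b) x) = (\<Sum>b'=1..B. if b' = b then c b else 0)"
    using assms umb_bin_unique[of x] by (intro sum.cong) (auto simp: indicator_def)
  then show ?thesis using assms by simp
qed

lemma umb_bin_iff:
  assumes "x \<in> {0..1}" "b \<in> {1..B}"
  shows "x \<in> umb_bin n z B b \<longleftrightarrow>
    (if b = 1 then -1 else umb_edge n z B (b - 1)) < x \<and> x \<le> (if b = B then 1 else umb_edge n z B b)"
  using assms by (auto simp: umb_bin_def)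

end

lemma umb_edge_rank:
  assumes "inj_on z {..<n}" "B \<le> n" "0 < b" "b < B"
  obtains i where "i < n" "umb_edge n z B b = z i" "card {l. l < n \<and> z l \<le> z i} = n * b div B"
proof -
  \<comment> \<open>This makes the rank at least 1. Number 0 would silently denote the smallest
    point, because \<open>k - 1\<close> truncates.\<close>
  have "B \<le> n * b" using assms mult_le_mono[of B n 1 b] by simp
  then have k: "1 \<le> n * b div B" "n * b div B \<le> n"
    using assms by (auto simp: div_greater_zero_iff Suc_le_eq intro!: mult_div_le_self)
  obtain i where i: "i < n" "order_stat n z (n * b div B) = z i"
    using order_stat_eq_obtain[of n "n * b div B" z] k assms by auto
  show ?thesis
    by (rule that[OF i(1)]) (use order_stat_rank[OF assms(1) k i(2)] i assms in \<open>auto simp: umb_edge_def\<close>)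
qed

lemma card_between:
  fixes z :: "nat \<Rightarrow> real"
  assumes "u \<le> v"
  shows "card {l. l < n \<and> u < z l \<and> z l \<le> v}
    = card {l. l < n \<and> z l \<le> v} - card {l. l < n \<and> z l \<le> u}"
proof -
  have "{l. l < n \<and> u < z l \<and> z l \<le> v} = {l. l < n \<and> z l \<le> v} - {l. l < n \<and> z l \<le> u}"
    by auto
  moreover have "{l. l < n \<and> z l \<le> u} \<subseteq> {l. l < n \<and> z l \<le> v}"
    using assms by auto
  ultimately show ?thesis by (simp add: card_Diff_subset)
qed

text \<open>Rounding down a sum differs from rounding down its summands by at most one unit, so
  every bin holds floor(n/B) or floor(n/B) + 1 points. The lower bound serves the concentration of
  the averages, the upper one the bound on the bin masses.\<close>

lemma div_increment:
  fixes n b B :: nat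
  assumes "0 < B" "1 \<le> b"
  shows "n div B \<le> n * b div B - n * (b - 1) div B"
    and "n * b div B - n * (b - 1) div B \<le> n div B + 1"
proof -
  obtain a where [simp]: "b = Suc a" using assms by (cases b) auto
  have "(n + n * a) div B = n div B + n * a div B + (n mod B + n * a mod B) div B"
    by (rule div_add1_eq)
  moreover have "n mod B + n * a mod B < 2 * B"
    using assms mod_less_divisor[of B n] mod_less_divisor[of B "n * a"] by linarith
  then have "(n mod B + n * a mod B) div B \<le> 1"
    using less_mult_imp_div_less[of _ 2 B] by fastforce
  ultimately show "n div B \<le> n * b div B - n * (b - 1) div B"
    "n * b div B - n * (b - 1) div B \<le> n div B + 1" by auto
qed

section \<open>Binomial tails\<close>

lemma exp_le_quadratic:
  fixes x :: real
  assumes "\<bar>x\<bar> \<le> 1"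
  shows "exp x \<le> 1 + x + x\<^sup>2"
proof (cases "0 \<le> x")
  case True
  then show ?thesis using exp_bound[of x] assms by auto
next
  case False
  define y where "y = - x"
  have y: "0 \<le> y" using False by (simp add: y_def)
  have "1 + y + y\<^sup>2 / 2 \<le> exp y" using y by (rule exp_lower_Taylor_quadratic)
  \<comment> \<open>For x = -y the claim reads 1 \<le> exp y (1 - y + y^2); replacing
    \<open>exp y\<close> by its second-order Taylor bound leaves 1 plus nonnegative terms.\<close>
  have "1 \<le> (1 + y + y\<^sup>2 / 2) * (1 - y + y\<^sup>2)"
  proof -
    have "(1 + y + y\<^sup>2 / 2) * (1 - y + y\<^sup>2) = 1 + y\<^sup>2 / 2 + y ^ 3 / 2 + y ^ 4 / 2"
      by (simp add: field_simps power2_eq_square power3_eq_cube power4_eq_xxxx)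
    then show ?thesis using y by simp
  qed
  also have "\<dots> \<le> exp y * (1 - y + y\<^sup>2)"
  proof (intro mult_right_mono)
    have "0 \<le> (y - 1/2)\<^sup>2 + 3/4" by simp
    then show "0 \<le> 1 - y + y\<^sup>2" by (simp add: power2_eq_square algebra_simps)
  qed fact
  finally show ?thesis by (simp add: y_def exp_minus field_simps)
qed

context prob_space
begin

text \<open>Each factor 1 + p (e^c - 1) is at most exp (p (e^c - 1)), the Poisson bound, so that
  both tails need only an estimate of e^c.\<close>

lemma binomial_mgf:
  fixes c :: real
  assumes A [measurable]: "A \<in> events"
  shows "(\<integral>\<^sup>+x. ennreal (exp (c * (\<Sum>l<n. indicator A (x l)))) \<partial>(\<Pi>\<^sub>M i\<in>{..<n::nat}. M))
    \<le> ennreal (exp (real n * prob A * (exp c - 1)))"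
proof -
  interpret product_sigma_finite "\<lambda>_::nat. M" by standard
  have "(\<integral>\<^sup>+x. ennreal (exp (c * (\<Sum>l<n. indicator A (x l)))) \<partial>(\<Pi>\<^sub>M i\<in>{..<n::nat}. M))
      = (\<integral>\<^sup>+x. (\<Prod>l<n. ennreal (exp (c * indicator A (x l)))) \<partial>(\<Pi>\<^sub>M i\<in>{..<n::nat}. M))"
  proof (rule nn_integral_cong)
    fix x :: "nat \<Rightarrow> 'a"
    have "exp (c * (\<Sum>l<n. indicator A (x l))) = (\<Prod>l<n. exp (c * indicator A (x l)))"
      unfolding sum_distrib_left by (rule exp_sum) simp
    then show "ennreal (exp (c * (\<Sum>l<n. indicator A (x l)))) = (\<Prod>l<n. ennreal (exp (c * indicator A (x l))))"
      by (simp only: prod_ennreal[OF exp_ge_zero])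
  qed
  also have "\<dots> = (\<Prod>l<n. \<integral>\<^sup>+\<omega>. ennreal (exp (c * indicator A \<omega>)) \<partial>M)"
    by (rule product_nn_integral_prod) auto
  also have "(\<integral>\<^sup>+\<omega>. ennreal (exp (c * indicator A \<omega>)) \<partial>M) = ennreal (1 + prob A * (exp c - 1))"
  proof -
    have int0: "integrable M (\<lambda>\<omega>. (exp c - 1) * indicator A \<omega>)"
      by (intro integrable_mult_right integrable_real_indicator) (auto simp: emeasure_eq_measure)
    then have int: "integrable M (\<lambda>\<omega>. 1 + (exp c - 1) * indicator A \<omega>)"
      by (intro Bochner_Integration.integrable_add integrable_const)
    have "(\<integral>\<^sup>+\<omega>. ennreal (exp (c * indicator A \<omega>)) \<partial>M)
        = (\<integral>\<^sup>+\<omega>. ennreal (1 + (exp c - 1) * indicator A \<omega>) \<partial>M)"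
      by (intro nn_integral_cong) (auto simp: indicator_def)
    also have "\<dots> = ennreal (\<integral>\<omega>. 1 + (exp c - 1) * indicator A \<omega> \<partial>M)"
      using int by (intro nn_integral_eq_integral) (auto intro!: AE_I2 simp: indicator_def)
    also have "(\<integral>\<omega>. 1 + (exp c - 1) * indicator A \<omega> \<partial>M) = 1 + prob A * (exp c - 1)"
      using int0 by (subst Bochner_Integration.integral_add) (auto simp: prob_space)
    finally show ?thesis .
  qed
  also have "(\<Prod>l<n. ennreal (1 + prob A * (exp c - 1))) = ennreal ((1 + prob A * (exp c - 1)) ^ n)"
  proof -
    have "0 \<le> 1 - prob A + prob A * exp c" using prob_le_1[of A] by (intro add_nonneg_nonneg) auto
    then show ?thesis by (simp add: ennreal_power algebra_simps)
  qed
  also have "\<dots> \<le> ennreal (exp (prob A * (exp c - 1)) ^ n)"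
  proof (intro ennreal_leI power_mono)
    have "0 \<le> 1 - prob A + prob A * exp c" using prob_le_1[of A] by (intro add_nonneg_nonneg) auto
    then show "0 \<le> 1 + prob A * (exp c - 1)" by (simp add: algebra_simps)
  qed (use exp_ge_add_one_self in auto)
  also have "exp (prob A * (exp c - 1)) ^ n = exp (real n * prob A * (exp c - 1))"
    by (simp add: exp_of_nat_mult[symmetric] mult.assoc)
  finally show ?thesis .
qed

text \<open>Chernoff's method with the quadratic bound on \<open>exp\<close>. The sign of the
  deviation is \<sigma>, so one proof gives both tails with the same constant 1/4.\<close>

lemma binomial_tail:
  fixes \<sigma> \<epsilon> :: real
  assumes A [measurable]: "A \<in> events" and \<epsilon>: "0 \<le> \<epsilon>" "\<epsilon> \<le> 1" and \<sigma>: "\<sigma> = 1 \<or> \<sigma> = -1"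
  shows "emeasure (\<Pi>\<^sub>M i\<in>{..<n::nat}. M)
      {x \<in> space (\<Pi>\<^sub>M i\<in>{..<n}. M). \<epsilon> * (real n * prob A) \<le> \<sigma> * ((\<Sum>l<n. indicator A (x l)) - real n * prob A)}
    \<le> ennreal (exp (- (real n * prob A * \<epsilon>\<^sup>2 / 4)))"
    (is "emeasure ?S ?X \<le> _")
proof -
  define a where "a = real n * prob A"
  \<comment> \<open>With a the expected count and s = \<sigma> c, the exponent is at most a (s^2 -
    \<epsilon> s); s = \<epsilon>/2 minimises this and leaves -a \<epsilon>^2 / 4.\<close>
  define c where "c = \<sigma> * (\<epsilon> / 2)"
  define k where "k = exp (- c * a - \<epsilon>\<^sup>2 / 2 * a)"
  let ?N = "\<lambda>x. \<Sum>l<n. indicator A (x l) :: real"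
  have a0: "0 \<le> a" by (simp add: a_def)
  have \<sigma>2: "\<sigma> * \<sigma> = 1" using \<sigma> by auto
  have "emeasure ?S ?X \<le> emeasure ?S {x \<in> space ?S. 1 \<le> ennreal k * ennreal (exp (c * ?N x))}"
  proof (intro emeasure_mono subsetI)
    fix x assume x: "x \<in> ?X"
    then have "\<epsilon> * a * (\<epsilon> / 2) \<le> \<sigma> * (?N x - a) * (\<epsilon> / 2)"
      unfolding a_def using \<epsilon> by (intro mult_right_mono) auto
    then have "0 \<le> - c * a - \<epsilon>\<^sup>2 / 2 * a + c * ?N x"
      by (simp add: c_def power2_eq_square algebra_simps)
    then have "1 \<le> k * exp (c * ?N x)"
      unfolding k_def by (simp flip: exp_add)
    then show "x \<in> {x \<in> space ?S. 1 \<le> ennreal k * ennreal (exp (c * ?N x))}"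
      using x by (simp add: k_def flip: ennreal_mult)
  qed measurable
  also have "\<dots> \<le> ennreal k * (\<integral>\<^sup>+x. ennreal (exp (c * ?N x)) * indicator (space ?S) x \<partial>?S)"
    by (intro nn_integral_Markov_inequality) measurable
  also have "\<dots> \<le> ennreal k * ennreal (exp (a * (exp c - 1)))"
  proof (intro mult_left_mono)
    have "(\<integral>\<^sup>+x. ennreal (exp (c * ?N x)) * indicator (space ?S) x \<partial>?S) = (\<integral>\<^sup>+x. ennreal (exp (c * ?N x)) \<partial>?S)"
      by (intro nn_integral_cong) auto
    then show "(\<integral>\<^sup>+x. ennreal (exp (c * ?N x)) * indicator (space ?S) x \<partial>?S) \<le> ennreal (exp (a * (exp c - 1)))"
      using binomial_mgf[OF A, where c = c and n = n] by (simp add: a_def)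
  qed simp
  also have "\<dots> = ennreal (exp (- c * a - \<epsilon>\<^sup>2 / 2 * a + a * (exp c - 1)))"
    by (simp add: k_def exp_add flip: ennreal_mult)
  also have "\<dots> \<le> ennreal (exp (- (a * \<epsilon>\<^sup>2 / 4)))"
  proof (intro ennreal_leI, subst exp_le_cancel_iff)
    have "\<bar>c\<bar> \<le> 1" using \<epsilon> \<sigma> by (auto simp: c_def)
    then have "exp c \<le> 1 + c + c\<^sup>2" by (rule exp_le_quadratic)
    moreover have "c\<^sup>2 = \<epsilon>\<^sup>2 / 4" using \<sigma>2 by (simp add: c_def power2_eq_square algebra_simps)
    ultimately have "exp c - 1 \<le> c + \<epsilon>\<^sup>2 / 4" by simp
    then have "a * (exp c - 1) \<le> a * (c + \<epsilon>\<^sup>2 / 4)" using a0 by (rule mult_left_mono)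
    then show "- c * a - \<epsilon>\<^sup>2 / 2 * a + a * (exp c - 1) \<le> - (a * \<epsilon>\<^sup>2 / 4)"
      by (simp add: algebra_simps)
  qed
  finally show ?thesis by (simp add: a_def)
qed

end

section \<open>Deviation of the bin means\<close>

lemma exp_convex_bound:
  fixes l y :: real
  assumes "y \<in> {0..1}"
  shows "exp (l * y) \<le> 1 - y + y * exp l"
  using convex_onD[OF exp_convex, of y 0 l] assms by (simp add: mult.commute)

text \<open>Hoeffding's lemma for a coin with mean \<open>m\<close>: the left side is the moment
  generating function of the centred coin divided by the sub-Gaussian bound exp (l^2 / 8).\<close>

lemma hoeffding_two_point:
  fixes l m :: real
  assumes "0 \<le> l" "m \<in> {0..1}"
  shows "(1 - m + m * exp l) * exp (- l * m - l\<^sup>2 / 8) \<le> 1"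
proof -
  have pos: "0 < 1 + m * (exp l - 1)"
    using assms by (intro add_pos_nonneg) auto
  have "- l * m + ln (1 + m * (exp l - 1)) \<le> l\<^sup>2 / 8"
    using Hoeffdings_lemma_aux[of l m] assms by auto
  then have "exp (ln (1 + m * (exp l - 1)) + (- l * m - l\<^sup>2 / 8)) \<le> exp 0"
    by (subst exp_le_cancel_iff) simp
  moreover have "exp (ln (1 + m * (exp l - 1)) + (- l * m - l\<^sup>2 / 8))
      = (1 + m * (exp l - 1)) * exp (- l * m - l\<^sup>2 / 8)"
    using pos by (simp only: exp_add exp_ln)
  moreover have "1 + m * (exp l - 1) = 1 - m + m * exp l" by (simp add: algebra_simps)
  ultimately show ?thesis by (simp only: exp_zero)
qed

text \<open>One-coordinate form of the tilting principle: on \<open>A\<close> the function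
  \<open>g\<close> is a constant that factors out, and there \<phi> has at most the mass of
  \<open>A\<close>; elsewhere \<phi> is 1.\<close>

lemma nn_integral_change_on_set:
  assumes [measurable]: "\<phi> \<in> borel_measurable M" "g \<in> borel_measurable M" "A \<in> sets M"
    and out: "\<And>\<omega>. \<omega> \<in> space M - A \<Longrightarrow> \<phi> \<omega> = 1"
    and le: "(\<integral>\<^sup>+\<omega>. indicator A \<omega> * \<phi> \<omega> \<partial>M) \<le> emeasure M A"
    and const: "\<And>\<omega> \<omega>'. \<omega> \<in> A \<Longrightarrow> \<omega>' \<in> A \<Longrightarrow> g \<omega> = (g \<omega>' :: ennreal)"
  shows "(\<integral>\<^sup>+\<omega>. g \<omega> * \<phi> \<omega> \<partial>M) \<le> (\<integral>\<^sup>+\<omega>. g \<omega> \<partial>M)"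
proof -
  obtain c where c: "\<And>\<omega>. \<omega> \<in> A \<Longrightarrow> g \<omega> = c"
    using const by (metis equals0I)
  have "(\<integral>\<^sup>+\<omega>. g \<omega> * \<phi> \<omega> \<partial>M) = (\<integral>\<^sup>+\<omega>. indicator (space M - A) \<omega> * g \<omega> + c * (indicator A \<omega> * \<phi> \<omega>) \<partial>M)"
    using c out by (intro nn_integral_cong) (auto simp: indicator_def)
  also have "\<dots> = (\<integral>\<^sup>+\<omega>. indicator (space M - A) \<omega> * g \<omega> \<partial>M) + c * (\<integral>\<^sup>+\<omega>. indicator A \<omega> * \<phi> \<omega> \<partial>M)"
    by (subst nn_integral_add) (auto simp: nn_integral_cmult)
  also have "\<dots> \<le> (\<integral>\<^sup>+\<omega>. indicator (space M - A) \<omega> * g \<omega> \<partial>M) + c * (\<integral>\<^sup>+\<omega>. indicator A \<omega> \<partial>M)"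
    using le by (intro add_left_mono mult_left_mono) auto
  also have "\<dots> = (\<integral>\<^sup>+\<omega>. indicator (space M - A) \<omega> * g \<omega> + c * indicator A \<omega> \<partial>M)"
    by (subst nn_integral_add) (auto simp: nn_integral_cmult)
  also have "\<dots> = (\<integral>\<^sup>+\<omega>. g \<omega> \<partial>M)"
    using c by (intro nn_integral_cong) (auto simp: indicator_def)
  finally show ?thesis .
qed

lemma sum_of_bool_le_1:
  assumes "finite S" "\<And>i i'. i \<in> S \<Longrightarrow> i' \<in> S \<Longrightarrow> Q i \<Longrightarrow> Q i' \<Longrightarrow> i = i'"
  shows "(\<Sum>i\<in>S. if Q i then 1 else 0 :: ennreal) \<le> 1"
proof (cases "\<exists>i\<in>S. Q i")
  case True
  then obtain i where "i \<in> S" "Q i" by auto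
  then have "(\<Sum>i\<in>S. if Q i then 1 else 0 :: ennreal) = (\<Sum>i'\<in>S. if i' = i then 1 else 0)"
    using assms(2) by (intro sum.cong) auto
  then show ?thesis using assms(1) \<open>i \<in> S\<close> by simp
qed (simp add: sum.neutral)

text \<open>\<open>Y\<close> is a bounded real variable rather than a label, so that the locale can
  be instantiated a second time with 1 - \<open>Y\<close>: lower deviations of the bin averages are
  upper deviations there.\<close>

locale scored_space = prob_space M for M :: "'a measure" +
  fixes Z Y :: "'a \<Rightarrow> real"
  assumes Z_measurable [measurable]: "Z \<in> borel_measurable M"
    and Y_measurable [measurable]: "Y \<in> borel_measurable M"
    and Z_range: "\<omega> \<in> space M \<Longrightarrow> Z \<omega> \<in> {0..1}"
    and Y_range: "\<omega> \<in> space M \<Longrightarrow> Y \<omega> \<in> {0..1}"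
begin

abbreviation samples :: "nat \<Rightarrow> (nat \<Rightarrow> 'a) measure" where
  "samples n \<equiv> \<Pi>\<^sub>M i\<in>{..<n}. M"

sublocale product: product_sigma_finite "\<lambda>_::nat. M"
  by standard

lemma prob_space_samples: "prob_space (samples n)"
  by (rule prob_space_PiM) (rule prob_space_axioms)

definition bmass :: "real \<Rightarrow> real \<Rightarrow> real" where
  "bmass u v = (\<integral>\<omega>. indicator {u<..v} (Z \<omega>) \<partial>M)"

text \<open>Conditional mean of \<open>Y\<close> on an interval of scores. A null interval gets the
  value 0 from division by zero, which keeps the range inside the unit interval.\<close>

definition bavg :: "real \<Rightarrow> real \<Rightarrow> real" where
  "bavg u v = (\<integral>\<omega>. indicator {u<..v} (Z \<omega>) * Y \<omega> \<partial>M) / bmass u v"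

lemma integrable_bounded_Y:
  assumes "g \<in> borel_measurable M" "\<And>\<omega>. \<omega> \<in> space M \<Longrightarrow> \<bar>g \<omega>\<bar> \<le> 1"
  shows "integrable M (g :: 'a \<Rightarrow> real)"
  by (rule integrable_const_bound[where B=1]) (use assms in auto)

lemma integrable_ind [simp]: "integrable M (\<lambda>\<omega>. indicator {u<..v} (Z \<omega>) :: real)"
  by (rule integrable_bounded_Y) (auto simp: indicator_def)

lemma integrable_ind_Y [simp]: "integrable M (\<lambda>\<omega>. indicator {u<..v} (Z \<omega>) * Y \<omega>)"
  using Y_range by (intro integrable_bounded_Y) (auto simp: indicator_def abs_le_iff intro: order_trans[of _ 0])

lemma bmass_eq: "bmass u v = prob {\<omega> \<in> space M. u < Z \<omega> \<and> Z \<omega> \<le> v}"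
proof -
  have "bmass u v = (\<integral>\<omega>. indicator {\<omega> \<in> space M. u < Z \<omega> \<and> Z \<omega> \<le> v} \<omega> \<partial>M)"
    unfolding bmass_def by (intro Bochner_Integration.integral_cong) (auto simp: indicator_def)
  then show ?thesis by simp
qed

lemma bmass_nonneg: "0 \<le> bmass u v" by (simp add: bmass_eq)

lemma ind_Y_le_bmass: "(\<integral>\<omega>. indicator {u<..v} (Z \<omega>) * Y \<omega> \<partial>M) \<le> bmass u v"
  unfolding bmass_def
  using Y_range by (intro integral_mono integrable_ind integrable_ind_Y) (auto simp: indicator_def)

lemma ind_Y_nonneg: "0 \<le> (\<integral>\<omega>. indicator {u<..v} (Z \<omega>) * Y \<omega> \<partial>M)"
  using Y_range by (intro integral_nonneg_AE AE_I2) (auto simp: indicator_def)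

lemma bavg_range: "bavg u v \<in> {0..1}"
  unfolding bavg_def using ind_Y_le_bmass[of u v] ind_Y_nonneg[of u v] bmass_nonneg[of u v]
  by (auto simp: divide_le_eq_1)

lemma bmass_bavg: "bmass u v * bavg u v = (\<integral>\<omega>. indicator {u<..v} (Z \<omega>) * Y \<omega> \<partial>M)"
  using ind_Y_le_bmass[of u v] ind_Y_nonneg[of u v] bmass_nonneg[of u v]
  by (auto simp: bavg_def)

lemma bmass_measurable [measurable]:
  "(\<lambda>x. bmass (fst x) (snd x)) \<in> borel_measurable (borel \<Otimes>\<^sub>M borel)"
  unfolding bmass_def indicator_def greaterThanAtMost_iff by measurable

lemma bavg_measurable [measurable]:
  "(\<lambda>x. bavg (fst x) (snd x)) \<in> borel_measurable (borel \<Otimes>\<^sub>M borel)"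
  unfolding bavg_def indicator_def greaterThanAtMost_iff by measurable

text \<open>Exponential tilt of the centred \<open>Y\<close> inside the interval. The term
  \<theta>^2 / 8 is Hoeffding's normalisation, which for \<theta> \<ge> 0 makes the tilted mass of
  the interval at most its mass.\<close>

definition tilt :: "real \<Rightarrow> real \<Rightarrow> real \<Rightarrow> 'a \<Rightarrow> real" where
  "tilt \<theta> u v \<omega> = (if u < Z \<omega> \<and> Z \<omega> \<le> v then exp (\<theta> * (Y \<omega> - bavg u v) - \<theta>\<^sup>2 / 8) else 1)"

lemma tilt_pos: "0 < tilt \<theta> u v \<omega>" by (simp add: tilt_def)

lemma tilt_measurable [measurable]: "tilt \<theta> u v \<in> borel_measurable M"
  unfolding tilt_def by measurable

text \<open>The chord bound for \<open>exp\<close> makes the integrand affine in \<open>Y\<close>,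
  so its integral depends on the interval only through mass and average; the two-point Hoeffding
  bound then applies.\<close>

lemma nn_integral_tilt_le:
  assumes "0 \<le> \<theta>"
  shows "(\<integral>\<^sup>+\<omega>. indicator {u<..v} (Z \<omega>) * ennreal (tilt \<theta> u v \<omega>) \<partial>M) \<le> ennreal (bmass u v)"
proof -
  let ?m = "bavg u v"
  let ?e = "exp (- \<theta> * ?m - \<theta>\<^sup>2 / 8)"
  let ?g = "\<lambda>\<omega>. (indicator {u<..v} (Z \<omega>) + (exp \<theta> - 1) * (indicator {u<..v} (Z \<omega>) * Y \<omega>)) * ?e"
  have g_nonneg: "0 \<le> ?g \<omega>" if "\<omega> \<in> space M" for \<omega>
    using Y_range[OF that] assms by (auto simp: indicator_def intro!: mult_nonneg_nonneg add_nonneg_nonneg)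
  have "indicator {u<..v} (Z \<omega>) * ennreal (tilt \<theta> u v \<omega>) \<le> ennreal (?g \<omega>)" if \<omega>: "\<omega> \<in> space M" for \<omega>
  proof (cases "Z \<omega> \<in> {u<..v}")
    case True
    have "tilt \<theta> u v \<omega> = exp (\<theta> * Y \<omega>) * ?e"
      using True by (simp add: tilt_def algebra_simps flip: exp_add)
    also have "\<dots> \<le> (1 - Y \<omega> + Y \<omega> * exp \<theta>) * ?e"
      by (intro mult_right_mono exp_convex_bound Y_range \<omega>) auto
    also have "\<dots> = ?g \<omega>" using True by (simp add: algebra_simps)
    finally show ?thesis using True by (simp add: ennreal_leI)
  qed simp
  then have "(\<integral>\<^sup>+\<omega>. indicator {u<..v} (Z \<omega>) * ennreal (tilt \<theta> u v \<omega>) \<partial>M) \<le> (\<integral>\<^sup>+\<omega>. ennreal (?g \<omega>) \<partial>M)"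
    by (intro nn_integral_mono)
  also have "\<dots> = ennreal (\<integral>\<omega>. ?g \<omega> \<partial>M)"
    by (intro nn_integral_eq_integral AE_I2 g_nonneg integrable_mult_left Bochner_Integration.integrable_add
        integrable_mult_right integrable_ind integrable_ind_Y)
  also have "(\<integral>\<omega>. ?g \<omega> \<partial>M) = bmass u v * ((1 - ?m + ?m * exp \<theta>) * ?e)"
    by (simp add: bmass_bavg[symmetric] flip: bmass_def) (simp add: algebra_simps)
  also have "\<dots> \<le> bmass u v * 1"
    by (intro mult_left_mono bmass_nonneg hoeffding_two_point assms bavg_range)
  finally show ?thesis by (simp add: ennreal_leI)
qed

text \<open>Induction over the coordinates, integrating out one at a time. The last hypothesis says
  that \<open>G\<close> cannot distinguish positions of a coordinate inside \<open>A\<close>; this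
  survives integration in another coordinate because updates at different coordinates
  commute.\<close>

lemma nn_integral_change_on_coordinates:
  fixes I :: "nat set"
  assumes "finite I" and [measurable]: "\<phi> \<in> borel_measurable M" "A \<in> sets M"
    and out: "\<And>\<omega>. \<omega> \<in> space M - A \<Longrightarrow> \<phi> \<omega> = 1"
    and le: "(\<integral>\<^sup>+\<omega>. indicator A \<omega> * \<phi> \<omega> \<partial>M) \<le> emeasure M A"
    and "G \<in> borel_measurable (\<Pi>\<^sub>M i\<in>I. M)"
    and "\<And>x i \<omega>. x \<in> space (\<Pi>\<^sub>M i\<in>I. M) \<Longrightarrow> i \<in> I \<Longrightarrow> x i \<in> A \<Longrightarrow> \<omega> \<in> A \<Longrightarrow> G (x(i := \<omega>)) = (G x :: ennreal)"
  shows "(\<integral>\<^sup>+x. G x * (\<Prod>i\<in>I. \<phi> (x i)) \<partial>(\<Pi>\<^sub>M i\<in>I. M)) \<le> (\<integral>\<^sup>+x. G x \<partial>(\<Pi>\<^sub>M i\<in>I. M))"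
  using assms(1,6,7)
proof (induction I arbitrary: G)
  case (insert i I)
  note [measurable] = insert.prems(1)
  have upd [measurable]: "(\<lambda>\<omega>. x(i := \<omega>)) \<in> M \<rightarrow>\<^sub>M (\<Pi>\<^sub>M i\<in>insert i I. M)"
    if "x \<in> space (\<Pi>\<^sub>M i\<in>I. M)" for x
    using measurable_component_update[of x I "\<lambda>_. M" i] that insert.hyps by simp
  have upd2 [measurable]: "(\<lambda>(x, \<omega>). x(i := \<omega>)) \<in> (\<Pi>\<^sub>M i\<in>I. M) \<Otimes>\<^sub>M M \<rightarrow>\<^sub>M (\<Pi>\<^sub>M i\<in>insert i I. M)"
    by (rule measurable_add_dim)
  have upd_space: "x(i := \<omega>) \<in> space (\<Pi>\<^sub>M i\<in>insert i I. M)"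
    if "x \<in> space (\<Pi>\<^sub>M i\<in>I. M)" "\<omega> \<in> space M" for x \<omega>
    using measurable_space[OF upd[OF that(1)] that(2)] .
  define G' where "G' = (\<lambda>x. \<integral>\<^sup>+\<omega>. G (x(i := \<omega>)) \<partial>M)"
  have AM: "\<omega> \<in> space M" if "\<omega> \<in> A" for \<omega> using that sets.sets_into_space[OF assms(3)] by auto
  have "(\<lambda>(x, \<omega>). G (x(i := \<omega>))) \<in> borel_measurable ((\<Pi>\<^sub>M i\<in>I. M) \<Otimes>\<^sub>M M)"
    using measurable_compose[OF upd2 insert.prems(1)] by (simp add: case_prod_beta')
  then have G' [measurable]: "G' \<in> borel_measurable (\<Pi>\<^sub>M i\<in>I. M)"
    unfolding G'_def by (rule borel_measurable_nn_integral)
  have "(\<integral>\<^sup>+x. G x * (\<Prod>i\<in>insert i I. \<phi> (x i)) \<partial>(\<Pi>\<^sub>M i\<in>insert i I. M))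
      = (\<integral>\<^sup>+x. \<integral>\<^sup>+\<omega>. G (x(i := \<omega>)) * (\<Prod>j\<in>insert i I. \<phi> ((x(i := \<omega>)) j)) \<partial>M \<partial>(\<Pi>\<^sub>M i\<in>I. M))"
  proof (rule product.product_nn_integral_insert[OF insert.hyps(1,2)])
    show "(\<lambda>x. G x * (\<Prod>i\<in>insert i I. \<phi> (x i))) \<in> borel_measurable (\<Pi>\<^sub>M i\<in>insert i I. M)"
      by measurable
  qed
  also have "\<dots> = (\<integral>\<^sup>+x. (\<integral>\<^sup>+\<omega>. G (x(i := \<omega>)) * \<phi> \<omega> \<partial>M) * (\<Prod>j\<in>I. \<phi> (x j)) \<partial>(\<Pi>\<^sub>M i\<in>I. M))"
  proof (rule nn_integral_cong)
    fix x assume x: "x \<in> space (\<Pi>\<^sub>M i\<in>I. M)"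
    have "(\<Prod>j\<in>insert i I. \<phi> ((x(i := \<omega>)) j)) = \<phi> \<omega> * (\<Prod>j\<in>I. \<phi> (x j))" for \<omega>
    proof -
      have "(\<Prod>j\<in>I. \<phi> ((x(i := \<omega>)) j)) = (\<Prod>j\<in>I. \<phi> (x j))"
        using insert.hyps by (intro prod.cong) auto
      then show ?thesis using insert.hyps by simp
    qed
    moreover have "(\<lambda>\<omega>. G (x(i := \<omega>))) \<in> borel_measurable M"
      by (rule measurable_compose[OF upd[OF x] insert.prems(1)])
    ultimately show "(\<integral>\<^sup>+\<omega>. G (x(i := \<omega>)) * (\<Prod>j\<in>insert i I. \<phi> ((x(i := \<omega>)) j)) \<partial>M)
        = (\<integral>\<^sup>+\<omega>. G (x(i := \<omega>)) * \<phi> \<omega> \<partial>M) * (\<Prod>j\<in>I. \<phi> (x j))"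
      by (subst nn_integral_multc[symmetric]) (auto simp: mult.assoc)
  qed
  also have "\<dots> \<le> (\<integral>\<^sup>+x. G' x * (\<Prod>j\<in>I. \<phi> (x j)) \<partial>(\<Pi>\<^sub>M i\<in>I. M))"
  proof (intro nn_integral_mono mult_right_mono)
    fix x assume x: "x \<in> space (\<Pi>\<^sub>M i\<in>I. M)"
    show "(\<integral>\<^sup>+\<omega>. G (x(i := \<omega>)) * \<phi> \<omega> \<partial>M) \<le> G' x"
      unfolding G'_def
    proof (rule nn_integral_change_on_set[where A = A])
      show "(\<lambda>\<omega>. G (x(i := \<omega>))) \<in> borel_measurable M"
        by (rule measurable_compose[OF upd[OF x] insert.prems(1)])
      show "G (x(i := \<omega>)) = G (x(i := \<omega>'))" if "\<omega> \<in> A" "\<omega>' \<in> A" for \<omega> \<omega>'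
        using insert.prems(2)[OF upd_space[OF x AM[OF that(2)]], of i \<omega>] that
        by (simp only: fun_upd_same fun_upd_upd insertI1)
    qed (use out le in auto)
  qed simp
  also have "\<dots> \<le> (\<integral>\<^sup>+x. G' x \<partial>(\<Pi>\<^sub>M i\<in>I. M))"
  proof (rule insert.IH[OF G'])
    fix x j \<omega> assume x: "x \<in> space (\<Pi>\<^sub>M i\<in>I. M)" and j: "j \<in> I" and *: "x j \<in> A" "\<omega> \<in> A"
    then have ij: "i \<noteq> j" using insert.hyps by auto
    have "G (x(i := \<omega>', j := \<omega>)) = G (x(i := \<omega>'))" if "\<omega>' \<in> space M" for \<omega>'
      by (rule insert.prems(2)[OF upd_space[OF x that]]) (use j * ij in auto)
    then have "G (x(j := \<omega>, i := \<omega>')) = G (x(i := \<omega>'))" if "\<omega>' \<in> space M" for \<omega>'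
      using that by (simp only: fun_upd_twist[OF ij])
    then show "G' (x(j := \<omega>)) = G' x"
      unfolding G'_def by (intro nn_integral_cong) auto
  qed
  also have "\<dots> = (\<integral>\<^sup>+x. G x \<partial>(\<Pi>\<^sub>M i\<in>insert i I. M))"
    unfolding G'_def using insert.hyps by (subst product.product_nn_integral_insert) auto
  finally show ?case .
qed simp

lemma bavg_measurable_raw [measurable (raw)]:
  assumes [measurable]: "a \<in> borel_measurable N" "b \<in> borel_measurable N"
  shows "(\<lambda>x. bavg (a x) (b x)) \<in> borel_measurable N"
  using measurable_compose[of "\<lambda>x. (a x, b x)" N "borel \<Otimes>\<^sub>M borel", OF _ bavg_measurable] by simp

lemma tilt_measurable_raw [measurable (raw)]:
  assumes [measurable]: "a \<in> borel_measurable N" "b \<in> borel_measurable N" "c \<in> N \<rightarrow>\<^sub>M M"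
  shows "(\<lambda>x. tilt \<theta> (a x) (b x) (c x)) \<in> borel_measurable N"
  unfolding tilt_def by measurable

section \<open>Ranks of the edge points and tilted weights\<close>

definition score_rank :: "nat \<Rightarrow> (nat \<Rightarrow> 'a) \<Rightarrow> nat \<Rightarrow> nat" where
  "score_rank n x i = card {l. l < n \<and> Z (x l) \<le> Z (x i)}"

text \<open>
  The index \<open>n\<close> is a sentinel for the two edges that are not sample points.  The lower one is put at \<open>-1\<close>
  so that the closed first bin becomes half-open without losing scores.
\<close>

definition lower_val :: "nat \<Rightarrow> (nat \<Rightarrow> 'a) \<Rightarrow> nat \<Rightarrow> real" where
  "lower_val n x i = (if i < n then Z (x i) else -1)"

definition upper_val :: "nat \<Rightarrow> (nat \<Rightarrow> 'a) \<Rightarrow> nat \<Rightarrow> real" where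
  "upper_val n x j = (if j < n then Z (x j) else 1)"

definition lower_at :: "nat \<Rightarrow> nat \<Rightarrow> (nat \<Rightarrow> 'a) \<Rightarrow> nat \<Rightarrow> bool" where
  "lower_at n k x i = (if k = 0 then i = n else i < n \<and> score_rank n x i = k)"

definition upper_at :: "nat \<Rightarrow> nat \<Rightarrow> (nat \<Rightarrow> 'a) \<Rightarrow> nat \<Rightarrow> bool" where
  "upper_at n k x j = (if k = n then j = n else j < n \<and> score_rank n x j = k)"

text \<open>The edge points stay outside the product: the interval, and with it every tilt, depends
  on their scores, and only the other points are integrated while the interval is held
  fixed.\<close>

definition edge_weight :: "nat \<Rightarrow> nat \<Rightarrow> nat \<Rightarrow> real \<Rightarrow> nat \<Rightarrow> nat \<Rightarrow> (nat \<Rightarrow> 'a) \<Rightarrow> ennreal" where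
  "edge_weight n k k' \<theta> i j x = (if lower_at n k x i \<and> upper_at n k' x j then 1 else 0)
     * (\<Prod>l\<in>{..<n} - {i, j}. ennreal (tilt \<theta> (lower_val n x i) (upper_val n x j) (x l)))"

lemma rank_eq_sum: "real (score_rank n x i) = (\<Sum>l<n. if Z (x l) \<le> Z (x i) then 1 else 0)"
proof -
  have "{l. l < n \<and> Z (x l) \<le> Z (x i)} = {..<n} \<inter> {l. Z (x l) \<le> Z (x i)}" by auto
  then show ?thesis by (simp add: score_rank_def sum.If_cases)
qed

lemma Z_component_measurable:
  assumes "l < n"
  shows "(\<lambda>x. Z (x l)) \<in> borel_measurable (samples n)"
  using assms by (intro measurable_compose[OF measurable_component_singleton[where M="\<lambda>_. M"] Z_measurable]) auto

lemma rank_pred [measurable]: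
  assumes "i < n"
  shows "Measurable.pred (samples n) (\<lambda>x. score_rank n x i = k)"
proof -
  have [measurable]: "(\<lambda>x. real (score_rank n x i)) \<in> borel_measurable (samples n)"
    unfolding rank_eq_sum
  proof (rule borel_measurable_sum)
    fix l assume "l \<in> {..<n}"
    then have [measurable]: "(\<lambda>x. Z (x l)) \<in> borel_measurable (samples n)"
      "(\<lambda>x. Z (x i)) \<in> borel_measurable (samples n)"
      using assms by (auto intro: Z_component_measurable)
    show "(\<lambda>x. if Z (x l) \<le> Z (x i) then 1 else 0 :: real) \<in> borel_measurable (samples n)"
      by measurable
  qed
  have "Measurable.pred (samples n) (\<lambda>x. real (score_rank n x i) = real k)" by measurable
  then show ?thesis by simp
qed

lemma lower_at_pred [measurable]: "Measurable.pred (samples n) (\<lambda>x. lower_at n k x i)"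
  unfolding lower_at_def by (cases "i < n"; cases "k = 0") auto

lemma upper_at_pred [measurable]: "Measurable.pred (samples n) (\<lambda>x. upper_at n k x i)"
  unfolding upper_at_def by (cases "i < n"; cases "k = n") auto

lemma lower_val_measurable [measurable]: "(\<lambda>x. lower_val n x i) \<in> borel_measurable (samples n)"
  unfolding lower_val_def by (cases "i < n") (auto intro: Z_component_measurable)

lemma upper_val_measurable [measurable]: "(\<lambda>x. upper_val n x i) \<in> borel_measurable (samples n)"
  unfolding upper_val_def by (cases "i < n") (auto intro: Z_component_measurable)

lemma edge_weight_measurable [measurable]: "edge_weight n k k' \<theta> i j \<in> borel_measurable (samples n)"
  unfolding edge_weight_def
proof (intro borel_measurable_times_ennreal borel_measurable_prod_ennreal)
  fix l assume "l \<in> {..<n} - {i, j}"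
  then have [measurable]: "(\<lambda>x. x l) \<in> samples n \<rightarrow>\<^sub>M M"
    by (intro measurable_component_singleton) auto
  show "(\<lambda>x. ennreal (tilt \<theta> (lower_val n x i) (upper_val n x j) (x l))) \<in> borel_measurable (samples n)"
    by measurable
qed measurable

text \<open>A point moving strictly above the lower edge is never counted in the rank of that edge.
  In the companion \<open>rank_upd_below\<close> it moves at or below the upper edge and is always
  counted. Moving inside the half-open bin therefore changes neither rank.\<close>

lemma rank_upd_above:
  assumes "c \<noteq> i" "Z (x i) < Z (x c)" "Z (x i) < Z \<omega>"
  shows "score_rank n (x(c := \<omega>)) i = score_rank n x i"
proof -
  have "{l. l < n \<and> Z ((x(c := \<omega>)) l) \<le> Z (x i)} = {l. l < n \<and> Z (x l) \<le> Z (x i)}"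
    using assms by auto
  then show ?thesis using assms by (simp add: score_rank_def)
qed

lemma rank_upd_below:
  assumes "c \<noteq> i" "Z (x c) \<le> Z (x i)" "Z \<omega> \<le> Z (x i)"
  shows "score_rank n (x(c := \<omega>)) i = score_rank n x i"
proof -
  have "{l. l < n \<and> Z ((x(c := \<omega>)) l) \<le> Z (x i)} = {l. l < n \<and> Z (x l) \<le> Z (x i)}"
    using assms by auto
  then show ?thesis using assms by (simp add: score_rank_def)
qed

lemma rank_inj:
  assumes inj: "inj_on (\<lambda>l. Z (x l)) {..<n}" and "i < n" "j < n" "score_rank n x i = score_rank n x j"
  shows "i = j"
proof -
  have less: "score_rank n x i < score_rank n x j" if "i < n" "j < n" "Z (x i) < Z (x j)" for i j
    unfolding score_rank_def
  proof (rule psubset_card_mono)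
    have "j \<in> {l. l < n \<and> Z (x l) \<le> Z (x j)}" "j \<notin> {l. l < n \<and> Z (x l) \<le> Z (x i)}"
      using that by auto
    moreover have "{l. l < n \<and> Z (x l) \<le> Z (x i)} \<subseteq> {l. l < n \<and> Z (x l) \<le> Z (x j)}"
      using that by auto
    ultimately show "{l. l < n \<and> Z (x l) \<le> Z (x i)} \<subset> {l. l < n \<and> Z (x l) \<le> Z (x j)}"
      by (metis psubsetI)
  qed simp
  have "\<not> Z (x i) < Z (x j)" "\<not> Z (x j) < Z (x i)"
    using less[of i j] less[of j i] assms by auto
  then have "Z (x i) = Z (x j)" by simp
  then show ?thesis using inj_onD[OF inj, of i j] assms by simp
qed

text \<open>Once the coordinates \<open>i\<close> and \<open>j\<close> are fixed, the interval is
  deterministic. The rank event is blind to where a remaining point sits inside it, and the tilts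
  are 1 outside it, so they can be removed one coordinate after another.\<close>

lemma nn_integral_edge_weight_le:
  assumes \<theta>: "0 \<le> \<theta>" and ij: "i \<le> n" "j \<le> n"
  shows "(\<integral>\<^sup>+x. edge_weight n k k' \<theta> i j x \<partial>samples n)
    \<le> (\<integral>\<^sup>+x. (if lower_at n k x i \<and> upper_at n k' x j then 1 else 0) \<partial>samples n)"
proof -
  \<comment> \<open>Intersecting with \<open>{..<n}\<close> discards sentinel indices, so bins with
    one or no sample point as an edge are covered too.\<close>
  define A where "A = {..<n} \<inter> {i, j}"
  define C where "C = {..<n} - {i, j}"
  have AC: "A \<inter> C = {}" "finite A" "finite C" and un: "A \<union> C = {..<n}"
    by (auto simp: A_def C_def)
  let ?I = "\<lambda>x. if lower_at n k x i \<and> upper_at n k' x j then 1 else 0 :: ennreal"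
  have I_meas: "?I \<in> borel_measurable (\<Pi>\<^sub>M i\<in>A \<union> C. M)" unfolding un by measurable
  have w_meas: "edge_weight n k k' \<theta> i j \<in> borel_measurable (\<Pi>\<^sub>M i\<in>A \<union> C. M)"
    unfolding un by measurable
  have "(\<integral>\<^sup>+x. edge_weight n k k' \<theta> i j x \<partial>samples n)
      = (\<integral>\<^sup>+x. \<integral>\<^sup>+y. edge_weight n k k' \<theta> i j (merge A C (x, y)) \<partial>(\<Pi>\<^sub>M i\<in>C. M) \<partial>(\<Pi>\<^sub>M i\<in>A. M))"
    using product.product_nn_integral_fold[OF AC w_meas] un by simp
  also have "\<dots> \<le> (\<integral>\<^sup>+x. \<integral>\<^sup>+y. ?I (merge A C (x, y)) \<partial>(\<Pi>\<^sub>M i\<in>C. M) \<partial>(\<Pi>\<^sub>M i\<in>A. M))"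
  proof (rule nn_integral_mono)
    fix x assume x: "x \<in> space (\<Pi>\<^sub>M i\<in>A. M)"
    define u where "u = lower_val n x i"
    define v where "v = upper_val n x j"
    define J where "J = {\<omega> \<in> space M. u < Z \<omega> \<and> Z \<omega> \<le> v}"
    have J [measurable]: "J \<in> sets M" unfolding J_def by measurable
    have u: "lower_val n (merge A C (x, y)) i = u" for y
      by (auto simp: u_def lower_val_def merge_def A_def)
    have v: "upper_val n (merge A C (x, y)) j = v" for y
      by (auto simp: v_def upper_val_def merge_def A_def)
    have pr: "(\<Prod>l\<in>C. ennreal (tilt \<theta> u v (merge A C (x, y) l))) = (\<Prod>l\<in>C. ennreal (tilt \<theta> u v (y l)))" for y
      using AC by (intro prod.cong) (auto simp: merge_def)
    have "(\<integral>\<^sup>+y. edge_weight n k k' \<theta> i j (merge A C (x, y)) \<partial>(\<Pi>\<^sub>M i\<in>C. M))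
       = (\<integral>\<^sup>+y. ?I (merge A C (x, y)) * (\<Prod>l\<in>C. ennreal (tilt \<theta> u v (y l))) \<partial>(\<Pi>\<^sub>M i\<in>C. M))"
      unfolding edge_weight_def u v C_def[symmetric] pr ..
    also have "\<dots> \<le> (\<integral>\<^sup>+y. ?I (merge A C (x, y)) \<partial>(\<Pi>\<^sub>M i\<in>C. M))"
    proof (rule nn_integral_change_on_coordinates[of C _ J])
      show "ennreal (tilt \<theta> u v \<omega>) = 1" if "\<omega> \<in> space M - J" for \<omega>
        using that by (auto simp: tilt_def J_def)
      have "(\<integral>\<^sup>+\<omega>. indicator J \<omega> * ennreal (tilt \<theta> u v \<omega>) \<partial>M)
          = (\<integral>\<^sup>+\<omega>. indicator {u<..v} (Z \<omega>) * ennreal (tilt \<theta> u v \<omega>) \<partial>M)"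
        by (intro nn_integral_cong) (auto simp: J_def indicator_def)
      also have "\<dots> \<le> ennreal (bmass u v)" by (rule nn_integral_tilt_le[OF \<theta>])
      also have "\<dots> = emeasure M J" by (simp add: bmass_eq J_def emeasure_eq_measure)
      finally show "(\<integral>\<^sup>+\<omega>. indicator J \<omega> * ennreal (tilt \<theta> u v \<omega>) \<partial>M) \<le> emeasure M J" .
      have mg: "(\<lambda>y. merge A C (x, y)) \<in> (\<Pi>\<^sub>M i\<in>C. M) \<rightarrow>\<^sub>M (\<Pi>\<^sub>M i\<in>A \<union> C. M)"
        using x by measurable
      show "(\<lambda>y. ?I (merge A C (x, y))) \<in> borel_measurable (\<Pi>\<^sub>M i\<in>C. M)"
        by (rule measurable_compose[OF mg I_meas])
      show "?I (merge A C (x, y(c := \<omega>))) = ?I (merge A C (x, y))"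
        if c: "c \<in> C" "y c \<in> J" "\<omega> \<in> J" for y c \<omega>
      proof -
        let ?x = "merge A C (x, y)"
        have upd: "merge A C (x, y(c := \<omega>)) = ?x(c := \<omega>)"
          using c AC by (auto simp: merge_def fun_eq_iff)
        have xc: "?x c = y c" using c AC by (auto simp: merge_def)
        have cij: "c \<noteq> i" "c \<noteq> j" using c by (auto simp: C_def)
        have "lower_at n k (?x(c := \<omega>)) i = lower_at n k ?x i"
        proof (cases "i < n")
          case True
          then have "Z (?x i) = u" using u[of y] by (simp add: lower_val_def)
          then show ?thesis
            using rank_upd_above[of c i ?x \<omega> n] cij c xc by (simp add: lower_at_def J_def)
        qed (simp add: lower_at_def)
        moreover have "upper_at n k' (?x(c := \<omega>)) j = upper_at n k' ?x j"
        proof (cases "j < n")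
          case True
          then have "Z (?x j) = v" using v[of y] by (simp add: upper_val_def)
          then show ?thesis
            using rank_upd_below[of c j ?x \<omega> n] cij c xc by (simp add: upper_at_def J_def)
        qed (simp add: upper_at_def)
        ultimately show ?thesis by (simp add: upd)
      qed
    qed (use AC in auto)
    finally show "(\<integral>\<^sup>+y. edge_weight n k k' \<theta> i j (merge A C (x, y)) \<partial>(\<Pi>\<^sub>M i\<in>C. M))
      \<le> (\<integral>\<^sup>+y. ?I (merge A C (x, y)) \<partial>(\<Pi>\<^sub>M i\<in>C. M))" .
  qed
  also have "\<dots> = (\<integral>\<^sup>+x. ?I x \<partial>samples n)"
    using product.product_nn_integral_fold[OF AC I_meas] un by simp
  finally show ?thesis .
qed

text \<open>At most one pair of indices has the prescribed ranks, so summing over all pairs costs no union bound.\<close>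

definition dev_weight :: "nat \<Rightarrow> nat \<Rightarrow> nat \<Rightarrow> real \<Rightarrow> real \<Rightarrow> (nat \<Rightarrow> 'a) \<Rightarrow> ennreal" where
  "dev_weight n k k' r t x = ennreal (exp (- (2 * r * t\<^sup>2))) * (\<Sum>i\<le>n. \<Sum>j\<le>n. edge_weight n k k' (4 * t) i j x)"

lemma dev_weight_measurable [measurable]: "dev_weight n k k' r t \<in> borel_measurable (samples n)"
  unfolding dev_weight_def by measurable

lemma nn_integral_dev_weight_le:
  assumes no_ties: "AE x in samples n. inj_on (\<lambda>l. Z (x l)) {..<n}" and t: "0 \<le> t"
  shows "(\<integral>\<^sup>+x. dev_weight n k k' r t x \<partial>samples n) \<le> ennreal (exp (- (2 * r * t\<^sup>2)))"
proof -
  interpret S: prob_space "samples n" by (rule prob_space_samples)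
  let ?L = "\<lambda>x i. if lower_at n k x i then 1 else 0 :: ennreal"
  let ?U = "\<lambda>x i. if upper_at n k' x i then 1 else 0 :: ennreal"
  have "(\<integral>\<^sup>+x. (\<Sum>i\<le>n. \<Sum>j\<le>n. edge_weight n k k' (4 * t) i j x) \<partial>samples n)
      = (\<Sum>i\<le>n. \<Sum>j\<le>n. \<integral>\<^sup>+x. edge_weight n k k' (4 * t) i j x \<partial>samples n)"
    by (simp add: nn_integral_sum)
  also have "\<dots> \<le> (\<Sum>i\<le>n. \<Sum>j\<le>n. \<integral>\<^sup>+x. (if lower_at n k x i \<and> upper_at n k' x j then 1 else 0) \<partial>samples n)"
    using t by (intro sum_mono nn_integral_edge_weight_le) auto
  also have "\<dots> = (\<integral>\<^sup>+x. (\<Sum>i\<le>n. \<Sum>j\<le>n. if lower_at n k x i \<and> upper_at n k' x j then 1 else 0) \<partial>samples n)"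
    by (simp add: nn_integral_sum)
  \<comment> \<open>The double sum factorises into a count of lower indices and a count of upper
    ones; distinct scores bound each count by 1.\<close>
  also have "\<dots> = (\<integral>\<^sup>+x. (\<Sum>i\<le>n. ?L x i) * (\<Sum>j\<le>n. ?U x j) \<partial>samples n)"
    by (intro nn_integral_cong) (auto simp: sum_product intro!: sum.cong)
  also have "\<dots> \<le> (\<integral>\<^sup>+x. 1 \<partial>samples n)"
  proof (rule nn_integral_mono_AE, use no_ties in eventually_elim)
    fix x assume inj: "inj_on (\<lambda>l. Z (x l)) {..<n}"
    have "(\<Sum>i\<le>n. ?L x i) \<le> 1"
      by (rule sum_of_bool_le_1) (use rank_inj[OF inj] in \<open>auto simp: lower_at_def split: if_splits\<close>)
    moreover have "(\<Sum>j\<le>n. ?U x j) \<le> 1"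
      by (rule sum_of_bool_le_1) (use rank_inj[OF inj] in \<open>auto simp: upper_at_def split: if_splits\<close>)
    ultimately show "(\<Sum>i\<le>n. ?L x i) * (\<Sum>j\<le>n. ?U x j) \<le> 1"
      using mult_mono[of _ "1::ennreal" _ 1] by simp
  qed
  also have "\<dots> = 1" by (simp add: S.emeasure_space_1)
  finally have "(\<integral>\<^sup>+x. (\<Sum>i\<le>n. \<Sum>j\<le>n. edge_weight n k k' (4 * t) i j x) \<partial>samples n) \<le> 1" .
  then have "ennreal (exp (- (2 * r * t\<^sup>2))) * (\<integral>\<^sup>+x. (\<Sum>i\<le>n. \<Sum>j\<le>n. edge_weight n k k' (4 * t) i j x) \<partial>samples n)
      \<le> ennreal (exp (- (2 * r * t\<^sup>2))) * 1" by (intro mult_left_mono) auto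
  then show ?thesis unfolding dev_weight_def by (subst nn_integral_cmult) auto
qed

lemma emeasure_dev_weight_le:
  assumes "AE x in samples n. inj_on (\<lambda>l. Z (x l)) {..<n}" "0 \<le> t"
  shows "emeasure (samples n) {x \<in> space (samples n). 1 \<le> dev_weight n k k' r t x}
    \<le> ennreal (exp (- (2 * r * t\<^sup>2)))"
proof -
  have "emeasure (samples n) {x \<in> space (samples n). 1 \<le> 1 * dev_weight n k k' r t x}
      \<le> 1 * (\<integral>\<^sup>+x. dev_weight n k k' r t x * indicator (space (samples n)) x \<partial>samples n)"
    by (intro nn_integral_Markov_inequality) measurable
  also have "\<dots> = (\<integral>\<^sup>+x. dev_weight n k k' r t x \<partial>samples n)"
    by (auto intro!: nn_integral_cong)
  also have "\<dots> \<le> ennreal (exp (- (2 * r * t\<^sup>2)))" by (rule nn_integral_dev_weight_le[OF assms])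
  finally show ?thesis by simp
qed

text \<open>An average excess of \<open>t\<close> over the points of \<open>J\<close> would make the
  product of tilts at least exp (2 |J| t^2), hence \<open>dev_weight\<close> at least 1. The
  parameter 4 t maximises \<theta> t - \<theta>^2 / 8, with value 2 t^2.\<close>

lemma sum_deviation_less:
  assumes small: "dev_weight n k k' r t x < 1"
    and at: "lower_at n k x i" "upper_at n k' x j"
    and J: "J = {l \<in> {..<n} - {i, j}. lower_val n x i < Z (x l) \<and> Z (x l) \<le> upper_val n x j}"
    and r: "r \<le> real (card J)" and t: "0 < t"
  shows "(\<Sum>l\<in>J. Y (x l) - bavg (lower_val n x i) (upper_val n x j)) < real (card J) * t"
proof -
  let ?u = "lower_val n x i" and ?v = "upper_val n x j"
  define S where "S = (\<Sum>l\<in>J. Y (x l) - bavg ?u ?v)"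
  have ij: "i \<le> n" "j \<le> n" using at by (auto simp: lower_at_def upper_at_def split: if_splits)
  have "edge_weight n k k' (4 * t) i j x \<le> (\<Sum>j\<le>n. edge_weight n k k' (4 * t) i j x)"
    by (rule member_le_sum) (use ij in auto)
  also have "\<dots> \<le> (\<Sum>i\<le>n. \<Sum>j\<le>n. edge_weight n k k' (4 * t) i j x)"
    by (rule member_le_sum[of i]) (use ij in auto)
  finally have "ennreal (exp (- (2 * r * t\<^sup>2))) * edge_weight n k k' (4 * t) i j x \<le> dev_weight n k k' r t x"
    unfolding dev_weight_def by (rule mult_left_mono) simp
  with small have *: "ennreal (exp (- (2 * r * t\<^sup>2))) * edge_weight n k k' (4 * t) i j x < 1" by simp
  have "(\<Prod>l\<in>{..<n} - {i, j}. tilt (4 * t) ?u ?v (x l)) = (\<Prod>l\<in>J. tilt (4 * t) ?u ?v (x l))"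
    unfolding J by (intro prod.mono_neutral_right) (auto simp: tilt_def)
  also have "\<dots> = (\<Prod>l\<in>J. exp (4 * t * (Y (x l) - bavg ?u ?v) - (4 * t)\<^sup>2 / 8))"
    by (intro prod.cong) (auto simp: J tilt_def)
  also have "\<dots> = exp (\<Sum>l\<in>J. 4 * t * (Y (x l) - bavg ?u ?v) - (4 * t)\<^sup>2 / 8)"
    by (rule exp_sum[symmetric]) (simp add: J)
  also have "(\<Sum>l\<in>J. 4 * t * (Y (x l) - bavg ?u ?v) - (4 * t)\<^sup>2 / 8) = 4 * t * S - 2 * real (card J) * t\<^sup>2"
    by (simp add: S_def sum_subtractf sum_distrib_left power2_eq_square algebra_simps)
  finally have "edge_weight n k k' (4 * t) i j x = ennreal (exp (4 * t * S - 2 * real (card J) * t\<^sup>2))"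
    using at by (simp add: edge_weight_def prod_ennreal tilt_pos less_imp_le)
  with * have "exp (- (2 * r * t\<^sup>2)) * exp (4 * t * S - 2 * real (card J) * t\<^sup>2) < 1"
    by (simp add: ennreal_less_iff flip: ennreal_mult ennreal_1)
  then have "exp (- (2 * r * t\<^sup>2) + (4 * t * S - 2 * real (card J) * t\<^sup>2)) < exp 0"
    by (simp only: exp_add exp_zero)
  then have "- (2 * r * t\<^sup>2) + (4 * t * S - 2 * real (card J) * t\<^sup>2) < 0" by simp
  moreover have "2 * r * t\<^sup>2 \<le> 2 * real (card J) * t\<^sup>2" using r by (intro mult_right_mono) auto
  ultimately have "4 * t * S < 4 * (real (card J) * t\<^sup>2)" by linarith
  then have "t * S < t * (real (card J) * t)" by (simp add: power2_eq_square algebra_simps)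
  then show ?thesis using t by (simp add: S_def)
qed

text \<open>Fubini in the coordinate \<open>i\<close>: given all the others, its score would have to
  hit the one value \<open>Z (x j)\<close>, which has probability 0. There are finitely many
  pairs.\<close>

lemma AE_no_ties:
  assumes atoms: "\<And>a. prob {\<omega> \<in> space M. Z \<omega> = a} = 0"
  shows "AE x in samples n. inj_on (\<lambda>l. Z (x l)) {..<n}"
proof -
  have "AE x in samples n. Z (x i) \<noteq> Z (x j)" if ij: "i \<noteq> j" "i < n" "j < n" for i j
  proof -
    define I where "I = {..<n} - {i}"
    have I: "finite I" "i \<notin> I" "insert i I = {..<n}" using ij by (auto simp: I_def)
    let ?f = "\<lambda>x. if Z (x i) = Z (x j) then 1 else 0 :: ennreal"
    have [measurable]: "(\<lambda>x. Z (x i)) \<in> borel_measurable (samples n)"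
      "(\<lambda>x. Z (x j)) \<in> borel_measurable (samples n)"
      using ij by (auto intro: Z_component_measurable)
    have f [measurable]: "?f \<in> borel_measurable (samples n)" by measurable
    then have "(\<integral>\<^sup>+x. ?f x \<partial>samples n) = (\<integral>\<^sup>+x. \<integral>\<^sup>+\<omega>. ?f (x(i := \<omega>)) \<partial>M \<partial>(\<Pi>\<^sub>M i\<in>I. M))"
      using product.product_nn_integral_insert[OF I(1,2), of ?f] I(3) by simp
    also have "\<dots> = (\<integral>\<^sup>+x. emeasure M {\<omega> \<in> space M. Z \<omega> = Z (x j)} \<partial>(\<Pi>\<^sub>M i\<in>I. M))"
    proof (rule nn_integral_cong)
      fix x :: "nat \<Rightarrow> 'a"
      have "(\<integral>\<^sup>+\<omega>. ?f (x(i := \<omega>)) \<partial>M) = (\<integral>\<^sup>+\<omega>. indicator {\<omega> \<in> space M. Z \<omega> = Z (x j)} \<omega> \<partial>M)"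
        using ij by (intro nn_integral_cong) (auto simp: indicator_def)
      then show "(\<integral>\<^sup>+\<omega>. ?f (x(i := \<omega>)) \<partial>M) = emeasure M {\<omega> \<in> space M. Z \<omega> = Z (x j)}"
        by simp
    qed
    also have "\<dots> = 0" by (simp add: emeasure_eq_measure atoms)
    finally have "AE x in samples n. ?f x = 0"
      using nn_integral_0_iff_AE[OF f] by simp
    then show ?thesis by (rule AE_mp) (auto intro!: AE_I2 split: if_splits)
  qed
  then have "AE x in samples n. \<forall>i\<in>{..<n}. \<forall>j\<in>{..<n}. i \<noteq> j \<longrightarrow> Z (x i) \<noteq> Z (x j)"
    by (intro AE_finite_allI finite_lessThan) auto
  then show ?thesis by (rule AE_mp) (auto intro!: AE_I2 simp: inj_on_def)
qed

section \<open>From rank events back to the bins\<close>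

definition bin_lo :: "nat \<Rightarrow> (nat \<Rightarrow> 'a) \<Rightarrow> nat \<Rightarrow> nat \<Rightarrow> real" where
  "bin_lo n x B b = (if b = 1 then -1 else umb_edge n (\<lambda>l. Z (x l)) B (b - 1))"

definition bin_hi :: "nat \<Rightarrow> (nat \<Rightarrow> 'a) \<Rightarrow> nat \<Rightarrow> nat \<Rightarrow> real" where
  "bin_hi n x B b = (if b = B then 1 else umb_edge n (\<lambda>l. Z (x l)) B b)"

lemma samples_range: "x \<in> space (samples n) \<Longrightarrow> l < n \<Longrightarrow> x l \<in> space M"
  by (auto simp: space_PiM)

lemma samples_Z_range: "x \<in> space (samples n) \<Longrightarrow> l < n \<Longrightarrow> Z (x l) \<in> {0..1}"
  using Z_range samples_range by blast

lemma bin_lo_le_hi: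
  assumes x: "x \<in> space (samples n)" and n: "0 < n" and b: "b \<in> {1..B}"
  shows "bin_lo n x B b \<le> bin_hi n x B b"
proof -
  have z: "Z (x l) \<in> {0..1}" if "l < n" for l using samples_Z_range[OF x that] .
  have B: "0 < B" using b by auto
  show ?thesis
    using umb_edge_range[where z = "\<lambda>l. Z (x l)", OF n B z, where b = b] umb_edge_range[where z = "\<lambda>l. Z (x l)", OF n B z, where b = "b - 1"]
      umb_edge_mono[where z = "\<lambda>l. Z (x l)", OF n B z, where b = "b - 1" and b' = b] b
    by (auto simp: bin_lo_def bin_hi_def)
qed

text \<open>Translates a bin into the rank event of \<open>edge_weight\<close>. The ranks 0 and
  \<open>n\<close> are reserved for the outer edges, so an inner lower edge must be shown to have
  positive rank and an inner upper edge a rank below \<open>n\<close>.\<close>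

lemma bin_edges_at:
  assumes x: "x \<in> space (samples n)" and inj: "inj_on (\<lambda>l. Z (x l)) {..<n}"
    and b: "b \<in> {1..B}" "B \<le> n"
  obtains i j where "lower_at n (n * (b - 1) div B) x i" "upper_at n (n * b div B) x j"
    "lower_val n x i = bin_lo n x B b" "upper_val n x j = bin_hi n x B b"
    "card {l. l < n \<and> Z (x l) \<le> bin_lo n x B b} = n * (b - 1) div B"
    "card {l. l < n \<and> Z (x l) \<le> bin_hi n x B b} = n * b div B"
proof -
  have z: "0 \<le> Z (x l)" "Z (x l) \<le> 1" if "l < n" for l using samples_Z_range[OF x that] by auto
  have "\<exists>i. lower_at n (n * (b - 1) div B) x i \<and> lower_val n x i = bin_lo n x B b
      \<and> card {l. l < n \<and> Z (x l) \<le> bin_lo n x B b} = n * (b - 1) div B"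
  proof (cases "b = 1")
    case True
    have "{l. l < n \<and> Z (x l) \<le> -1} = {}" using z by fastforce
    then have "card {l. l < n \<and> Z (x l) \<le> -1} = 0" by simp
    then show ?thesis using True
      by (intro exI[of _ n]) (simp add: lower_at_def lower_val_def bin_lo_def)
  next
    case False
    have b1: "0 < b - 1" "b - 1 < B" using b False by auto
    obtain i where i: "i < n" "umb_edge n (\<lambda>l. Z (x l)) B (b - 1) = Z (x i)"
      "card {l. l < n \<and> Z (x l) \<le> Z (x i)} = n * (b - 1) div B"
      using umb_edge_rank[OF inj b(2) b1] by blast
    have "i \<in> {l. l < n \<and> Z (x l) \<le> Z (x i)}" using i by simp
    then have "0 < card {l. l < n \<and> Z (x l) \<le> Z (x i)}" by (auto simp: card_gt_0_iff)
    then show ?thesis using i False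
      by (intro exI[of _ i]) (simp add: lower_at_def lower_val_def bin_lo_def score_rank_def)
  qed
  moreover have "\<exists>j. upper_at n (n * b div B) x j \<and> upper_val n x j = bin_hi n x B b
      \<and> card {l. l < n \<and> Z (x l) \<le> bin_hi n x B b} = n * b div B"
  proof (cases "b = B")
    case True
    have "{l. l < n \<and> Z (x l) \<le> 1} = {..<n}" using z by auto
    then have "card {l. l < n \<and> Z (x l) \<le> 1} = n" by simp
    then show ?thesis using True b
      by (intro exI[of _ n]) (simp add: upper_at_def upper_val_def bin_hi_def)
  next
    case False
    have b1: "0 < b" "b < B" using b False by auto
    obtain j where j: "j < n" "umb_edge n (\<lambda>l. Z (x l)) B b = Z (x j)"
      "card {l. l < n \<and> Z (x l) \<le> Z (x j)} = n * b div B"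
      using umb_edge_rank[OF inj b(2) b1] by blast
    have "n * b < n * B" using False b j(1) by auto
    then have "n * b div B < n" by (rule less_mult_imp_div_less)
    then show ?thesis using j False
      by (intro exI[of _ j]) (simp add: upper_at_def upper_val_def bin_hi_def score_rank_def)
  qed
  ultimately show ?thesis using that by blast
qed

lemma card_in_bin:
  assumes x: "x \<in> space (samples n)" and inj: "inj_on (\<lambda>l. Z (x l)) {..<n}"
    and b: "b \<in> {1..B}" "B \<le> n"
  shows "card {l. l < n \<and> bin_lo n x B b < Z (x l) \<and> Z (x l) \<le> bin_hi n x B b}
    = n * b div B - n * (b - 1) div B"
proof -
  obtain i j where "card {l. l < n \<and> Z (x l) \<le> bin_lo n x B b} = n * (b - 1) div B"
    "card {l. l < n \<and> Z (x l) \<le> bin_hi n x B b} = n * b div B"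
    using bin_edges_at[OF x inj b] by blast
  then show ?thesis
    using card_between[OF bin_lo_le_hi[OF x _ b(1)], of n "\<lambda>l. Z (x l)"] b by auto
qed

text \<open>The lower edge lies outside its half-open bin, but the upper edge may be a sample point
  \<open>j\<close> inside it, with an untilted label. Removing it leaves at least floor(n/B) - 1
  points, and putting it back raises the centred label sum by at most 1; division by the bin count
  turns this into the summand 1/floor(n/B).\<close>

lemma bin_mean_upper:
  assumes x: "x \<in> space (samples n)" and inj: "inj_on (\<lambda>l. Z (x l)) {..<n}"
    and b: "b \<in> {1..B}" "B \<le> n" and t: "0 < t"
    and small: "dev_weight n (n * (b - 1) div B) (n * b div B) (real (n div B) - 1) t x < 1"
    and L: "L = {l. l < n \<and> bin_lo n x B b < Z (x l) \<and> Z (x l) \<le> bin_hi n x B b}"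
  shows "(\<Sum>l\<in>L. Y (x l)) / real (card L) - bavg (bin_lo n x B b) (bin_hi n x B b) \<le> t + 1 / real (n div B)"
proof -
  let ?u = "bin_lo n x B b" and ?v = "bin_hi n x B b"
  let ?m = "bavg ?u ?v"
  obtain i j where ij: "lower_at n (n * (b - 1) div B) x i" "upper_at n (n * b div B) x j"
    "lower_val n x i = ?u" "upper_val n x j = ?v"
    using bin_edges_at[OF x inj b] by metis
  define J where "J = {l \<in> {..<n} - {i, j}. lower_val n x i < Z (x l) \<and> Z (x l) \<le> upper_val n x j}"
  have finL: "finite L" by (simp add: L)
  have iL: "i \<notin> L" using ij(3) by (auto simp: L lower_val_def)
  have J: "J = L - {j}" using iL ij by (auto simp: J_def L)
  have "card L = n * b div B - n * (b - 1) div B" unfolding L by (rule card_in_bin[OF x inj b])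
  then have mL: "n div B \<le> card L" using div_increment(1)[of B b n] b by auto
  have m1: "1 \<le> n div B" using b by (auto simp: Suc_le_eq div_greater_zero_iff)
  have cJ: "card L - 1 \<le> card J" "card J \<le> card L"
    unfolding J using finL by (auto simp: card_Diff_singleton_if)
  have r: "real (n div B) - 1 \<le> real (card J)" using cJ mL by linarith
  have "(\<Sum>l\<in>J. Y (x l) - ?m) < real (card J) * t"
    using sum_deviation_less[OF small ij(1,2) J_def r t] ij by simp
  moreover have "(\<Sum>l\<in>L. Y (x l) - ?m) \<le> (\<Sum>l\<in>J. Y (x l) - ?m) + 1"
  proof (cases "j \<in> L")
    case True
    have "Y (x j) \<in> {0..1}" using True x by (auto simp: L intro!: Y_range samples_range simp del: atLeastAtMost_iff)
    then show ?thesis unfolding J using sum.remove[OF finL True, of "\<lambda>l. Y (x l) - ?m"] bavg_range[of ?u ?v] by auto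
  next
    case False
    then show ?thesis by (simp add: J)
  qed
  moreover have "real (card J) * t \<le> real (card L) * t" using cJ t by simp
  ultimately have "(\<Sum>l\<in>L. Y (x l) - ?m) \<le> real (card L) * t + 1" by linarith
  then have *: "(\<Sum>l\<in>L. Y (x l)) - real (card L) * ?m \<le> real (card L) * t + 1"
    by (simp add: sum_subtractf)
  have cpos: "0 < real (card L)" using mL m1 by linarith
  have "(\<Sum>l\<in>L. Y (x l)) / real (card L) - ?m = ((\<Sum>l\<in>L. Y (x l)) - real (card L) * ?m) / real (card L)"
    using cpos by (simp add: field_simps)
  also have "\<dots> \<le> (real (card L) * t + 1) / real (card L)"
    using * cpos by (intro divide_right_mono) auto
  also have "\<dots> = t + 1 / real (card L)" using cpos by (simp add: field_simps)
  also have "\<dots> \<le> t + 1 / real (n div B)"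
    using mL m1 by (intro add_left_mono divide_left_mono) auto
  finally show ?thesis .
qed

lemma scored_space_flip: "scored_space M Z (\<lambda>\<omega>. 1 - Y \<omega>)"
  using Z_range Y_range by unfold_locales auto

text \<open>Positive mass matters: on a null interval both averages are 0 by convention and do not
  add up to 1.\<close>

lemma bavg_flip:
  assumes "0 < bmass u v"
  shows "scored_space.bavg M Z (\<lambda>\<omega>. 1 - Y \<omega>) u v = 1 - bavg u v"
proof -
  interpret flip: scored_space M Z "\<lambda>\<omega>. 1 - Y \<omega>" by (rule scored_space_flip)
  have "(\<integral>\<omega>. indicator {u<..v} (Z \<omega>) * (1 - Y \<omega>) \<partial>M)
      = (\<integral>\<omega>. indicator {u<..v} (Z \<omega>) - indicator {u<..v} (Z \<omega>) * Y \<omega> \<partial>M)"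
    by (simp add: right_diff_distrib)
  also have "\<dots> = bmass u v - (\<integral>\<omega>. indicator {u<..v} (Z \<omega>) * Y \<omega> \<partial>M)"
    unfolding bmass_def by (rule Bochner_Integration.integral_diff) auto
  finally show ?thesis using assms by (simp add: flip.bavg_def bavg_def diff_divide_distrib)
qed

text \<open>The factor 2 B is a union bound over the bins and the two signs of the deviation; the
  second sign is the first one for 1 - \<open>Y\<close>.\<close>

lemma bin_means_concentrate:
  assumes no_ties: "AE x in samples n. inj_on (\<lambda>l. Z (x l)) {..<n}" and t: "0 < t" and B: "0 < B" "B \<le> n"
  obtains N where "N \<in> sets (samples n)"
    "emeasure (samples n) N \<le> ennreal (2 * real B * exp (- (2 * (real (n div B) - 1) * t\<^sup>2)))"
    "\<And>x b. x \<in> space (samples n) - N \<Longrightarrow> inj_on (\<lambda>l. Z (x l)) {..<n} \<Longrightarrow> b \<in> {1..B} \<Longrightarrow>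
      0 < bmass (bin_lo n x B b) (bin_hi n x B b) \<Longrightarrow>
      \<bar>(\<Sum>l | l < n \<and> bin_lo n x B b < Z (x l) \<and> Z (x l) \<le> bin_hi n x B b. Y (x l))
          / real (card {l. l < n \<and> bin_lo n x B b < Z (x l) \<and> Z (x l) \<le> bin_hi n x B b})
        - bavg (bin_lo n x B b) (bin_hi n x B b)\<bar> \<le> t + 1 / real (n div B)"
proof -
  interpret flip: scored_space M Z "\<lambda>\<omega>. 1 - Y \<omega>" by (rule scored_space_flip)
  let ?r = "real (n div B) - 1"
  let ?k = "\<lambda>b. n * (b - 1) div B" and ?k' = "\<lambda>b. n * b div B"
  let ?e = "exp (- (2 * ?r * t\<^sup>2))"
  define D1 where "D1 b = {x \<in> space (samples n). 1 \<le> dev_weight n (?k b) (?k' b) ?r t x}" for b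
  define D2 where "D2 b = {x \<in> space (samples n). 1 \<le> flip.dev_weight n (?k b) (?k' b) ?r t x}" for b
  define N where "N = (\<Union>b\<in>{1..B}. D1 b \<union> D2 b)"
  have [measurable]: "D1 b \<in> sets (samples n)" "D2 b \<in> sets (samples n)" for b
    unfolding D1_def D2_def by measurable
  show ?thesis
  proof (rule that[of N])
    show "N \<in> sets (samples n)" unfolding N_def by measurable
    have "emeasure (samples n) N \<le> (\<Sum>b\<in>{1..B}. emeasure (samples n) (D1 b \<union> D2 b))"
      unfolding N_def by (intro emeasure_subadditive_finite) auto
    also have "\<dots> \<le> (\<Sum>b\<in>{1..B}. ennreal ?e + ennreal ?e)"
    proof (rule sum_mono)
      fix b
      have "emeasure (samples n) (D1 b \<union> D2 b) \<le> emeasure (samples n) (D1 b) + emeasure (samples n) (D2 b)"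
        by (intro emeasure_subadditive) auto
      also have "\<dots> \<le> ennreal ?e + ennreal ?e"
        unfolding D1_def D2_def
        using emeasure_dev_weight_le[OF no_ties, of t "?k b" "?k' b" ?r]
          flip.emeasure_dev_weight_le[OF no_ties, of t "?k b" "?k' b" ?r] t by (intro add_mono) auto
      finally show "emeasure (samples n) (D1 b \<union> D2 b) \<le> ennreal ?e + ennreal ?e" .
    qed
    also have "\<dots> = ennreal (2 * real B * ?e)"
      by (simp add: ennreal_of_nat_eq_real_of_nat flip: ennreal_plus ennreal_mult)
    finally show "emeasure (samples n) N \<le> ennreal (2 * real B * ?e)" .
  next
    fix x b assume x: "x \<in> space (samples n) - N" and inj: "inj_on (\<lambda>l. Z (x l)) {..<n}"
      and b: "b \<in> {1..B}" and pos: "0 < bmass (bin_lo n x B b) (bin_hi n x B b)"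
    let ?u = "bin_lo n x B b" and ?v = "bin_hi n x B b"
    define L where "L = {l. l < n \<and> ?u < Z (x l) \<and> Z (x l) \<le> ?v}"
    have xs: "x \<in> space (samples n)" using x by simp
    have d1: "dev_weight n (?k b) (?k' b) ?r t x < 1" and d2: "flip.dev_weight n (?k b) (?k' b) ?r t x < 1"
      using x b by (auto simp: N_def D1_def D2_def not_le)
    have "card L = ?k' b - ?k b" unfolding L_def by (rule card_in_bin[OF xs inj b B(2)])
    then have "n div B \<le> card L" using div_increment(1)[of B b n] b by auto
    moreover have "1 \<le> n div B" using B by (auto simp: Suc_le_eq div_greater_zero_iff)
    ultimately have cpos: "0 < real (card L)" by linarith
    have "(\<Sum>l\<in>L. Y (x l)) / real (card L) - bavg ?u ?v \<le> t + 1 / real (n div B)"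
      by (rule bin_mean_upper[OF xs inj b B(2) t d1 L_def])
    moreover have "(\<Sum>l\<in>L. 1 - Y (x l)) / real (card L) - (1 - bavg ?u ?v) \<le> t + 1 / real (n div B)"
      using flip.bin_mean_upper[OF xs inj b B(2) t d2 L_def] bavg_flip[OF pos] by simp
    moreover have "(\<Sum>l\<in>L. 1 - Y (x l)) / real (card L) = 1 - (\<Sum>l\<in>L. Y (x l)) / real (card L)"
      using cpos by (simp add: sum_subtractf diff_divide_distrib)
    ultimately show "\<bar>(\<Sum>l | l < n \<and> ?u < Z (x l) \<and> Z (x l) \<le> ?v. Y (x l))
          / real (card {l. l < n \<and> ?u < Z (x l) \<and> Z (x l) \<le> ?v}) - bavg ?u ?v\<bar> \<le> t + 1 / real (n div B)"
      unfolding L_def[symmetric] by linarith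
  qed
qed

end

section \<open>Masses of the bins\<close>

context scored_space
begin

definition score_cdf :: "real \<Rightarrow> real" where
  "score_cdf z = prob {\<omega> \<in> space M. Z \<omega> \<le> z}"

lemma cdf_distr_score: "cdf (distr M borel Z) z = score_cdf z"
proof -
  have "cdf (distr M borel Z) z = prob (Z -` {..z} \<inter> space M)"
    unfolding cdf_def by (rule measure_distr) simp_all
  also have "\<dots> = score_cdf z"
    unfolding score_cdf_def by (rule arg_cong[of _ _ prob]) auto
  finally show ?thesis .
qed

lemma score_cdf_mono: "u \<le> v \<Longrightarrow> score_cdf u \<le> score_cdf v"
  unfolding score_cdf_def by (intro finite_measure_mono) auto

lemma score_cdf_range: "score_cdf z \<in> {0..1}"
  by (simp add: score_cdf_def)

lemma score_cdf_neg: "z < 0 \<Longrightarrow> score_cdf z = 0"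
proof -
  assume "z < 0"
  then have "{\<omega> \<in> space M. Z \<omega> \<le> z} = {}" using Z_range by fastforce
  then show ?thesis by (simp only: score_cdf_def measure_empty)
qed

lemma score_cdf_ge_1: "1 \<le> z \<Longrightarrow> score_cdf z = 1"
proof -
  assume "1 \<le> z"
  then have "{\<omega> \<in> space M. Z \<omega> \<le> z} = space M" using Z_range by fastforce
  then show ?thesis by (simp only: score_cdf_def prob_space)
qed

lemma bmass_eq_cdf_diff:
  assumes "u \<le> v"
  shows "bmass u v = score_cdf v - score_cdf u"
proof -
  have "bmass u v = prob ({\<omega> \<in> space M. Z \<omega> \<le> v} - {\<omega> \<in> space M. Z \<omega> \<le> u})"
    unfolding bmass_eq by (rule arg_cong[of _ _ prob]) auto
  also have "\<dots> = score_cdf v - score_cdf u"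
    unfolding score_cdf_def by (rule finite_measure_Diff) (use assms in auto)
  finally show ?thesis .
qed

lemma atomless:
  assumes "isCont score_cdf a"
  shows "prob {\<omega> \<in> space M. Z \<omega> = a} = 0"
proof -
  interpret D: real_distribution "distr M borel Z" by (rule real_distribution_distr) simp
  have "cdf (distr M borel Z) = score_cdf" by (rule ext) (rule cdf_distr_score)
  then have "measure (distr M borel Z) {a} = 0" using D.isCont_cdf assms by simp
  moreover have "measure (distr M borel Z) {a} = prob (Z -` {a} \<inter> space M)"
    by (rule measure_distr) simp_all
  moreover have "Z -` {a} \<inter> space M = {\<omega> \<in> space M. Z \<omega> = a}" by auto
  ultimately show ?thesis by (simp only:)
qed

lemma score_cdf_measurable [measurable]: "score_cdf \<in> borel_measurable borel"
  by (rule borel_measurable_mono) (simp add: mono_def score_cdf_mono)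

text \<open>Probability integral transform for a continuous distribution function that may have flat
  parts: the sublevel set is the half-line up to its supremum, and the intermediate value theorem
  forces the value \<open>s\<close> there.\<close>

lemma prob_score_cdf_le:
  assumes cont: "\<And>a. isCont score_cdf a" and s: "0 \<le> s" "s \<le> 1"
  shows "prob {\<omega> \<in> space M. score_cdf (Z \<omega>) \<le> s} = s"
proof (cases "s = 1")
  case True
  then have "{\<omega> \<in> space M. score_cdf (Z \<omega>) \<le> s} = space M" using score_cdf_range by auto
  then show ?thesis using True by (simp only: prob_space)
next
  case False
  define T where "T = {z. score_cdf z \<le> s}"
  define t where "t = Sup T"
  have m1: "-1 \<in> T" using s by (simp add: T_def score_cdf_neg)
  have le1: "z \<le> 1" if "z \<in> T" for z
    using that False s score_cdf_ge_1[of z] by (force simp: T_def)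
  have bdd: "bdd_above T" using le1 by (auto simp: bdd_above_def)
  have "closed T"
    unfolding T_def using cont by (intro closed_Collect_le continuous_at_imp_continuous_on) auto
  then have tT: "t \<in> T" unfolding t_def using m1 bdd by (intro closed_contains_Sup) auto
  have "\<exists>c\<ge>t. c \<le> 1 \<and> score_cdf c = s"
    using tT le1[OF tT] s cont score_cdf_ge_1[of 1] by (intro IVT) (auto simp: T_def)
  then obtain c where c: "t \<le> c" "score_cdf c = s" by auto
  then have "c \<le> t" unfolding t_def using bdd by (intro cSup_upper) (auto simp: T_def)
  with c have ts: "score_cdf t = s" by simp
  have "score_cdf z \<le> s \<longleftrightarrow> z \<le> t" for z
  proof
    assume "score_cdf z \<le> s"
    then show "z \<le> t" unfolding t_def using bdd by (intro cSup_upper) (auto simp: T_def)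
  qed (use score_cdf_mono[of z t] ts in simp)
  then show ?thesis using ts by (simp add: score_cdf_def)
qed

text \<open>The exceptional event concerns \<open>B\<close> fixed cells, yet the conclusion holds
  for all intervals simultaneously and so applies to the random bins. An interval of mass above 4/B
  contains three consecutive cells, hence more than 3n/(2B) sample points; for n/B \<ge> 2 this
  exceeds the n/B + 1 points that a bin can hold.\<close>

lemma bin_masses_bounded:
  assumes cont: "\<And>a. isCont score_cdf a" and B: "0 < B"
  obtains N where "N \<in> sets (samples n)"
    "emeasure (samples n) N \<le> ennreal (real B * exp (- (real n / real B / 16)))"
    "\<And>x u v. x \<in> space (samples n) - N \<Longrightarrow> u \<le> v \<Longrightarrow> 2 \<le> real n / real B \<Longrightarrow>
      real (card {l. l < n \<and> u < Z (x l) \<and> Z (x l) \<le> v}) \<le> real n / real B + 1 \<Longrightarrow>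
      bmass u v \<le> 4 / real B"
proof -
  define cell where "cell g = {\<omega> \<in> space M. real g / real B < score_cdf (Z \<omega>) \<and> score_cdf (Z \<omega>) \<le> (real g + 1) / real B}" for g
  define cnt where "cnt g x = (\<Sum>l<n. indicator (cell g) (x l) :: real)" for g and x :: "nat \<Rightarrow> 'a"
  \<comment> \<open>Lower tail at \<epsilon> = 1/2. Its exponent (n/B) (1/2)^2 / 4 is the source of
    the 16 in the failure probability.\<close>
  define D where "D g = {x \<in> space (samples n). 1 / 2 * (real n * prob (cell g)) \<le> -1 * (cnt g x - real n * prob (cell g))}" for g
  define N where "N = (\<Union>g\<in>{..<B}. D g)"
  have cell [measurable]: "cell g \<in> events" for g unfolding cell_def by measurable
  have prob_cell: "prob (cell g) = 1 / real B" if "g < B" for g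
  proof -
    have le: "real g / real B \<le> (real g + 1) / real B" using B by (simp add: divide_right_mono)
    have "prob (cell g) = prob ({\<omega> \<in> space M. score_cdf (Z \<omega>) \<le> (real g + 1) / real B}
        - {\<omega> \<in> space M. score_cdf (Z \<omega>) \<le> real g / real B})"
      unfolding cell_def by (rule arg_cong[of _ _ prob]) auto
    also have "\<dots> = prob {\<omega> \<in> space M. score_cdf (Z \<omega>) \<le> (real g + 1) / real B}
        - prob {\<omega> \<in> space M. score_cdf (Z \<omega>) \<le> real g / real B}"
      by (rule finite_measure_Diff) (use le in auto)
    also have "\<dots> = (real g + 1) / real B - real g / real B"
      using that by (intro arg_cong2[where f = "(-)"] prob_score_cdf_le cont) auto
    also have "\<dots> = 1 / real B" by (simp add: diff_divide_distrib[symmetric])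
    finally show ?thesis .
  qed
  have [measurable]: "D g \<in> sets (samples n)" for g
    unfolding D_def cnt_def by measurable
  show ?thesis
  proof (rule that[of N])
    show "N \<in> sets (samples n)" unfolding N_def by measurable
    have "emeasure (samples n) N \<le> (\<Sum>g\<in>{..<B}. emeasure (samples n) (D g))"
      unfolding N_def by (intro emeasure_subadditive_finite) auto
    also have "\<dots> \<le> (\<Sum>g\<in>{..<B}. ennreal (exp (- (real n / real B / 16))))"
    proof (rule sum_mono)
      fix g assume "g \<in> {..<B}"
      then show "emeasure (samples n) (D g) \<le> ennreal (exp (- (real n / real B / 16)))"
        using binomial_tail[OF cell[of g], of "1/2" "-1" n] prob_cell[of g]
        unfolding D_def cnt_def by (simp add: power2_eq_square mult.commute)
    qed
    also have "\<dots> = ennreal (real B * exp (- (real n / real B / 16)))"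
      by (simp add: ennreal_of_nat_eq_real_of_nat flip: ennreal_mult)
    finally show "emeasure (samples n) N \<le> ennreal (real B * exp (- (real n / real B / 16)))" .
  next
    fix x u v assume x: "x \<in> space (samples n) - N" and uv: "u \<le> v" and n2: "2 \<le> real n / real B"
      and count: "real (card {l. l < n \<and> u < Z (x l) \<and> Z (x l) \<le> v}) \<le> real n / real B + 1"
    show "bmass u v \<le> 4 / real B"
    proof (rule ccontr)
      assume "\<not> ?thesis"
      then have big: "score_cdf u + 4 / real B < score_cdf v"
        using bmass_eq_cdf_diff[OF uv] by simp
      \<comment> \<open>Index of the first cell starting at or above the level of \<open>u\<close>.
        Rounding up loses less than one of four cell widths, so three whole cells fit.\<close>
      define g where "g = nat \<lceil>score_cdf u * real B\<rceil>"
      have Bpos: "0 < real B" using B by simp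
      have c0: "0 \<le> score_cdf u * real B" using score_cdf_range[of u] by simp
      then have gl: "score_cdf u * real B \<le> real g" and gu: "real g < score_cdf u * real B + 1"
        unfolding g_def by linarith+
      have gl': "score_cdf u \<le> real g / real B" using gl Bpos by (simp add: field_simps)
      have gu': "(real g + 3) / real B < score_cdf v"
      proof -
        have "(real g + 3) / real B < (score_cdf u * real B + 4) / real B"
          using gu Bpos by (intro divide_strict_right_mono) auto
        also have "\<dots> = score_cdf u + 4 / real B" using Bpos by (simp add: field_simps)
        finally show ?thesis using big by simp
      qed
      have "(real g + 3) / real B < 1" using gu' score_cdf_range[of v] by simp
      then have "real g + 3 < real B" using Bpos by (simp add: field_simps)
      then have gB: "g + 2 < B" by linarith
      have cnt_big: "real n / real B / 2 < cnt h x" if "h < B" for h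
      proof -
        have "x \<notin> D h" using x that by (auto simp: N_def)
        then show ?thesis using x prob_cell[OF that] by (simp add: D_def field_simps)
      qed
      have "cnt g x + cnt (g + 1) x + cnt (g + 2) x
          = (\<Sum>l<n. indicator (cell g) (x l) + indicator (cell (g + 1)) (x l) + indicator (cell (g + 2)) (x l))"
        by (simp only: cnt_def sum.distrib)
      also have "\<dots> \<le> (\<Sum>l<n. if u < Z (x l) \<and> Z (x l) \<le> v then 1 else 0)"
      proof (rule sum_mono)
        fix l
        let ?F = "score_cdf (Z (x l))"
        have inuv: "u < Z (x l) \<and> Z (x l) \<le> v" if "real g / real B < ?F" "?F \<le> (real g + 3) / real B"
          using score_cdf_mono[of "Z (x l)" u] score_cdf_mono[of v "Z (x l)"] that gl' gu' by linarith
        have m: "real g / real B \<le> (real g + 1) / real B" "(real g + 1) / real B \<le> (real g + 2) / real B"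
          "(real g + 2) / real B \<le> (real g + 3) / real B"
          using Bpos by (auto intro!: divide_right_mono)
        show "indicator (cell g) (x l) + indicator (cell (g + 1)) (x l) + indicator (cell (g + 2)) (x l)
            \<le> (if u < Z (x l) \<and> Z (x l) \<le> v then 1 else 0 :: real)"
        proof (cases "x l \<in> cell g \<or> x l \<in> cell (g + 1) \<or> x l \<in> cell (g + 2)")
          case True
          then have "real g / real B < ?F \<and> ?F \<le> (real g + 3) / real B"
            using m by (auto simp: cell_def add.commute)
          moreover have "\<not> (x l \<in> cell g \<and> x l \<in> cell (g + 1))" "\<not> (x l \<in> cell g \<and> x l \<in> cell (g + 2))"
            "\<not> (x l \<in> cell (g + 1) \<and> x l \<in> cell (g + 2))"
            using m by (auto simp: cell_def add.commute)
          ultimately show ?thesis using inuv by (auto simp: indicator_def)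
        qed auto
      qed
      also have "\<dots> = real (card {l. l < n \<and> u < Z (x l) \<and> Z (x l) \<le> v})"
        by (simp add: sum.If_cases Int_def)
      finally have "cnt g x + cnt (g + 1) x + cnt (g + 2) x \<le> real n / real B + 1" using count by simp
      moreover have "real n / real B / 2 < cnt g x" "real n / real B / 2 < cnt (g + 1) x"
        "real n / real B / 2 < cnt (g + 2) x" using gB cnt_big[of g] cnt_big[of "g + 1"] cnt_big[of "g + 2"] by simp_all
      moreover have "a + b + c \<le> q + 1 \<Longrightarrow> q / 2 < a \<Longrightarrow> q / 2 < b \<Longrightarrow> q / 2 < c \<Longrightarrow> q < 2"
        for a b c q :: real by linarith
      ultimately show False using n2 by (meson not_le)
    qed
  qed
qed

end

section \<open>Risk of a binned estimator\<close>

context scored_space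
begin

lemma bmass_subinterval: "u \<le> u' \<Longrightarrow> v' \<le> v \<Longrightarrow> bmass u' v' \<le> bmass u v"
  unfolding bmass_eq by (intro finite_measure_mono) auto

text \<open>On one bin the error splits into the squared bias of the constant \<open>a\<close> and
  the variance of \<open>h\<close>, and the variance is at most a quarter of the squared range of
  \<open>h\<close> (Popoviciu). \<open>S\<close> carries the scores almost surely and is where the
  oscillation is controlled, so the range is taken over \<open>S\<close> only.\<close>

lemma bin_error_bound:
  fixes h :: "real \<Rightarrow> real"
  assumes h [measurable]: "h \<in> borel_measurable borel"
    and h01: "AE \<omega> in M. h (Z \<omega>) \<in> {0..1}"
    and mean: "(\<integral>\<omega>. indicator {u<..v} (Z \<omega>) * h (Z \<omega>) \<partial>M) = (\<integral>\<omega>. indicator {u<..v} (Z \<omega>) * Y \<omega> \<partial>M)"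
    and S: "AE \<omega> in M. Z \<omega> \<in> S"
    and osc: "\<And>z1 z2. z1 \<in> S \<Longrightarrow> z2 \<in> S \<Longrightarrow> z1 \<le> z2 \<Longrightarrow> \<bar>h z2 - h z1\<bar> \<le> K * bmass z1 z2" and K: "0 \<le> K"
  shows "(\<integral>\<omega>. indicator {u<..v} (Z \<omega>) * (a - h (Z \<omega>))\<^sup>2 \<partial>M)
    \<le> bmass u v * ((a - bavg u v)\<^sup>2 + (K * bmass u v / 2)\<^sup>2)"
proof -
  let ?J = "\<lambda>\<omega>. indicator {u<..v} (Z \<omega>) :: real"
  let ?m = "bavg u v" and ?p = "bmass u v"
  have p0: "0 \<le> ?p" by (rule bmass_nonneg)
  have intJh: "integrable M (\<lambda>\<omega>. ?J \<omega> * h (Z \<omega>))"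
    by (rule integrable_const_bound[where B = 1], use h01 in eventually_elim) (auto simp: indicator_def)
  have intq: "integrable M (\<lambda>\<omega>. ?J \<omega> * (c - h (Z \<omega>))\<^sup>2)" for c
  proof (rule integrable_const_bound[where B = "(\<bar>c\<bar> + 1)\<^sup>2"])
    show "AE \<omega> in M. norm (?J \<omega> * (c - h (Z \<omega>))\<^sup>2) \<le> (\<bar>c\<bar> + 1)\<^sup>2"
      using h01
    proof eventually_elim
      case (elim \<omega>)
      then have "\<bar>c - h (Z \<omega>)\<bar>\<^sup>2 \<le> (\<bar>c\<bar> + 1)\<^sup>2" by (intro power_mono) auto
      then show ?case by (auto simp: indicator_def)
    qed
  qed measurable
  show ?thesis
  proof (cases "?p = 0")
    case True
    then have "AE \<omega> in M. ?J \<omega> = 0"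
      unfolding bmass_def by (subst (asm) integral_nonneg_eq_0_iff_AE) auto
    then have "(\<integral>\<omega>. ?J \<omega> * (a - h (Z \<omega>))\<^sup>2 \<partial>M) = 0"
      by (intro integral_eq_zero_AE) auto
    then show ?thesis using True by simp
  next
    case False
    then have ppos: "0 < ?p" using p0 by simp
    define V where "V = h ` (S \<inter> {u<..v})"
    have "S \<inter> {u<..v} \<noteq> {}"
    proof
      assume "S \<inter> {u<..v} = {}"
      then have "AE \<omega> in M. ?J \<omega> = 0" using S by (auto simp: indicator_def elim!: eventually_mono)
      then have "?p = 0" unfolding bmass_def by (intro integral_eq_zero_AE)
      with False show False by simp
    qed
    then obtain z0 where z0: "z0 \<in> S" "u < z0" "z0 \<le> v" by auto
    have diff: "h z2 - h z1 \<le> K * ?p" if "z1 \<in> S" "z2 \<in> S" "u < z1" "z1 \<le> v" "u < z2" "z2 \<le> v" for z1 z2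
    proof (cases "z1 \<le> z2")
      case True
      then have "h z2 - h z1 \<le> K * bmass z1 z2" using osc[of z1 z2] that by auto
      also have "\<dots> \<le> K * ?p" using that K by (intro mult_left_mono bmass_subinterval) auto
      finally show ?thesis .
    next
      case False
      then have "h z2 - h z1 \<le> K * bmass z2 z1" using osc[of z2 z1] that by auto
      also have "\<dots> \<le> K * ?p" using that K by (intro mult_left_mono bmass_subinterval) auto
      finally show ?thesis .
    qed
    have bdd: "bdd_above V" "bdd_below V"
    proof -
      have "w \<le> h z0 + K * ?p" "h z0 - K * ?p \<le> w" if "w \<in> V" for w
        using that diff[of z0] diff[of _ z0] z0 by (force simp: V_def)+
      then show "bdd_above V" "bdd_below V" by (auto simp: bdd_above_def bdd_below_def)
    qed
    have Vne: "V \<noteq> {}" using z0 by (auto simp: V_def)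
    have width: "Sup V - Inf V \<le> K * ?p"
    proof -
      have "Sup V \<le> K * ?p + Inf V"
      proof (rule cSup_least[OF Vne])
        fix w assume w: "w \<in> V"
        have "w - K * ?p \<le> Inf V"
        proof (rule cInf_greatest[OF Vne])
          fix w' assume "w' \<in> V"
          then show "w - K * ?p \<le> w'" using w diff by (fastforce simp: V_def)
        qed
        then show "w \<le> K * ?p + Inf V" by simp
      qed
      then show ?thesis by simp
    qed
    \<comment> \<open>Centre of the range of \<open>h\<close>. Using it in place of the mean of
      \<open>h\<close> can only increase the mean square; the surplus is the term with (c - ?m)^2
      that is dropped at the end.\<close>
    define c where "c = (Sup V + Inf V) / 2"
    have near: "(c - h z)\<^sup>2 \<le> (K * ?p / 2)\<^sup>2" if "z \<in> S" "u < z" "z \<le> v" for z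
    proof -
      have "h z \<in> V" using that by (auto simp: V_def)
      then have "h z \<le> Sup V" "Inf V \<le> h z" using bdd by (auto intro: cSup_upper cInf_lower)
      then have "\<bar>c - h z\<bar> \<le> K * ?p / 2" using width unfolding c_def by (auto simp: abs_le_iff field_simps)
      then have "\<bar>c - h z\<bar>\<^sup>2 \<le> (K * ?p / 2)\<^sup>2" by (intro power_mono) auto
      then show ?thesis by simp
    qed
    have "(\<integral>\<omega>. ?J \<omega> * (a - h (Z \<omega>))\<^sup>2 \<partial>M)
        = (\<integral>\<omega>. ?J \<omega> * (c - h (Z \<omega>))\<^sup>2 + ((a\<^sup>2 - c\<^sup>2) * ?J \<omega> - 2 * (a - c) * (?J \<omega> * h (Z \<omega>))) \<partial>M)"
      by (intro Bochner_Integration.integral_cong) (auto simp: power2_eq_square algebra_simps)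
    also have "\<dots> = (\<integral>\<omega>. ?J \<omega> * (c - h (Z \<omega>))\<^sup>2 \<partial>M) + ((a\<^sup>2 - c\<^sup>2) * ?p - 2 * (a - c) * (?p * ?m))"
      using intq[of c] intJh mean
      by (simp add: Bochner_Integration.integral_add Bochner_Integration.integral_diff bmass_bavg flip: bmass_def)
    also have "(\<integral>\<omega>. ?J \<omega> * (c - h (Z \<omega>))\<^sup>2 \<partial>M) \<le> (\<integral>\<omega>. ?J \<omega> * (K * ?p / 2)\<^sup>2 \<partial>M)"
    proof (rule integral_mono_AE)
      show "AE \<omega> in M. ?J \<omega> * (c - h (Z \<omega>))\<^sup>2 \<le> ?J \<omega> * (K * ?p / 2)\<^sup>2"
        using S by eventually_elim (use near in \<open>auto simp: indicator_def\<close>)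
    qed (use intq in auto)
    also have "(\<integral>\<omega>. ?J \<omega> * (K * ?p / 2)\<^sup>2 \<partial>M) = ?p * (K * ?p / 2)\<^sup>2"
      by (simp add: bmass_def)
    also have "?p * (K * ?p / 2)\<^sup>2 + ((a\<^sup>2 - c\<^sup>2) * ?p - 2 * (a - c) * (?p * ?m))
        = ?p * ((a - ?m)\<^sup>2 + (K * ?p / 2)\<^sup>2) - ?p * (c - ?m)\<^sup>2"
      by (simp add: power2_eq_square algebra_simps)
    also have "\<dots> \<le> ?p * ((a - ?m)\<^sup>2 + (K * ?p / 2)\<^sup>2)" using p0 by simp
    finally show ?thesis by simp
  qed
qed

text \<open>The bins partition the scores, so the error is an average of bin errors with weights
  summing to 1. A null bin contributes 0 whatever its constant is, which is why \<open>err\<close>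
  is restricted to bins with mass.\<close>

lemma binned_error_bound:
  fixes h :: "real \<Rightarrow> real" and c :: "nat \<Rightarrow> real"
  assumes h: "h \<in> borel_measurable borel" "AE \<omega> in M. h (Z \<omega>) \<in> {0..1}"
    and mean: "\<And>u v. (\<integral>\<omega>. indicator {u<..v} (Z \<omega>) * h (Z \<omega>) \<partial>M) = (\<integral>\<omega>. indicator {u<..v} (Z \<omega>) * Y \<omega> \<partial>M)"
    and S: "AE \<omega> in M. Z \<omega> \<in> S"
    and osc: "\<And>z1 z2. z1 \<in> S \<Longrightarrow> z2 \<in> S \<Longrightarrow> z1 \<le> z2 \<Longrightarrow> \<bar>h z2 - h z1\<bar> \<le> K * bmass z1 z2" and K: "0 \<le> K"
    and x: "x \<in> space (samples n)" and n: "0 < n" and B: "0 < B"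
    and err: "\<And>b. b \<in> {1..B} \<Longrightarrow> 0 < bmass (bin_lo n x B b) (bin_hi n x B b) \<Longrightarrow>
      \<bar>c b - bavg (bin_lo n x B b) (bin_hi n x B b)\<bar> \<le> \<tau>" and \<tau>: "0 \<le> \<tau>"
    and mass: "\<And>b. b \<in> {1..B} \<Longrightarrow> bmass (bin_lo n x B b) (bin_hi n x B b) \<le> 4 / real B"
  shows "(\<integral>\<omega>. ((\<Sum>b=1..B. c b * indicator (umb_bin n (\<lambda>l. Z (x l)) B b) (Z \<omega>)) - h (Z \<omega>))\<^sup>2 \<partial>M)
    \<le> \<tau>\<^sup>2 + 8 * K\<^sup>2 / (real B)\<^sup>2"
proof -
  let ?I = "\<lambda>b. {bin_lo n x B b<..bin_hi n x B b}"
  let ?p = "\<lambda>b. bmass (bin_lo n x B b) (bin_hi n x B b)"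
  note [measurable] = h(1)
  have z: "Z (x l) \<in> {0..1}" if "l < n" for l using samples_Z_range[OF x that] .
  have bin: "Z \<omega> \<in> umb_bin n (\<lambda>l. Z (x l)) B b \<longleftrightarrow> Z \<omega> \<in> ?I b" if "\<omega> \<in> space M" "b \<in> {1..B}" for \<omega> b
    using umb_bin_iff[where z = "\<lambda>l. Z (x l)", OF n B z Z_range[OF that(1)] that(2)]
    by (auto simp: bin_lo_def bin_hi_def)
  have single: "(\<Sum>b=1..B. d b * indicator (?I b) (Z \<omega>)) = d b0"
    if "\<omega> \<in> space M" "b0 \<in> {1..B}" "Z \<omega> \<in> ?I b0" for \<omega> b0 and d :: "nat \<Rightarrow> real"
  proof -
    have "(\<Sum>b=1..B. d b * indicator (?I b) (Z \<omega>)) = (\<Sum>b=1..B. d b * indicator (umb_bin n (\<lambda>l. Z (x l)) B b) (Z \<omega>))"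
      using bin[OF that(1)] by (intro sum.cong) (auto simp: indicator_def)
    then show ?thesis
      using umb_bin_sum[where z = "\<lambda>l. Z (x l)" and x = "Z \<omega>" and b = b0 and c = d, OF n B z that(2)] bin[OF that(1,2)] that(3) by simp
  qed
  have in_bin: "\<exists>b\<in>{1..B}. Z \<omega> \<in> ?I b" if "\<omega> \<in> space M" for \<omega>
    using umb_bin_exists[where z = "\<lambda>l. Z (x l)", OF n B z Z_range[OF that]] bin[OF that] by metis
  have intq: "integrable M (\<lambda>\<omega>. indicator (?I b) (Z \<omega>) * (c b - h (Z \<omega>))\<^sup>2)" for b
  proof (rule integrable_const_bound[where B = "(\<bar>c b\<bar> + 1)\<^sup>2"])
    show "AE \<omega> in M. norm (indicator (?I b) (Z \<omega>) * (c b - h (Z \<omega>))\<^sup>2) \<le> (\<bar>c b\<bar> + 1)\<^sup>2"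
      using h(2)
    proof eventually_elim
      case (elim \<omega>)
      then have "\<bar>c b - h (Z \<omega>)\<bar>\<^sup>2 \<le> (\<bar>c b\<bar> + 1)\<^sup>2" by (intro power_mono) auto
      then show ?case by (auto simp: indicator_def)
    qed
  qed measurable
  have "(\<integral>\<omega>. ((\<Sum>b=1..B. c b * indicator (umb_bin n (\<lambda>l. Z (x l)) B b) (Z \<omega>)) - h (Z \<omega>))\<^sup>2 \<partial>M)
      = (\<integral>\<omega>. (\<Sum>b=1..B. indicator (?I b) (Z \<omega>) * (c b - h (Z \<omega>))\<^sup>2) \<partial>M)"
  proof (rule Bochner_Integration.integral_cong[OF refl])
    fix \<omega> assume \<omega>: "\<omega> \<in> space M"
    obtain b0 where b0: "b0 \<in> {1..B}" "Z \<omega> \<in> ?I b0" using in_bin[OF \<omega>] by auto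
    have "(\<Sum>b=1..B. c b * indicator (umb_bin n (\<lambda>l. Z (x l)) B b) (Z \<omega>)) = c b0"
      using umb_bin_sum[where z = "\<lambda>l. Z (x l)" and x = "Z \<omega>" and b = b0 and c = c, OF n B z b0(1)] bin[OF \<omega> b0(1)] b0(2) by simp
    then show "((\<Sum>b=1..B. c b * indicator (umb_bin n (\<lambda>l. Z (x l)) B b) (Z \<omega>)) - h (Z \<omega>))\<^sup>2
        = (\<Sum>b=1..B. indicator (?I b) (Z \<omega>) * (c b - h (Z \<omega>))\<^sup>2)"
      using single[OF \<omega> b0, of "\<lambda>b. (c b - h (Z \<omega>))\<^sup>2"] by (simp add: mult.commute)
  qed
  also have "\<dots> = (\<Sum>b=1..B. \<integral>\<omega>. indicator (?I b) (Z \<omega>) * (c b - h (Z \<omega>))\<^sup>2 \<partial>M)"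
    by (rule Bochner_Integration.integral_sum) (rule intq)
  also have "\<dots> \<le> (\<Sum>b=1..B. ?p b * (\<tau>\<^sup>2 + 8 * K\<^sup>2 / (real B)\<^sup>2))"
  proof (rule sum_mono)
    fix b assume b: "b \<in> {1..B}"
    show "(\<integral>\<omega>. indicator (?I b) (Z \<omega>) * (c b - h (Z \<omega>))\<^sup>2 \<partial>M) \<le> ?p b * (\<tau>\<^sup>2 + 8 * K\<^sup>2 / (real B)\<^sup>2)"
    proof (cases "?p b = 0")
      case True
      then show ?thesis
        using bin_error_bound[OF h mean S osc K, of "bin_lo n x B b" "bin_hi n x B b" "c b"] by simp
    next
      case False
      then have p: "0 < ?p b" using bmass_nonneg[of "bin_lo n x B b" "bin_hi n x B b"] by simp
      have "\<bar>c b - bavg (bin_lo n x B b) (bin_hi n x B b)\<bar>\<^sup>2 \<le> \<tau>\<^sup>2"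
        using err[OF b p] by (intro power_mono) auto
      moreover have "(K * ?p b / 2)\<^sup>2 \<le> (K * (4 / real B) / 2)\<^sup>2"
        using K p mass[OF b] by (intro power_mono divide_right_mono mult_left_mono) auto
      \<comment> \<open>The half-width 2K/B squares to 4 K^2 / B^2, so the 8 of the bound leaves a
        factor 2 to spare.\<close>
      moreover have "(K * (4 / real B) / 2)\<^sup>2 \<le> 8 * K\<^sup>2 / (real B)\<^sup>2"
        using B by (simp add: power2_eq_square field_simps)
      ultimately have "(c b - bavg (bin_lo n x B b) (bin_hi n x B b))\<^sup>2 + (K * ?p b / 2)\<^sup>2 \<le> \<tau>\<^sup>2 + 8 * K\<^sup>2 / (real B)\<^sup>2"
        by simp
      then have "?p b * ((c b - bavg (bin_lo n x B b) (bin_hi n x B b))\<^sup>2 + (K * ?p b / 2)\<^sup>2) \<le> ?p b * (\<tau>\<^sup>2 + 8 * K\<^sup>2 / (real B)\<^sup>2)"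
        using p by (intro mult_left_mono) auto
      then show ?thesis
        using bin_error_bound[OF h mean S osc K, of "bin_lo n x B b" "bin_hi n x B b" "c b"] by linarith
    qed
  qed
  also have "\<dots> = (\<Sum>b=1..B. ?p b) * (\<tau>\<^sup>2 + 8 * K\<^sup>2 / (real B)\<^sup>2)"
    by (rule sum_distrib_right[symmetric])
  also have "(\<Sum>b=1..B. ?p b) = 1"
  proof -
    have "(\<Sum>b=1..B. ?p b) = (\<integral>\<omega>. (\<Sum>b=1..B. indicator (?I b) (Z \<omega>)) \<partial>M)"
      unfolding bmass_def by (rule Bochner_Integration.integral_sum[symmetric]) simp
    also have "\<dots> = (\<integral>\<omega>. 1 \<partial>M)"
    proof (rule Bochner_Integration.integral_cong[OF refl])
      fix \<omega> assume \<omega>: "\<omega> \<in> space M"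
      obtain b0 where "b0 \<in> {1..B}" "Z \<omega> \<in> ?I b0" using in_bin[OF \<omega>] by auto
      then show "(\<Sum>b=1..B. indicator (?I b) (Z \<omega>)) = (1 :: real)"
        using single[OF \<omega>, of b0 "\<lambda>_. 1"] by simp
    qed
    finally show ?thesis by (simp add: prob_space)
  qed
  finally show ?thesis by simp
qed

end

section \<open>Label shift\<close>

text \<open>If the exact correction is a/(a + b), the estimated one is \<rho>_1 a / (\<rho>_1 a +
  \<rho>_0 b). The difference has numerator (\<rho>_1 - \<rho>_0) a b, and a b (\<rho>_0 + \<rho>_1)
  is part of the expanded denominator (\<rho>_1 a + \<rho>_0 b) (a + b), all of whose terms are
  nonnegative.\<close>

lemma shift_correction_diff:
  fixes w w' :: "nat \<Rightarrow> real"
  assumes w: "0 < w 0" "0 < w 1" and w': "0 < w' 0" "0 < w' 1" and z: "z \<in> {0..1}"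
  defines "\<rho> \<equiv> \<lambda>k. w' k / w k"
  shows "\<bar>shift_correction w' z - shift_correction w z\<bar> \<le> \<bar>(\<rho> 0 - \<rho> 1) / (\<rho> 0 + \<rho> 1)\<bar>"
proof -
  define a where "a = w 1 * z"
  define b where "b = w 0 * (1 - z)"
  have \<rho>: "0 < \<rho> 0" "0 < \<rho> 1" using w w' by (auto simp: \<rho>_def)
  have ab: "0 \<le> a" "0 \<le> b" using w z by (auto simp: a_def b_def)
  have sum: "0 < a + b"
    using w z by (cases "z = 0") (auto simp: a_def b_def intro: add_pos_nonneg)
  have eq: "w' 1 * z = \<rho> 1 * a" "w' 0 * (1 - z) = \<rho> 0 * b" using w by (auto simp: \<rho>_def a_def b_def)
  have sum': "0 < \<rho> 1 * a + \<rho> 0 * b"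
  proof -
    have "0 < min (\<rho> 0) (\<rho> 1) * (a + b)" using \<rho> sum by simp
    also have "\<dots> = min (\<rho> 0) (\<rho> 1) * a + min (\<rho> 0) (\<rho> 1) * b" by (simp add: distrib_left)
    also have "\<dots> \<le> \<rho> 1 * a + \<rho> 0 * b" using ab by (intro add_mono mult_right_mono) auto
    finally show ?thesis .
  qed
  have "shift_correction w' z - shift_correction w z = \<rho> 1 * a / (\<rho> 1 * a + \<rho> 0 * b) - a / (a + b)"
    by (simp only: shift_correction_def eq a_def[symmetric] b_def[symmetric])
  also have "\<dots> = (\<rho> 1 - \<rho> 0) * (a * b) / ((\<rho> 1 * a + \<rho> 0 * b) * (a + b))"
    using sum sum' by (simp add: diff_frac_eq) (simp add: algebra_simps)
  finally have "\<bar>shift_correction w' z - shift_correction w z\<bar>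
      = \<bar>\<rho> 0 - \<rho> 1\<bar> * (a * b) / ((\<rho> 1 * a + \<rho> 0 * b) * (a + b))"
    using sum sum' ab by (simp add: abs_mult abs_minus_commute)
  also have "\<dots> \<le> \<bar>\<rho> 0 - \<rho> 1\<bar> / (\<rho> 0 + \<rho> 1)"
  proof -
    have "(a * b) * (\<rho> 0 + \<rho> 1) \<le> (\<rho> 1 * a + \<rho> 0 * b) * (a + b)"
      using \<rho> ab by (simp add: algebra_simps)
    then have "\<bar>\<rho> 0 - \<rho> 1\<bar> * ((a * b) * (\<rho> 0 + \<rho> 1)) \<le> \<bar>\<rho> 0 - \<rho> 1\<bar> * ((\<rho> 1 * a + \<rho> 0 * b) * (a + b))"
      by (rule mult_left_mono) simp
    then show ?thesis using \<rho> sum sum' by (simp add: divide_simps mult_ac)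
  qed
  finally show ?thesis using \<rho> by simp
qed

text \<open>With D the denominator of the correction, the difference equals w_0 w_1 (s - t) / (D(s)
  D(t)). The factor D(t) on the left is the form in which the density of \<open>Q\<close> on score
  events will appear; it cancels one of the two factors D(t) of the square.\<close>

lemma shift_correction_lipschitz:
  fixes w :: "nat \<Rightarrow> real"
  assumes w: "0 < w 0" "0 < w 1" and s: "s \<in> {0..1}" and t: "t \<in> {0..1}"
  shows "(w 1 * t + w 0 * (1 - t)) * (shift_correction w s - shift_correction w t)\<^sup>2
    \<le> max (w 0) (w 1) ^ 3 / (min (w 0) (w 1))\<^sup>2 * (s - t)\<^sup>2"
proof -
  let ?lo = "min (w 0) (w 1)" and ?hi = "max (w 0) (w 1)"
  define D where "D z = w 1 * z + w 0 * (1 - z)" for z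
  have lo: "0 < ?lo" and lohi: "?lo \<le> ?hi" using w by auto
  have Dlo: "?lo \<le> D z" if "z \<in> {0..1}" for z
  proof -
    have "?lo = ?lo * z + ?lo * (1 - z)" by (simp add: algebra_simps)
    also have "\<dots> \<le> D z" unfolding D_def using that by (intro add_mono mult_right_mono) auto
    finally show ?thesis .
  qed
  have Ds: "?lo \<le> D s" and Dt: "?lo \<le> D t" using Dlo s t by auto
  have pos: "0 < D s" "0 < D t" using Ds Dt lo by linarith+
  have "shift_correction w s - shift_correction w t = w 1 * s / D s - w 1 * t / D t"
    by (simp add: shift_correction_def D_def)
  also have "\<dots> = (w 0 * w 1) * (s - t) / (D s * D t)"
    using pos by (simp add: diff_frac_eq) (simp add: D_def algebra_simps)
  finally have sd: "shift_correction w s - shift_correction w t = (w 0 * w 1) * (s - t) / (D s * D t)" .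
  have "D t * (shift_correction w s - shift_correction w t)\<^sup>2
      = (w 0 * w 1)\<^sup>2 * (s - t)\<^sup>2 / ((D s)\<^sup>2 * D t)"
    using pos unfolding sd by (simp add: power2_eq_square mult_ac)
  also have "\<dots> \<le> (?lo * ?hi)\<^sup>2 * (s - t)\<^sup>2 / (?lo\<^sup>2 * ?lo)"
  proof (rule frac_le)
    have "w 0 * w 1 = ?lo * ?hi" by (simp add: min_def max_def)
    then show "(w 0 * w 1)\<^sup>2 * (s - t)\<^sup>2 \<le> (?lo * ?hi)\<^sup>2 * (s - t)\<^sup>2" by simp
    show "?lo\<^sup>2 * ?lo \<le> (D s)\<^sup>2 * D t"
      using lo Ds Dt pos by (intro mult_mono power_mono) auto
  qed (use lo in auto)
  also have "\<dots> = ?lo * ?hi\<^sup>2 / ?lo\<^sup>2 * (s - t)\<^sup>2"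
    using lo by (simp add: power_mult_distrib power2_eq_square)
  \<comment> \<open>The computation has produced hi^2 / lo; lo \<le> hi weakens it to hi^3 / lo^2,
    the constant of the theorem.\<close>
  also have "\<dots> \<le> ?hi * ?hi\<^sup>2 / ?lo\<^sup>2 * (s - t)\<^sup>2"
    using lohi by (intro mult_right_mono divide_right_mono) auto
  also have "?hi * ?hi\<^sup>2 = ?hi ^ 3" by (simp add: power3_eq_cube power2_eq_square)
  finally show ?thesis by (simp add: D_def)
qed

lemma shift_correction_range:
  fixes w :: "nat \<Rightarrow> real"
  assumes "0 \<le> w 0" "0 \<le> w 1" "z \<in> {0..1}"
  shows "shift_correction w z \<in> {0..1}"
proof -
  have "0 \<le> w 1 * z" "0 \<le> w 0 * (1 - z)" using assms by auto
  then show ?thesis by (auto simp: shift_correction_def divide_le_eq_1)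
qed

section \<open>Score, label and calibrated mean under one law\<close>

locale labelled_score =
  fixes d :: nat and S :: "(nat \<Rightarrow> real) set" and M :: "labelled measure" and f :: "(nat \<Rightarrow> real) \<Rightarrow> real"
  assumes law: "labelled_law d S M"
    and f_measurable: "f \<in> measurable (feature_space d S) (restrict_space borel {0..1})"
begin

lemma sets_M: "sets M = sets (feature_space d S \<Otimes>\<^sub>M count_space {0, 1})"
  using law by (simp add: labelled_law_def)

lemma space_M: "space M = space (feature_space d S) \<times> {0, 1}"
  using sets_eq_imp_space_eq[OF sets_M] by (simp add: space_pair_measure)

lemma fst_measurable [measurable]: "fst \<in> M \<rightarrow>\<^sub>M feature_space d S"
  unfolding measurable_cong_sets[OF sets_M refl] by (rule measurable_fst)

lemma snd_measurable [measurable]: "snd \<in> M \<rightarrow>\<^sub>M count_space {0, 1}"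
  unfolding measurable_cong_sets[OF sets_M refl] by (rule measurable_snd)

lemma score_measurable': "(\<lambda>\<omega>. f (fst \<omega>)) \<in> M \<rightarrow>\<^sub>M restrict_space borel {0..1}"
  by (rule measurable_compose[OF fst_measurable f_measurable])

lemma label_in: "\<omega> \<in> space M \<Longrightarrow> snd \<omega> \<in> {0, 1}"
  by (auto simp: space_M)

sublocale scored_space M "\<lambda>\<omega>. f (fst \<omega>)" "\<lambda>\<omega>. real (snd \<omega>)"
proof (intro scored_space.intro scored_space_axioms.intro)
  show "prob_space M"
    using law by (simp add: labelled_law_def)
  show "(\<lambda>\<omega>. f (fst \<omega>)) \<in> borel_measurable M"
    using score_measurable' by (simp add: measurable_restrict_space2_iff)
  show "(\<lambda>\<omega>. real (snd \<omega>)) \<in> borel_measurable M"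
    by (rule measurable_compose[OF snd_measurable]) simp
  show "f (fst \<omega>) \<in> {0..1}" if "\<omega> \<in> space M" for \<omega>
    using measurable_space[OF score_measurable' that] by (simp add: space_restrict_space)
  show "real (snd \<omega>) \<in> {0..1}" if "\<omega> \<in> space M" for \<omega>
    using label_in[OF that] by auto
qed

definition score_algebra :: "labelled measure" where
  "score_algebra = vimage_algebra (space M) (\<lambda>\<omega>. f (fst \<omega>)) borel"

sublocale cond: finite_measure_subalgebra M score_algebra
proof
  show "subalgebra M score_algebra"
    using Z_measurable by (simp add: subalgebra_def score_algebra_def measurable_iff_sets)
qed

lemma cond_label_eq: "cond_label M f = real_cond_exp M score_algebra (\<lambda>\<omega>. real (snd \<omega>))"
  by (simp add: cond_label_def score_algebra_def)

lemma cond_label_measurable [measurable]: "cond_label M f \<in> borel_measurable M"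
  by (simp add: cond_label_eq)

lemma score_function_measurable:
  assumes "g \<in> borel_measurable borel"
  shows "(\<lambda>\<omega>. g (f (fst \<omega>))) \<in> borel_measurable score_algebra"
  unfolding score_algebra_def
  by (rule measurable_compose[OF measurable_vimage_algebra1 assms]) simp

lemma integrable_label: "integrable M (\<lambda>\<omega>. real (snd \<omega>))"
  using Y_range by (intro integrable_bounded_Y) auto

text \<open>Version of the conditional mean clamped to the unit interval: pointwise estimates then
  hold everywhere instead of almost everywhere, and measurability with respect to the score is
  kept.\<close>

definition label_mean :: "labelled \<Rightarrow> real" where
  "label_mean \<omega> = min 1 (max 0 (cond_label M f \<omega>))"

lemma label_mean_range: "label_mean \<omega> \<in> {0..1}"
  by (auto simp: label_mean_def)

lemma label_mean_measurable_score: "label_mean \<in> borel_measurable score_algebra"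
  unfolding label_mean_def cond_label_eq by measurable

lemma label_mean_measurable [measurable]: "label_mean \<in> borel_measurable M"
  unfolding label_mean_def by measurable

lemma AE_label_mean: "AE \<omega> in M. cond_label M f \<omega> = label_mean \<omega>"
proof -
  have "AE \<omega> in M. real_cond_exp M score_algebra (\<lambda>\<omega>. real (snd \<omega>)) \<omega> \<ge> 0"
    using Y_range by (intro cond.real_cond_exp_ge_c integrable_label AE_I2) auto
  moreover have "AE \<omega> in M. real_cond_exp M score_algebra (\<lambda>\<omega>. real (snd \<omega>)) \<omega> \<le> 1"
    using Y_range by (intro cond.real_cond_exp_le_c integrable_label AE_I2) auto
  ultimately show ?thesis
    unfolding cond_label_eq[symmetric] by eventually_elim (simp add: label_mean_def)
qed

lemma integral_label_mean:
  assumes g: "g \<in> borel_measurable score_algebra" and bdd: "\<And>\<omega>. \<omega> \<in> space M \<Longrightarrow> \<bar>g \<omega>\<bar> \<le> c"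
  shows "(\<integral>\<omega>. g \<omega> * real (snd \<omega>) \<partial>M) = (\<integral>\<omega>. g \<omega> * label_mean \<omega> \<partial>M)"
proof -
  have [measurable]: "g \<in> borel_measurable M" by (rule measurable_from_subalg[OF cond.subalg g])
  have "integrable M (\<lambda>\<omega>. g \<omega> * real (snd \<omega>))"
  proof (rule integrable_const_bound[where B = "\<bar>c\<bar>"])
    show "AE \<omega> in M. norm (g \<omega> * real (snd \<omega>)) \<le> \<bar>c\<bar>"
    proof (rule AE_I2)
      fix \<omega> assume \<omega>: "\<omega> \<in> space M"
      then show "norm (g \<omega> * real (snd \<omega>)) \<le> \<bar>c\<bar>"
        using bdd[OF \<omega>] label_in[OF \<omega>] by auto
    qed
  qed measurable
  then have "(\<integral>\<omega>. g \<omega> * real (snd \<omega>) \<partial>M) = (\<integral>\<omega>. g \<omega> * cond_label M f \<omega> \<partial>M)"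
    unfolding cond_label_eq using g by (intro cond.real_cond_exp_intg(2)[symmetric]) auto
  also have "\<dots> = (\<integral>\<omega>. g \<omega> * label_mean \<omega> \<partial>M)"
    by (rule integral_cong_AE) (use AE_label_mean in \<open>auto elim!: eventually_mono\<close>)
  finally show ?thesis .
qed

lemma recal_risk_label_mean:
  assumes [measurable]: "h \<in> borel_measurable borel"
  shows "recal_risk M h f = (\<integral>\<omega>. (h (f (fst \<omega>)) - label_mean \<omega>)\<^sup>2 \<partial>M)"
  unfolding recal_risk_def
  by (rule integral_cong_AE) (use AE_label_mean in \<open>auto elim!: eventually_mono\<close>)

lemma label_event [measurable]: "{\<omega> \<in> space M. snd \<omega> = k} \<in> sets M"
  by measurable

lemma class_prob_0: "class_prob M 0 = 1 - class_prob M 1"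
proof -
  have "{\<omega> \<in> space M. snd \<omega> = 0} = space M - {\<omega> \<in> space M. snd \<omega> = 1}" using label_in by auto
  then show ?thesis unfolding class_prob_def by (simp only: prob_compl[OF label_event])
qed

end

section \<open>Change of measure under label shift\<close>

locale label_shift =
  P: labelled_score d S P f + Q: labelled_score d S Q f
  for d :: nat and S :: "(nat \<Rightarrow> real) set" and P Q :: "labelled measure" and f :: "(nat \<Rightarrow> real) \<Rightarrow> real" +
  assumes shift: "\<And>k A. k \<in> {0, 1} \<Longrightarrow> A \<in> sets (feature_space d S) \<Longrightarrow>
      \<P>(\<omega> in P. fst \<omega> \<in> A \<bar> snd \<omega> = k) = \<P>(\<omega> in Q. fst \<omega> \<in> A \<bar> snd \<omega> = k)"
    and P1: "class_prob P 1 \<in> {0<..<1}" and Q1: "class_prob Q 1 \<in> {0<..<1}"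
begin

lemma class_prob_pos: "k \<in> {0, 1} \<Longrightarrow> 0 < class_prob P k" "k \<in> {0, 1} \<Longrightarrow> 0 < class_prob Q k"
  using P1 Q1 P.class_prob_0 Q.class_prob_0 by auto

abbreviation w :: "nat \<Rightarrow> real" where "w \<equiv> weight P Q"

lemma w_pos: "0 < w 0" "0 < w 1"
  using class_prob_pos by (auto simp: weight_def)

lemma space_eq: "space Q = space P"
  by (simp add: P.space_M Q.space_M)

lemma sets_eq: "sets Q = sets P"
  by (simp add: P.sets_M Q.sets_M)

lemma score_algebra_eq: "Q.score_algebra = P.score_algebra"
  by (simp add: P.score_algebra_def Q.score_algebra_def space_eq)

text \<open>Within one class a joint event is determined by its slice at label \<open>k\<close>, a
  feature event to which the equality of the class-conditional laws applies.\<close>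

lemma prob_class_scaled:
  assumes k: "k \<in> {0, 1}" and A: "A \<in> sets P"
  shows "Q.prob {\<omega> \<in> A. snd \<omega> = k} = w k * P.prob {\<omega> \<in> A. snd \<omega> = k}"
proof -
  define A' where "A' = (\<lambda>x. (x, k)) -` A"
  have A': "A' \<in> sets (feature_space d S)"
    unfolding A'_def using A P.sets_M by (intro sets_Pair2) simp
  have sub: "A \<subseteq> space P" using sets.sets_into_space[OF A] .
  have "{\<omega> \<in> space P. fst \<omega> \<in> A' \<and> snd \<omega> = k} = {\<omega> \<in> A. snd \<omega> = k}"
    using sub by (auto simp: A'_def)
  then have "P.prob {\<omega> \<in> A. snd \<omega> = k} / class_prob P k = Q.prob {\<omega> \<in> A. snd \<omega> = k} / class_prob Q k"
    using shift[OF k A'] unfolding cond_prob_def class_prob_def space_eq by simp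
  then show ?thesis using class_prob_pos[OF k] by (simp add: weight_def field_simps)
qed

lemma Q_density: "Q = density P (\<lambda>\<omega>. ennreal (w (snd \<omega>)))"
proof (rule measure_eqI)
  show "sets Q = sets (density P (\<lambda>\<omega>. ennreal (w (snd \<omega>))))" by (simp add: sets_eq)
  fix A assume "A \<in> sets Q"
  then have A [measurable]: "A \<in> sets P" "A \<in> sets Q" by (auto simp: sets_eq)
  have sub: "A \<subseteq> space P" using sets.sets_into_space[OF A(1)] .
  have meas [measurable]: "{\<omega> \<in> A. snd \<omega> = k} \<in> sets P" "{\<omega> \<in> A. snd \<omega> = k} \<in> sets Q" for k
  proof -
    have "{\<omega> \<in> A. snd \<omega> = k} = A \<inter> {\<omega> \<in> space P. snd \<omega> = k}" using sub by auto
    then show "{\<omega> \<in> A. snd \<omega> = k} \<in> sets P" by (simp only:) (intro sets.Int A P.label_event)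
    then show "{\<omega> \<in> A. snd \<omega> = k} \<in> sets Q" by (simp add: sets_eq)
  qed
  have w_meas [measurable]: "(\<lambda>\<omega>. ennreal (w (snd \<omega>))) \<in> borel_measurable P"
    by (rule measurable_compose[OF P.snd_measurable]) simp
  have A01: "A = {\<omega> \<in> A. snd \<omega> = 0} \<union> {\<omega> \<in> A. snd \<omega> = 1}"
    using sub P.label_in by auto
  have "emeasure Q A = emeasure Q {\<omega> \<in> A. snd \<omega> = 0} + emeasure Q {\<omega> \<in> A. snd \<omega> = 1}"
    by (subst A01, rule plus_emeasure[symmetric]) auto
  also have "\<dots> = ennreal (w 0) * emeasure P {\<omega> \<in> A. snd \<omega> = 0} + ennreal (w 1) * emeasure P {\<omega> \<in> A. snd \<omega> = 1}"
    using w_pos by (simp add: Q.emeasure_eq_measure P.emeasure_eq_measure prob_class_scaled A flip: ennreal_mult)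
  also have "\<dots> = (\<integral>\<^sup>+\<omega>. ennreal (w 0) * indicator {\<omega> \<in> A. snd \<omega> = 0} \<omega> + ennreal (w 1) * indicator {\<omega> \<in> A. snd \<omega> = 1} \<omega> \<partial>P)"
    by (subst nn_integral_add) (auto simp: nn_integral_cmult_indicator)
  also have "\<dots> = (\<integral>\<^sup>+\<omega>. ennreal (w (snd \<omega>)) * indicator A \<omega> \<partial>P)"
    using P.label_in by (intro nn_integral_cong) (force simp: indicator_def)
  also have "\<dots> = emeasure (density P (\<lambda>\<omega>. ennreal (w (snd \<omega>)))) A"
    by (rule emeasure_density[symmetric]) auto
  finally show "emeasure Q A = emeasure (density P (\<lambda>\<omega>. ennreal (w (snd \<omega>)))) A" .
qed

lemma integral_Q:
  assumes [measurable]: "g \<in> borel_measurable P"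
  shows "(\<integral>\<omega>. g \<omega> \<partial>Q) = (\<integral>\<omega>. w (snd \<omega>) * g \<omega> \<partial>P :: real)"
proof -
  have [measurable]: "(\<lambda>\<omega>. w (snd \<omega>)) \<in> borel_measurable P"
    by (rule measurable_compose[OF P.snd_measurable]) simp
  have "AE \<omega> in P. 0 \<le> w (snd \<omega>)"
    by (rule AE_I2) (use P.label_in w_pos in \<open>force simp: less_imp_le\<close>)
  then show ?thesis by (subst Q_density, subst integral_density) auto
qed

text \<open>Conditional expectation under \<open>P\<close> of the weight of the label given the
  score, that is, the density of \<open>Q\<close> with respect to \<open>P\<close> on score events.
  It is also the denominator of the exact correction.\<close>

definition w_mean :: "labelled \<Rightarrow> real" where
  "w_mean \<omega> = w 1 * P.label_mean \<omega> + w 0 * (1 - P.label_mean \<omega>)"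

text \<open>A weight on two labels is affine in the label, w_0 + (w_1 - w_0) Y, so conditioning on
  the score just replaces \<open>Y\<close> by its conditional mean.\<close>

lemma integral_Q_score:
  assumes g: "g \<in> borel_measurable P.score_algebra" and bdd: "\<And>\<omega>. \<omega> \<in> space P \<Longrightarrow> \<bar>g \<omega>\<bar> \<le> c"
  shows "(\<integral>\<omega>. g \<omega> \<partial>Q) = (\<integral>\<omega>. w_mean \<omega> * g \<omega> \<partial>P)"
proof -
  have [measurable]: "g \<in> borel_measurable P" by (rule measurable_from_subalg[OF P.cond.subalg g])
  have ig: "integrable P (\<lambda>\<omega>. g \<omega> * u \<omega>)"
    if [measurable]: "u \<in> borel_measurable P" and u: "\<And>\<omega>. \<omega> \<in> space P \<Longrightarrow> u \<omega> \<in> {0..1}" for u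
  proof (rule P.integrable_const_bound[where B = "\<bar>c\<bar>"])
    show "AE \<omega> in P. norm (g \<omega> * u \<omega>) \<le> \<bar>c\<bar>"
    proof (rule AE_I2)
      fix \<omega> assume \<omega>: "\<omega> \<in> space P"
      have "\<bar>g \<omega>\<bar> * \<bar>u \<omega>\<bar> \<le> \<bar>c\<bar> * 1" using bdd[OF \<omega>] u[OF \<omega>] by (intro mult_mono) auto
      then show "norm (g \<omega> * u \<omega>) \<le> \<bar>c\<bar>" by (simp add: abs_mult)
    qed
  qed measurable
  have i1: "integrable P g" using ig[of "\<lambda>_. 1"] by simp
  have iY: "integrable P (\<lambda>\<omega>. g \<omega> * real (snd \<omega>))" using P.Y_range by (intro ig) auto
  have im: "integrable P (\<lambda>\<omega>. g \<omega> * P.label_mean \<omega>)" using P.label_mean_range by (intro ig) auto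
  have "(\<integral>\<omega>. g \<omega> \<partial>Q) = (\<integral>\<omega>. w (snd \<omega>) * g \<omega> \<partial>P)" by (rule integral_Q) simp
  also have "\<dots> = (\<integral>\<omega>. w 0 * g \<omega> + (w 1 - w 0) * (g \<omega> * real (snd \<omega>)) \<partial>P)"
    using P.label_in by (intro Bochner_Integration.integral_cong) (force simp: algebra_simps)+
  also have "\<dots> = w 0 * (\<integral>\<omega>. g \<omega> \<partial>P) + (w 1 - w 0) * (\<integral>\<omega>. g \<omega> * real (snd \<omega>) \<partial>P)"
    using i1 iY by simp
  also have "(\<integral>\<omega>. g \<omega> * real (snd \<omega>) \<partial>P) = (\<integral>\<omega>. g \<omega> * P.label_mean \<omega> \<partial>P)"
    by (rule P.integral_label_mean[OF g bdd])
  also have "w 0 * (\<integral>\<omega>. g \<omega> \<partial>P) + (w 1 - w 0) * (\<integral>\<omega>. g \<omega> * P.label_mean \<omega> \<partial>P)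
      = (\<integral>\<omega>. w 0 * g \<omega> + (w 1 - w 0) * (g \<omega> * P.label_mean \<omega>) \<partial>P)"
    using i1 im by simp
  also have "\<dots> = (\<integral>\<omega>. w_mean \<omega> * g \<omega> \<partial>P)"
    by (intro Bochner_Integration.integral_cong) (auto simp: w_mean_def algebra_simps)
  finally show ?thesis .
qed

lemma w_mean_pos: "0 < w_mean \<omega>"
proof -
  have "0 \<le> P.label_mean \<omega>" "P.label_mean \<omega> \<le> 1" using P.label_mean_range[of \<omega>] by auto
  then show ?thesis
    using w_pos by (cases "P.label_mean \<omega> = 0") (auto simp: w_mean_def intro: add_pos_nonneg)
qed

lemma shift_measurable: "shift_correction u \<in> borel_measurable borel"
  unfolding shift_correction_def by measurable

text \<open>Bayes' rule: multiplied by \<open>w_mean\<close> the exact correction becomes w_1 times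
  the \<open>P\<close>-mean, whose integral over a score event is the \<open>Q\<close>-probability
  of label 1 in that event. This is the characterising property of the conditional expectation under
  \<open>Q\<close>.\<close>

lemma AE_cond_label_Q: "AE \<omega> in Q. cond_label Q f \<omega> = shift_correction w (P.label_mean \<omega>)"
  unfolding Q.cond_label_eq
proof (rule Q.cond.real_cond_exp_charact)
  let ?g = "\<lambda>\<omega>. shift_correction w (P.label_mean \<omega>)"
  have g: "?g \<in> borel_measurable P.score_algebra"
    by (rule measurable_compose[OF P.label_mean_measurable_score shift_measurable])
  have g01: "?g \<omega> \<in> {0..1}" for \<omega>
    using w_pos P.label_mean_range by (intro shift_correction_range) auto
  show "?g \<in> borel_measurable Q.score_algebra" using g by (simp add: score_algebra_eq)
  show "integrable Q (\<lambda>\<omega>. real (snd \<omega>))" by (rule Q.integrable_label)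
  have gP [measurable]: "?g \<in> borel_measurable P" by (rule measurable_from_subalg[OF P.cond.subalg g])
  then have gQ: "?g \<in> borel_measurable Q" by (simp add: measurable_cong_sets[OF sets_eq refl])
  show "integrable Q ?g" using gQ g01 by (intro Q.integrable_bounded_Y) (auto simp: abs_le_iff intro: order_trans[of _ 0])
  fix A assume "A \<in> sets Q.score_algebra"
  then have A: "A \<in> sets P.score_algebra" by (simp add: score_algebra_eq)
  then have [measurable]: "A \<in> sets P" using P.cond.subalg by (auto simp: subalgebra_def)
  have iA: "(indicator A :: _ \<Rightarrow> real) \<in> borel_measurable P.score_algebra" using A by simp
  have "(\<integral>\<omega>\<in>A. real (snd \<omega>) \<partial>Q) = (\<integral>\<omega>. w (snd \<omega>) * (indicator A \<omega> * real (snd \<omega>)) \<partial>P)"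
    unfolding set_lebesgue_integral_def by (subst integral_Q) auto
  also have "\<dots> = (\<integral>\<omega>. w 1 * (indicator A \<omega> * real (snd \<omega>)) \<partial>P)"
    using P.label_in by (intro Bochner_Integration.integral_cong) force+
  also have "\<dots> = w 1 * (\<integral>\<omega>. indicator A \<omega> * P.label_mean \<omega> \<partial>P)"
    using P.integral_label_mean[OF iA, of 1] by simp
  also have "\<dots> = (\<integral>\<omega>. w_mean \<omega> * (indicator A \<omega> * ?g \<omega>) \<partial>P)"
  proof -
    have "w_mean \<omega> * (indicator A \<omega> * ?g \<omega>) = w 1 * (indicator A \<omega> * P.label_mean \<omega>)" for \<omega>
      using w_mean_pos[of \<omega>] by (simp add: shift_correction_def w_mean_def)
    then show ?thesis by (simp only: integral_mult_right_zero)
  qed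
  also have "\<dots> = (\<integral>\<omega>. indicator A \<omega> * ?g \<omega> \<partial>Q)"
  proof (rule integral_Q_score[symmetric, where c = 1])
    show "(\<lambda>\<omega>. indicator A \<omega> * ?g \<omega>) \<in> borel_measurable P.score_algebra"
      using iA g by (rule borel_measurable_times)
    show "\<bar>indicator A \<omega> * ?g \<omega>\<bar> \<le> 1" for \<omega>
      using g01[of \<omega>] by (auto simp: indicator_def)
  qed
  finally show "(\<integral>\<omega>\<in>A. real (snd \<omega>) \<partial>Q) = (\<integral>\<omega>\<in>A. ?g \<omega> \<partial>Q)"
    by (simp add: set_lebesgue_integral_def)
qed

text \<open>The outer factor 2 comes from (a + b)^2 \<le> 2 (a^2 + b^2), where a is the error of the
  correction at \<open>h\<close> and b the change of the exact correction when the calibrated mean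
  is replaced by \<open>h\<close>. The \<open>Q\<close>-integral of b^2 becomes a
  \<open>P\<close>-integral with weight \<open>w_mean\<close>, exactly the factor in the Lipschitz
  estimate.\<close>

lemma recal_risk_shift_bound:
  fixes w' :: "nat \<Rightarrow> real"
  assumes h: "h \<in> borel_measurable borel" and h01: "\<And>z. z \<in> {0..1} \<Longrightarrow> h z \<in> {0..1}"
    and w': "0 < w' 0" "0 < w' 1"
  defines "\<rho> \<equiv> \<lambda>k. w' k / w k"
  shows "recal_risk Q (shift_correction w' \<circ> h) f
    \<le> 2 * (((\<rho> 0 - \<rho> 1) / (\<rho> 0 + \<rho> 1))\<^sup>2
        + weight_max P Q ^ 3 / (weight_min P Q)\<^sup>2 * recal_risk P h f)"
proof -
  let ?r = "(\<rho> 0 - \<rho> 1) / (\<rho> 0 + \<rho> 1)"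
  let ?C = "weight_max P Q ^ 3 / (weight_min P Q)\<^sup>2"
  let ?h = "\<lambda>\<omega>. h (f (fst \<omega>))"
  let ?e = "\<lambda>\<omega>. (shift_correction w (?h \<omega>) - shift_correction w (P.label_mean \<omega>))\<^sup>2"
  note [measurable] = h shift_measurable
  have hF: "?h \<in> borel_measurable P.score_algebra" by (rule P.score_function_measurable[OF h])
  have lm: "P.label_mean \<in> borel_measurable P.score_algebra" by (rule P.label_mean_measurable_score)
  have [measurable]: "?h \<in> borel_measurable P" "?h \<in> borel_measurable Q" by measurable
  have [measurable]: "P.label_mean \<in> borel_measurable Q"
    using P.label_mean_measurable by (simp add: measurable_cong_sets[OF sets_eq refl])
  have hr: "?h \<omega> \<in> {0..1}" if "\<omega> \<in> space P" for \<omega> using h01 P.Z_range[OF that] by blast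
  have sr: "shift_correction w (P.label_mean \<omega>) \<in> {0..1}" for \<omega>
    using w_pos P.label_mean_range by (intro shift_correction_range) auto
  have srh: "shift_correction w (?h \<omega>) \<in> {0..1}" "shift_correction w' (?h \<omega>) \<in> {0..1}" if "\<omega> \<in> space P" for \<omega>
    using w_pos w' hr[OF that] by (auto intro!: shift_correction_range simp del: atLeastAtMost_iff)
  have sq: "(a - b)\<^sup>2 \<le> 1" if "a \<in> {0..1}" "b \<in> {0..1}" for a b :: real
    using that by (auto intro!: abs_square_le_1[THEN iffD2])
  have eF: "?e \<in> borel_measurable P.score_algebra"
    using measurable_compose[OF hF shift_measurable] measurable_compose[OF lm shift_measurable]
    by (intro borel_measurable_power borel_measurable_diff)
  have e1: "\<bar>?e \<omega>\<bar> \<le> 1" if "\<omega> \<in> space P" for \<omega> using sq[OF srh(1)[OF that] sr] by simp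
  have ie: "integrable Q ?e"
    using e1 by (intro Q.integrable_bounded_Y) (auto simp: space_eq)
  have "recal_risk Q (shift_correction w' \<circ> h) f
      = (\<integral>\<omega>. (shift_correction w' (?h \<omega>) - shift_correction w (P.label_mean \<omega>))\<^sup>2 \<partial>Q)"
    unfolding recal_risk_def comp_def
    by (rule integral_cong_AE) (use AE_cond_label_Q in \<open>auto elim!: eventually_mono\<close>)
  also have "\<dots> \<le> (\<integral>\<omega>. 2 * (?r\<^sup>2 + ?e \<omega>) \<partial>Q)"
  proof (rule integral_mono)
    show "integrable Q (\<lambda>\<omega>. (shift_correction w' (?h \<omega>) - shift_correction w (P.label_mean \<omega>))\<^sup>2)"
      using sq[OF srh(2) sr] by (intro Q.integrable_bounded_Y) (auto simp: space_eq)
    show "integrable Q (\<lambda>\<omega>. 2 * (?r\<^sup>2 + ?e \<omega>))" using ie by simp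
    fix \<omega> assume "\<omega> \<in> space Q"
    then have \<omega>: "\<omega> \<in> space P" by (simp add: space_eq)
    define a where "a = shift_correction w' (?h \<omega>) - shift_correction w (?h \<omega>)"
    define b where "b = shift_correction w (?h \<omega>) - shift_correction w (P.label_mean \<omega>)"
    have "\<bar>a\<bar> \<le> \<bar>?r\<bar>" unfolding a_def \<rho>_def by (rule shift_correction_diff[OF w_pos w' hr[OF \<omega>]])
    then have "a\<^sup>2 \<le> ?r\<^sup>2" by (rule abs_le_square_iff[THEN iffD1])
    then have "2 * (a\<^sup>2 + b\<^sup>2) \<le> 2 * (?r\<^sup>2 + b\<^sup>2)" by simp
    moreover have "(a + b)\<^sup>2 \<le> 2 * (a\<^sup>2 + b\<^sup>2)"
    proof -
      have "2 * (a\<^sup>2 + b\<^sup>2) - (a + b)\<^sup>2 = (a - b)\<^sup>2" by (simp add: power2_eq_square algebra_simps)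
      then show ?thesis using zero_le_power2[of "a - b"] by linarith
    qed
    ultimately have "(a + b)\<^sup>2 \<le> 2 * (?r\<^sup>2 + b\<^sup>2)" by (rule order_trans[rotated])
    then show "(shift_correction w' (?h \<omega>) - shift_correction w (P.label_mean \<omega>))\<^sup>2 \<le> 2 * (?r\<^sup>2 + ?e \<omega>)"
      by (simp add: a_def b_def)
  qed
  also have "\<dots> = 2 * (?r\<^sup>2 + (\<integral>\<omega>. ?e \<omega> \<partial>Q))"
    using ie by (simp add: Q.prob_space)
  also have "(\<integral>\<omega>. ?e \<omega> \<partial>Q) = (\<integral>\<omega>. w_mean \<omega> * ?e \<omega> \<partial>P)"
    by (rule integral_Q_score[OF eF e1])
  also have "\<dots> \<le> (\<integral>\<omega>. ?C * (?h \<omega> - P.label_mean \<omega>)\<^sup>2 \<partial>P)"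
  proof (rule integral_mono)
    show "integrable P (\<lambda>\<omega>. ?C * (?h \<omega> - P.label_mean \<omega>)\<^sup>2)"
      using sq[OF hr P.label_mean_range]
      by (intro integrable_mult_right P.integrable_bounded_Y) auto
    show le: "w_mean \<omega> * ?e \<omega> \<le> ?C * (?h \<omega> - P.label_mean \<omega>)\<^sup>2" if "\<omega> \<in> space P" for \<omega>
      unfolding w_mean_def weight_max_def weight_min_def
      by (rule shift_correction_lipschitz[OF w_pos hr[OF that] P.label_mean_range])
    show "integrable P (\<lambda>\<omega>. w_mean \<omega> * ?e \<omega>)"
    proof (rule P.integrable_const_bound[where B = "\<bar>w 1\<bar> + \<bar>w 0\<bar>"])
      show "AE \<omega> in P. norm (w_mean \<omega> * ?e \<omega>) \<le> \<bar>w 1\<bar> + \<bar>w 0\<bar>"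
      proof (rule AE_I2)
        fix \<omega> assume \<omega>: "\<omega> \<in> space P"
        have "0 \<le> P.label_mean \<omega>" "P.label_mean \<omega> \<le> 1" using P.label_mean_range[of \<omega>] by auto
        then have "w_mean \<omega> \<le> w 1 * 1 + w 0 * 1"
          unfolding w_mean_def using w_pos by (intro add_mono mult_left_mono) auto
        then have "\<bar>w_mean \<omega>\<bar> * \<bar>?e \<omega>\<bar> \<le> (w 1 + w 0) * 1"
          using w_mean_pos[of \<omega>] e1[OF \<omega>] w_pos by (intro mult_mono) auto
        then show "norm (w_mean \<omega> * ?e \<omega>) \<le> \<bar>w 1\<bar> + \<bar>w 0\<bar>" using w_pos by (simp add: abs_mult)
      qed
    qed (unfold w_mean_def, measurable)
  qed
  also have "\<dots> = ?C * recal_risk P h f"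
    by (simp add: P.recal_risk_label_mean[OF h])
  finally show ?thesis by (simp add: comp_def)
qed

end

section \<open>Estimation from samples\<close>

lemma order_stat_0: "order_stat n z 0 = order_stat n z 1"
  by (simp add: order_stat_def)

context scored_space
begin

lemma order_stat_measurable:
  assumes n: "0 < n" and k: "k \<le> n"
  shows "(\<lambda>x. order_stat n (\<lambda>l. Z (x l)) k) \<in> borel_measurable (samples n)"
proof (rule borel_measurableI_le)
  fix y :: real
  \<comment> \<open>Number 0 does occur for an edge when there are fewer points than bins; truncated
    subtraction identifies it with number 1.\<close>
  define k' where "k' = max 1 k"
  have k': "1 \<le> k'" "k' \<le> n" using n k by (auto simp: k'_def)
  have eq: "order_stat n z k = order_stat n z k'" for z
    by (cases "k = 0") (simp_all add: k'_def order_stat_0 max_def)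
  have card: "real (card {i. i < n \<and> Z (x i) \<le> y}) = (\<Sum>i<n. if Z (x i) \<le> y then 1 else 0)" for x
    by (simp add: sum.If_cases Int_def)
  have [measurable]: "(\<lambda>x. real (card {i. i < n \<and> Z (x i) \<le> y})) \<in> borel_measurable (samples n)"
    unfolding card
  proof (rule borel_measurable_sum)
    fix l assume "l \<in> {..<n}"
    then have [measurable]: "(\<lambda>x. Z (x l)) \<in> borel_measurable (samples n)"
      by (auto intro: Z_component_measurable)
    show "(\<lambda>x. if Z (x l) \<le> y then 1 else 0 :: real) \<in> borel_measurable (samples n)"
      by measurable
  qed
  have "{x \<in> space (samples n). order_stat n (\<lambda>l. Z (x l)) k \<le> y}
      = {x \<in> space (samples n). real k' \<le> real (card {i. i < n \<and> Z (x i) \<le> y})}"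
    unfolding eq using order_stat_le_iff[OF k'] by simp
  also have "\<dots> \<in> sets (samples n)" by measurable
  finally show "{x \<in> space (samples n). order_stat n (\<lambda>l. Z (x l)) k \<le> y} \<in> sets (samples n)" .
qed

lemma umb_edge_measurable:
  assumes "0 < n" "b \<le> B"
  shows "(\<lambda>x. umb_edge n (\<lambda>l. Z (x l)) B b) \<in> borel_measurable (samples n)"
  unfolding umb_edge_def
  using order_stat_measurable[OF assms(1) mult_div_le_self[OF assms(2)]] by simp

text \<open>Sample and tested score are both functions on a common space \<open>N\<close>: the risk
  integrates a fresh score for a fixed sample, so its measurability in the sample needs joint
  measurability.\<close>

lemma umb_indicator_measurable:
  assumes n: "0 < n" and b: "b \<in> {1..B}"
    and D: "D \<in> N \<rightarrow>\<^sub>M samples n" and g [measurable]: "g \<in> borel_measurable N"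
  shows "(\<lambda>x. indicator (umb_bin n (\<lambda>l. Z (D x l)) B b) (g x) :: real) \<in> borel_measurable N"
proof -
  have [measurable]: "(\<lambda>x. umb_edge n (\<lambda>l. Z (D x l)) B b) \<in> borel_measurable N"
    "(\<lambda>x. umb_edge n (\<lambda>l. Z (D x l)) B (b - 1)) \<in> borel_measurable N"
    using b by (auto intro!: measurable_compose[OF D umb_edge_measurable[OF n]])
  show ?thesis
  proof (cases "b = 1")
    case True
    have eq: "indicator (umb_bin n (\<lambda>l. Z (D x l)) B b) (g x)
        = (if 0 \<le> g x \<and> g x \<le> umb_edge n (\<lambda>l. Z (D x l)) B b then 1 else 0 :: real)" for x
      using True by (simp add: umb_bin_def indicator_def)
    show ?thesis unfolding eq by measurable
  next
    case False
    have eq: "indicator (umb_bin n (\<lambda>l. Z (D x l)) B b) (g x)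
        = (if umb_edge n (\<lambda>l. Z (D x l)) B (b - 1) < g x \<and> g x \<le> umb_edge n (\<lambda>l. Z (D x l)) B b
           then 1 else 0 :: real)" for x
      using False by (simp add: umb_bin_def indicator_def)
    show ?thesis unfolding eq by measurable
  qed
qed

end

text \<open>The complement of the support is a union of null open sets; by Lindelof's theorem
  countably many of them already cover it.\<close>

lemma AE_measure_support:
  assumes N: "sets N = sets borel"
  shows "AE z in N. z \<in> measure_support N"
proof -
  define \<U> where "\<U> = {U. open U \<and> emeasure N U = 0}"
  obtain \<V> where V: "\<V> \<subseteq> \<U>" "countable \<V>" "\<Union>\<V> = \<Union>\<U>"
    using Lindelof[of \<U>] by (auto simp: \<U>_def)
  have "U \<in> null_sets N" if "U \<in> \<V>" for U
    using V(1) that N by (auto simp: \<U>_def null_sets_def)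
  then have "\<Union>\<V> \<in> null_sets N" using V(2) null_sets_UN'[of \<V> "\<lambda>U. U" N] by auto
  moreover have "{z \<in> space N. z \<notin> measure_support N} \<subseteq> \<Union>\<V>"
    unfolding V(3) by (auto simp: measure_support_def \<U>_def zero_less_iff_neq_zero)
  ultimately show ?thesis by (rule AE_I')
qed

lemma abs_continuous_fun_isCont:
  assumes F: "abs_continuous_fun F"
  shows "isCont F a"
  unfolding continuous_at_eps_delta
proof (intro allI impI)
  fix e :: real assume "0 < e"
  then have "\<exists>\<eta>>0. \<forall>(m::nat) (a::nat \<Rightarrow> real) b.
      (\<forall>i<m. a i \<le> b i) \<and> disjoint_family_on (\<lambda>i. {a i<..<b i}) {..<m} \<and>
        (\<Sum>i<m. b i - a i) < \<eta> \<longrightarrow> (\<Sum>i<m. \<bar>F (b i) - F (a i)\<bar>) < e"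
    using F unfolding abs_continuous_fun_def by simp
  then obtain \<eta> where \<eta>: "0 < \<eta>" and small:
    "\<forall>(m::nat) (a::nat \<Rightarrow> real) b. (\<forall>i<m. a i \<le> b i) \<and> disjoint_family_on (\<lambda>i. {a i<..<b i}) {..<m} \<and>
        (\<Sum>i<m. b i - a i) < \<eta> \<longrightarrow> (\<Sum>i<m. \<bar>F (b i) - F (a i)\<bar>) < e"
    by (elim exE conjE)
  \<comment> \<open>A single interval, m = 1, turns absolute continuity into uniform
    continuity.\<close>
  have one: "\<bar>F y - F x\<bar> < e" if "x \<le> y" "y - x < \<eta>" for x y
    using small[rule_format, of 1 "\<lambda>_. x" "\<lambda>_. y"] that by (simp add: disjoint_family_on_def)
  show "\<exists>d>0. \<forall>x'. dist x' a < d \<longrightarrow> dist (F x') (F a) < e"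
  proof (intro exI[of _ \<eta>] conjI allI impI \<eta>)
    fix x assume "dist x a < \<eta>"
    then show "dist (F x) (F a) < e"
      using one[of x a] one[of a x] by (cases "x \<le> a") (auto simp: dist_real_def abs_minus_commute)
  qed
qed

section \<open>Measurability, range and accuracy of the estimators\<close>

context labelled_score
begin

lemma recal_est_measurable_raw:
  assumes n: "0 < n" and D: "D \<in> N \<rightarrow>\<^sub>M samples n" and g: "g \<in> borel_measurable N"
  shows "(\<lambda>x. recal_est f n (D x) B (g x)) \<in> borel_measurable N"
    and "\<And>b. b \<in> {1..B} \<Longrightarrow> (\<lambda>x. bin_count f n (D x) B b) \<in> borel_measurable N"
proof -
  have Zi [measurable]: "(\<lambda>x. f (fst (D x i))) \<in> borel_measurable N" if "i < n" for i
    using measurable_compose[OF D Z_component_measurable[OF that]] by simp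
  have Yi [measurable]: "(\<lambda>x. real (snd (D x i))) \<in> borel_measurable N" if "i < n" for i
  proof -
    have "(\<lambda>x. x i) \<in> samples n \<rightarrow>\<^sub>M M" using that by (intro measurable_component_singleton) auto
    from measurable_compose[OF measurable_compose[OF D this] Y_measurable] show ?thesis .
  qed
  have ind: "(\<lambda>x. indicator (data_bin f n (D x) B b) (u x) :: real) \<in> borel_measurable N"
    if "b \<in> {1..B}" "u \<in> borel_measurable N" for b u
    unfolding data_bin_def by (rule umb_indicator_measurable[OF n that(1) D that(2)])
  have cnt: "(\<lambda>x. bin_count f n (D x) B b) \<in> borel_measurable N" if "b \<in> {1..B}" for b
    unfolding bin_count_def using ind[OF that Zi] by (intro borel_measurable_sum) auto
  then show "\<And>b. b \<in> {1..B} \<Longrightarrow> (\<lambda>x. bin_count f n (D x) B b) \<in> borel_measurable N" .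
  have "(\<lambda>x. bin_mean f n (D x) B b) \<in> borel_measurable N" if "b \<in> {1..B}" for b
    unfolding bin_mean_def using ind[OF that Zi] Yi cnt[OF that]
    by (intro borel_measurable_divide borel_measurable_sum borel_measurable_times) auto
  then show "(\<lambda>x. recal_est f n (D x) B (g x)) \<in> borel_measurable N"
    unfolding recal_est_def using ind[OF _ g]
    by (intro borel_measurable_sum borel_measurable_times) auto
qed

lemma emp_class_prob_measurable:
  assumes D: "D \<in> N \<rightarrow>\<^sub>M samples n"
  shows "(\<lambda>x. emp_class_prob n (D x) k) \<in> borel_measurable N"
  unfolding emp_class_prob_def
proof (intro borel_measurable_divide borel_measurable_sum borel_measurable_const)
  fix i assume "i \<in> {..<n}"
  then have i: "(\<lambda>x. x i) \<in> samples n \<rightarrow>\<^sub>M M" by (intro measurable_component_singleton) auto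
  have "(\<lambda>\<omega>. of_bool (snd \<omega> = k) :: real) \<in> borel_measurable M"
    by (rule measurable_compose[OF snd_measurable]) simp
  from measurable_compose[OF measurable_compose[OF D i] this]
  show "(\<lambda>x. of_bool (snd (D x i) = k) :: real) \<in> borel_measurable N" .
qed

lemma recal_est_measurable: "recal_est f n D B \<in> borel_measurable borel"
proof -
  have "data_bin f n D B b \<in> sets borel" for b by (simp add: data_bin_def umb_bin_def)
  then show ?thesis unfolding recal_est_def by measurable
qed

lemma sample_label: "D \<in> space (samples n) \<Longrightarrow> i < n \<Longrightarrow> snd (D i) \<in> {0, 1}"
  by (rule label_in[OF samples_range])

text \<open>The label sum lies between 0 and the count; an empty bin has mean 0 by division by zero,
  which is in range as well.\<close>

lemma bin_mean_range:
  assumes D: "D \<in> space (samples n)"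
  shows "bin_mean f n D B b \<in> {0..1}"
proof -
  have "(\<Sum>i<n. real (snd (D i)) * indicator (data_bin f n D B b) (f (fst (D i)))) \<le> bin_count f n D B b"
    unfolding bin_count_def using sample_label[OF D] by (intro sum_mono) (force simp: indicator_def)
  moreover have "0 \<le> (\<Sum>i<n. real (snd (D i)) * indicator (data_bin f n D B b) (f (fst (D i))))"
    by (intro sum_nonneg) auto
  ultimately show ?thesis by (auto simp: bin_mean_def divide_le_eq_1)
qed

lemma recal_est_range:
  assumes D: "D \<in> space (samples n)" and n: "0 < n" and B: "0 < B" and z: "z \<in> {0..1}"
  shows "recal_est f n D B z \<in> {0..1}"
proof -
  have sc: "f (fst (D i)) \<in> {0..1}" if "i < n" for i using samples_Z_range[OF D that] .
  obtain b where b: "b \<in> {1..B}" "z \<in> umb_bin n (\<lambda>i. f (fst (D i))) B b"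
    using umb_bin_exists[where z = "\<lambda>i. f (fst (D i))", OF n B sc z] by auto
  have "recal_est f n D B z = bin_mean f n D B b"
    unfolding recal_est_def data_bin_def
    using umb_bin_sum[where z = "\<lambda>i. f (fst (D i))" and c = "bin_mean f n D B", OF n B sc b] .
  then show ?thesis using bin_mean_range[OF D] by simp
qed

lemma emp_class_prob_nonneg: "0 \<le> emp_class_prob n D k"
  by (auto simp: emp_class_prob_def intro!: divide_nonneg_nonneg sum_nonneg)

lemma emp_class_prob_0:
  assumes D: "D \<in> space (samples n)" and n: "0 < n"
  shows "emp_class_prob n D 0 = 1 - emp_class_prob n D 1"
proof -
  have "(\<Sum>i<n. of_bool (snd (D i) = 0)) = (\<Sum>i<n. 1 - of_bool (snd (D i) = 1) :: real)"
    using sample_label[OF D] by (intro sum.cong) force+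
  then show ?thesis using n by (simp add: emp_class_prob_def sum_subtractf diff_divide_distrib)
qed

text \<open>The two frequencies sum to 1, as do the two probabilities, so both classes have the same
  absolute error and it is enough to watch the rarer one. One pair of tails serves both
  classes.\<close>

lemma class_probs_concentrate:
  assumes \<epsilon>: "0 \<le> \<epsilon>" "\<epsilon> \<le> 1" and n: "0 < n"
  obtains N where "N \<in> sets (samples n)"
    "emeasure (samples n) N \<le> ennreal (2 * exp (- (real n * class_prob_min M * \<epsilon>\<^sup>2 / 4)))"
    "\<And>D k. D \<in> space (samples n) - N \<Longrightarrow> k \<in> {0, 1} \<Longrightarrow>
      \<bar>emp_class_prob n D k - class_prob M k\<bar> \<le> \<epsilon> * class_prob_min M"
proof -
  define p where "p = class_prob_min M"
  obtain k0 where k0: "k0 \<in> {0, 1}" "p = class_prob M k0"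
    by (cases "class_prob M 0 \<le> class_prob M 1") (auto simp: p_def class_prob_min_def)
  define A where "A = {\<omega> \<in> space M. snd \<omega> = k0}"
  have A [measurable]: "A \<in> events" unfolding A_def by measurable
  have pA: "prob A = p" by (simp add: A_def k0 class_prob_def)
  let ?N = "\<lambda>D. \<Sum>l<n. indicator A (D l) :: real"
  define T where "T \<sigma> = {D \<in> space (samples n). \<epsilon> * (real n * prob A) \<le> \<sigma> * (?N D - real n * prob A)}" for \<sigma> :: real
  have T [measurable]: "T \<sigma> \<in> sets (samples n)" for \<sigma> unfolding T_def by measurable
  let ?e = "exp (- (real n * p * \<epsilon>\<^sup>2 / 4))"
  show ?thesis
  proof (rule that[of "T 1 \<union> T (-1)"])
    show "T 1 \<union> T (-1) \<in> sets (samples n)" by measurable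
    have "emeasure (samples n) (T 1 \<union> T (-1)) \<le> emeasure (samples n) (T 1) + emeasure (samples n) (T (-1))"
      by (intro emeasure_subadditive) auto
    also have "\<dots> \<le> ennreal ?e + ennreal ?e"
      unfolding T_def pA[symmetric] using \<epsilon> by (intro add_mono binomial_tail) auto
    also have "\<dots> = ennreal (2 * ?e)" by (simp flip: ennreal_plus)
    finally show "emeasure (samples n) (T 1 \<union> T (-1)) \<le> ennreal (2 * exp (- (real n * class_prob_min M * \<epsilon>\<^sup>2 / 4)))"
      by (simp add: p_def)
  next
    fix D k assume D: "D \<in> space (samples n) - (T 1 \<union> T (-1))" and k: "k \<in> {0, 1 :: nat}"
    have Ds: "D \<in> space (samples n)" using D by simp
    have N: "?N D = real n * emp_class_prob n D k0"
    proof -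
      have "?N D = (\<Sum>l<n. of_bool (snd (D l) = k0))"
        using samples_range[OF Ds] by (intro sum.cong) (auto simp: A_def indicator_def)
      then show ?thesis using n by (simp add: emp_class_prob_def)
    qed
    have "\<bar>?N D - real n * p\<bar> \<le> \<epsilon> * (real n * p)"
      using D by (auto simp: T_def pA not_le abs_le_iff)
    then have "real n * \<bar>emp_class_prob n D k0 - p\<bar> \<le> real n * (\<epsilon> * p)"
      unfolding N by (simp add: abs_mult mult.left_commute flip: right_diff_distrib)
    then have main: "\<bar>emp_class_prob n D k0 - class_prob M k0\<bar> \<le> \<epsilon> * p" using n k0 by simp
    have "\<bar>emp_class_prob n D k - class_prob M k\<bar> = \<bar>emp_class_prob n D k0 - class_prob M k0\<bar>"
      using k k0(1) emp_class_prob_0[OF Ds n] class_prob_0 by auto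
    then show "\<bar>emp_class_prob n D k - class_prob M k\<bar> \<le> \<epsilon> * class_prob_min M"
      using main by (simp add: p_def)
  qed
qed

text \<open>Joins three exceptional sets: tied scores, deviating averages and underfilled quantile
  cells. Outside them no bin is empty, so the bin means are genuine quotients.\<close>

lemma recal_est_risk_high_prob:
  assumes opt: "optimal_recal M f h" and ac: "abs_continuous_fun (cdf (score_law M f))"
    and mono: "mono_on (measure_support (score_law M f)) h" and K: "0 < K"
    and lip: "\<And>z1 z2. z1 \<in> {0..1} \<Longrightarrow> z2 \<in> {0..1} \<Longrightarrow> z1 \<le> z2 \<Longrightarrow>
      h z2 - h z1 \<le> K * (cdf (score_law M f) z2 - cdf (score_law M f) z1)"
    and B: "1 \<le> B" and t: "0 < t" and n: "2 \<le> real n / real B"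
  obtains N where "N \<in> sets (samples n)"
    "emeasure (samples n) N \<le> ennreal (2 * real B * exp (- (2 * (real (n div B) - 1) * t\<^sup>2)))
      + ennreal (real B * exp (- (real n / real B / 16)))"
    "\<And>D. D \<in> space (samples n) - N \<Longrightarrow>
      recal_risk M (recal_est f n D B) f \<le> (t + 1 / real (n div B))\<^sup>2 + 8 * K\<^sup>2 / (real B)\<^sup>2"
    "\<And>D b. D \<in> space (samples n) - N \<Longrightarrow> b \<in> {1..B} \<Longrightarrow> bin_count f n D B b \<noteq> 0"
proof -
  let ?Z = "\<lambda>\<omega>. f (fst \<omega>)"
  have Bpos: "0 < B" using B by simp
  have Bn: "B \<le> n"
  proof -
    have "2 * real B \<le> real n" using n Bpos by (simp add: field_simps)
    then show ?thesis using Bpos by linarith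
  qed
  have npos: "0 < n" using Bn Bpos by simp
  have cdf: "cdf (score_law M f) = score_cdf"
    unfolding score_law_def by (rule ext) (rule cdf_distr_score)
  have cont: "isCont score_cdf a" for a using abs_continuous_fun_isCont[OF ac] unfolding cdf .
  have no_ties: "AE x in samples n. inj_on (\<lambda>l. ?Z (x l)) {..<n}"
    by (intro AE_no_ties atomless cont)
  have h [measurable]: "h \<in> borel_measurable borel" using opt by (simp add: optimal_recal_def)
  have h_lm: "AE \<omega> in M. h (?Z \<omega>) = label_mean \<omega>"
  proof -
    have "AE \<omega> in M. h (?Z \<omega>) = cond_label M f \<omega>" using opt by (simp add: optimal_recal_def)
    then show ?thesis using AE_label_mean by eventually_elim simp
  qed
  have h01: "AE \<omega> in M. h (?Z \<omega>) \<in> {0..1}"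
    using h_lm by eventually_elim (use label_mean_range in auto)
  have mean: "(\<integral>\<omega>. indicator {u<..v} (?Z \<omega>) * h (?Z \<omega>) \<partial>M) = (\<integral>\<omega>. indicator {u<..v} (?Z \<omega>) * real (snd \<omega>) \<partial>M)" for u v
  proof -
    have "(\<integral>\<omega>. indicator {u<..v} (?Z \<omega>) * h (?Z \<omega>) \<partial>M) = (\<integral>\<omega>. indicator {u<..v} (?Z \<omega>) * label_mean \<omega> \<partial>M)"
      by (rule integral_cong_AE) (use h_lm in \<open>auto elim!: eventually_mono\<close>)
    also have "\<dots> = (\<integral>\<omega>. indicator {u<..v} (?Z \<omega>) * real (snd \<omega>) \<partial>M)"
      by (rule integral_label_mean[symmetric, where c = 1])
        (auto intro!: score_function_measurable simp: indicator_def)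
    finally show ?thesis .
  qed
  \<comment> \<open>Monotonicity of \<open>h\<close> is available on the support and the growth
    bound on the unit interval; the scores lie in both almost surely.\<close>
  define S where "S = measure_support (score_law M f) \<inter> {0..1}"
  have S: "AE \<omega> in M. ?Z \<omega> \<in> S"
  proof -
    have "AE z in score_law M f. z \<in> measure_support (score_law M f)"
      by (rule AE_measure_support) (simp add: score_law_def)
    then have "AE \<omega> in M. ?Z \<omega> \<in> measure_support (score_law M f)"
      unfolding score_law_def by (rule AE_distrD[rotated]) simp
    moreover have "AE \<omega> in M. ?Z \<omega> \<in> {0..1}" using Z_range by (intro AE_I2)
    ultimately show ?thesis by eventually_elim (simp add: S_def)
  qed
  have osc: "\<bar>h z2 - h z1\<bar> \<le> K * bmass z1 z2" if "z1 \<in> S" "z2 \<in> S" "z1 \<le> z2" for z1 z2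
  proof -
    have "h z1 \<le> h z2" using mono that by (auto simp: S_def mono_on_def)
    moreover have "h z2 - h z1 \<le> K * bmass z1 z2"
      using lip[of z1 z2] that bmass_eq_cdf_diff[OF that(3)] by (simp add: S_def cdf)
    ultimately show ?thesis by simp
  qed
  obtain N0 where N0: "{x \<in> space (samples n). \<not> inj_on (\<lambda>l. ?Z (x l)) {..<n}} \<subseteq> N0"
    "emeasure (samples n) N0 = 0" "N0 \<in> sets (samples n)"
    by (rule AE_E[OF no_ties])
  obtain N1 where N1: "N1 \<in> sets (samples n)"
    "emeasure (samples n) N1 \<le> ennreal (2 * real B * exp (- (2 * (real (n div B) - 1) * t\<^sup>2)))"
    "\<And>x b. x \<in> space (samples n) - N1 \<Longrightarrow> inj_on (\<lambda>l. ?Z (x l)) {..<n} \<Longrightarrow> b \<in> {1..B} \<Longrightarrow>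
      0 < bmass (bin_lo n x B b) (bin_hi n x B b) \<Longrightarrow>
      \<bar>(\<Sum>l | l < n \<and> bin_lo n x B b < ?Z (x l) \<and> ?Z (x l) \<le> bin_hi n x B b. real (snd (x l)))
          / real (card {l. l < n \<and> bin_lo n x B b < ?Z (x l) \<and> ?Z (x l) \<le> bin_hi n x B b})
        - bavg (bin_lo n x B b) (bin_hi n x B b)\<bar> \<le> t + 1 / real (n div B)"
  proof (rule bin_means_concentrate[OF no_ties t Bpos Bn], goal_cases)
    case (1 N)
    show ?case by (rule 1(1)[OF 1(2-4)])
  qed
  obtain N2 where N2: "N2 \<in> sets (samples n)"
    "emeasure (samples n) N2 \<le> ennreal (real B * exp (- (real n / real B / 16)))"
    "\<And>x u v. x \<in> space (samples n) - N2 \<Longrightarrow> u \<le> v \<Longrightarrow> 2 \<le> real n / real B \<Longrightarrow>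
      real (card {l. l < n \<and> u < ?Z (x l) \<and> ?Z (x l) \<le> v}) \<le> real n / real B + 1 \<Longrightarrow>
      bmass u v \<le> 4 / real B"
  proof (rule bin_masses_bounded[where n = n, OF cont Bpos], goal_cases)
    case (1 N)
    show ?case by (rule 1(1)[OF 1(2-4)])
  qed
  \<comment> \<open>Replaces the bins of the estimator by half-open intervals with the same sample
    points, and reads off that each holds floor(n/B) or floor(n/B) + 1 of them.\<close>
  have bins: "bin_count f n D B b = real (card L) \<and> bin_mean f n D B b = (\<Sum>l\<in>L. real (snd (D l))) / real (card L)
      \<and> n div B \<le> card L \<and> card L \<le> n div B + 1"
    if D: "D \<in> space (samples n)" and inj: "inj_on (\<lambda>l. ?Z (D l)) {..<n}" and b: "b \<in> {1..B}"
      and L: "L = {l. l < n \<and> bin_lo n D B b < ?Z (D l) \<and> ?Z (D l) \<le> bin_hi n D B b}" for D b L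
  proof -
    have z: "?Z (D l) \<in> {0..1}" if "l < n" for l using samples_Z_range[OF D that] .
    have "?Z (D l) \<in> data_bin f n D B b \<longleftrightarrow> l \<in> L" if "l < n" for l
      using umb_bin_iff[where z = "\<lambda>l. ?Z (D l)", OF npos Bpos z z[OF that] b] that
      by (simp add: data_bin_def L bin_lo_def bin_hi_def)
    then have ind: "indicator (data_bin f n D B b) (?Z (D l)) = (if l \<in> L then 1 else 0 :: real)" if "l < n" for l
      using that by (simp add: indicator_def)
    have sum: "(\<Sum>l<n. if l \<in> L then g l else 0) = (\<Sum>l\<in>L. g l)" for g :: "nat \<Rightarrow> real"
    proof -
      have "L \<subseteq> {..<n}" using L by auto
      then have "(\<Sum>l\<in>L. g l) = (\<Sum>l\<in>L. if l \<in> L then g l else 0)" by simp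
      also have "\<dots> = (\<Sum>l<n. if l \<in> L then g l else 0)"
        using \<open>L \<subseteq> {..<n}\<close> by (intro sum.mono_neutral_left) auto
      finally show ?thesis by simp
    qed
    have cnt: "bin_count f n D B b = real (card L)"
      unfolding bin_count_def using sum[of "\<lambda>_. 1"] by (simp add: ind)
    have "(\<Sum>l<n. real (snd (D l)) * indicator (data_bin f n D B b) (?Z (D l))) = (\<Sum>l<n. if l \<in> L then real (snd (D l)) else 0)"
      by (intro sum.cong) (auto simp: ind)
    then have mean: "bin_mean f n D B b = (\<Sum>l\<in>L. real (snd (D l))) / real (card L)"
      unfolding bin_mean_def cnt sum by simp
    have "card L = n * b div B - n * (b - 1) div B"
      unfolding L by (rule card_in_bin[OF D inj b Bn])
    then show ?thesis using cnt mean div_increment[of B b n] Bpos b by simp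
  qed
  show ?thesis
  proof (rule that[of "N0 \<union> N1 \<union> N2"])
    show "N0 \<union> N1 \<union> N2 \<in> sets (samples n)" using N0 N1 N2 by simp
    have "emeasure (samples n) (N0 \<union> N1 \<union> N2) \<le> emeasure (samples n) (N0 \<union> N1) + emeasure (samples n) N2"
      using N0 N1 N2 by (intro emeasure_subadditive) auto
    also have "\<dots> \<le> emeasure (samples n) N0 + emeasure (samples n) N1 + emeasure (samples n) N2"
      using N0 N1 N2 by (intro add_right_mono emeasure_subadditive) auto
    also have "\<dots> \<le> ennreal (2 * real B * exp (- (2 * (real (n div B) - 1) * t\<^sup>2)))
      + ennreal (real B * exp (- (real n / real B / 16)))"
      using N0(2) N1(2) N2(2) by (simp add: add_mono)
    finally show "emeasure (samples n) (N0 \<union> N1 \<union> N2) \<le> ennreal (2 * real B * exp (- (2 * (real (n div B) - 1) * t\<^sup>2)))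
      + ennreal (real B * exp (- (real n / real B / 16)))" .
  next
    fix D b assume D: "D \<in> space (samples n) - (N0 \<union> N1 \<union> N2)" and b: "b \<in> {1..B}"
    then have Ds: "D \<in> space (samples n)" and inj: "inj_on (\<lambda>l. ?Z (D l)) {..<n}" using N0(1) by auto
    define L where "L = {l. l < n \<and> bin_lo n D B b < ?Z (D l) \<and> ?Z (D l) \<le> bin_hi n D B b}"
    have "bin_count f n D B b = real (card L)" "n div B \<le> card L"
      using bins[OF Ds inj b L_def] by auto
    moreover have "0 < n div B" using Bn Bpos by (simp add: div_greater_zero_iff)
    ultimately show "bin_count f n D B b \<noteq> 0" by simp
  next
    fix D assume D: "D \<in> space (samples n) - (N0 \<union> N1 \<union> N2)"
    then have Ds: "D \<in> space (samples n)" and inj: "inj_on (\<lambda>l. ?Z (D l)) {..<n}" using N0(1) by auto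
    have "recal_risk M (recal_est f n D B) f = (\<integral>\<omega>. (recal_est f n D B (?Z \<omega>) - label_mean \<omega>)\<^sup>2 \<partial>M)"
      by (rule recal_risk_label_mean[OF recal_est_measurable])
    also have "\<dots> = (\<integral>\<omega>. (recal_est f n D B (?Z \<omega>) - h (?Z \<omega>))\<^sup>2 \<partial>M)"
    proof (rule integral_cong_AE)
      note [measurable] = recal_est_measurable
      show "AE \<omega> in M. (recal_est f n D B (?Z \<omega>) - label_mean \<omega>)\<^sup>2 = (recal_est f n D B (?Z \<omega>) - h (?Z \<omega>))\<^sup>2"
        using h_lm by eventually_elim simp
      show "(\<lambda>\<omega>. (recal_est f n D B (?Z \<omega>) - label_mean \<omega>)\<^sup>2) \<in> borel_measurable M"
        "(\<lambda>\<omega>. (recal_est f n D B (?Z \<omega>) - h (?Z \<omega>))\<^sup>2) \<in> borel_measurable M" by measurable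
    qed
    also have "\<dots> \<le> (t + 1 / real (n div B))\<^sup>2 + 8 * K\<^sup>2 / (real B)\<^sup>2"
      unfolding recal_est_def data_bin_def
    proof (rule binned_error_bound[OF h h01 mean S osc _ Ds npos Bpos])
      fix b assume b: "b \<in> {1..B}"
      define L where "L = {l. l < n \<and> bin_lo n D B b < ?Z (D l) \<and> ?Z (D l) \<le> bin_hi n D B b}"
      note bb = bins[OF Ds inj b L_def]
      show "\<bar>bin_mean f n D B b - bavg (bin_lo n D B b) (bin_hi n D B b)\<bar> \<le> t + 1 / real (n div B)"
        if "0 < bmass (bin_lo n D B b) (bin_hi n D B b)"
        using N1(3)[of D b] D inj b that bb by (simp add: L_def)
      have "real (card L) \<le> real (n div B) + 1" using bb by linarith
      also have "real (n div B) \<le> real n / real B" by (rule of_nat_div_le_of_nat)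
      finally have "real (card L) \<le> real n / real B + 1" by simp
      then show "bmass (bin_lo n D B b) (bin_hi n D B b) \<le> 4 / real B"
        using N2(3)[of D, OF _ bin_lo_le_hi[OF Ds npos b] n] D by (simp add: L_def)
    qed (use K t in auto)
    finally show "recal_risk M (recal_est f n D B) f \<le> (t + 1 / real (n div B))\<^sup>2 + 8 * K\<^sup>2 / (real B)\<^sup>2" .
  qed
qed

end

section \<open>Accuracy of the estimated weights\<close>

lemma relative_error_ratio:
  fixes a c :: "nat \<Rightarrow> real"
  assumes \<epsilon>: "0 \<le> \<epsilon>" "\<epsilon> < 1"
    and a: "\<bar>a 0 - 1\<bar> \<le> \<epsilon>" "\<bar>a 1 - 1\<bar> \<le> \<epsilon>" and c: "\<bar>c 0 - 1\<bar> \<le> \<epsilon>" "\<bar>c 1 - 1\<bar> \<le> \<epsilon>"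
  shows "((a 0 / c 0 - a 1 / c 1) / (a 0 / c 0 + a 1 / c 1))\<^sup>2 \<le> 4 * \<epsilon>\<^sup>2"
proof -
  \<comment> \<open>Multiplying both quotients by \<open>c 0 * c 1\<close> leaves the ratio
    unchanged and turns it into (x - y)/(x + y).\<close>
  define x where "x = a 0 * c 1"
  define y where "y = a 1 * c 0"
  have lo: "1 - \<epsilon> \<le> a 0" "1 - \<epsilon> \<le> a 1" "1 - \<epsilon> \<le> c 0" "1 - \<epsilon> \<le> c 1"
    and hi: "a 0 \<le> 1 + \<epsilon>" "a 1 \<le> 1 + \<epsilon>" "c 0 \<le> 1 + \<epsilon>" "c 1 \<le> 1 + \<epsilon>"
    using a c by (auto simp: abs_le_iff)
  have pos: "0 < c 0" "0 < c 1" "0 < a 0" "0 < a 1" using lo \<epsilon> by auto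
  have xy: "0 < x" "0 < y" using pos by (auto simp: x_def y_def)
  have bounds: "(1 - \<epsilon>)\<^sup>2 \<le> x" "(1 - \<epsilon>)\<^sup>2 \<le> y" "x \<le> (1 + \<epsilon>)\<^sup>2" "y \<le> (1 + \<epsilon>)\<^sup>2"
    unfolding x_def y_def power2_eq_square using lo hi pos \<epsilon> by (auto intro!: mult_mono)
  \<comment> \<open>The extreme case u = (1 + \<epsilon>)^2, v = (1 - \<epsilon>)^2 has (u - v)/(u +
    v) = 2 \<epsilon>/(1 + \<epsilon>^2). The claim is rewritten as u (1 - 2 \<epsilon>) \<le> v (1
    + 2 \<epsilon>), whose sides differ by 4 \<epsilon>^3 in that case.\<close>
  have key: "u - v \<le> 2 * \<epsilon> * (u + v)" if "(1 - \<epsilon>)\<^sup>2 \<le> v" "u \<le> (1 + \<epsilon>)\<^sup>2" "0 < u" "0 < v" for u v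
  proof (cases "1 - 2 * \<epsilon> \<le> 0")
    case True
    then have "u * (1 - 2 * \<epsilon>) \<le> 0" "0 \<le> v * (1 + 2 * \<epsilon>)" using that \<epsilon> by (auto simp: mult_nonneg_nonpos)
    then show ?thesis by (simp add: algebra_simps)
  next
    case False
    then have "u * (1 - 2 * \<epsilon>) \<le> (1 + \<epsilon>)\<^sup>2 * (1 - 2 * \<epsilon>)" using that by (intro mult_right_mono) auto
    also have "\<dots> \<le> (1 - \<epsilon>)\<^sup>2 * (1 + 2 * \<epsilon>)"
    proof -
      have "(1 - \<epsilon>)\<^sup>2 * (1 + 2 * \<epsilon>) - (1 + \<epsilon>)\<^sup>2 * (1 - 2 * \<epsilon>) = 4 * \<epsilon> ^ 3"
        by (simp add: power2_eq_square power3_eq_cube algebra_simps)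
      moreover have "0 \<le> \<epsilon> ^ 3" using \<epsilon> by simp
      ultimately show ?thesis by linarith
    qed
    also have "\<dots> \<le> v * (1 + 2 * \<epsilon>)" using that \<epsilon> by (intro mult_right_mono) auto
    finally show ?thesis by (simp add: algebra_simps)
  qed
  have "(a 0 / c 0 - a 1 / c 1) / (a 0 / c 0 + a 1 / c 1) = (x - y) / (x + y)"
  proof -
    define k where "k = c 0 * c 1"
    have "k \<noteq> 0" "a 0 / c 0 = x / k" "a 1 / c 1 = y / k"
      using pos by (auto simp: k_def x_def y_def)
    then show ?thesis by (simp flip: diff_divide_distrib add_divide_distrib)
  qed
  moreover have "\<bar>(x - y) / (x + y)\<bar> \<le> 2 * \<epsilon>"
    using key[OF bounds(2,3) xy] key[OF bounds(1,4) xy(2,1)] xy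
    by (simp add: abs_le_iff divide_le_eq add.commute minus_divide_left)
  ultimately have "\<bar>(a 0 / c 0 - a 1 / c 1) / (a 0 / c 0 + a 1 / c 1)\<bar>\<^sup>2 \<le> (2 * \<epsilon>)\<^sup>2"
    by (intro power_mono) auto
  then show ?thesis by (simp only: power2_abs power_mult_distrib) simp
qed

text \<open>The condition for all \<open>z\<close> reduces to the two end points, since nonnegative
  weights keep the denominator positive in between, and the condition on the bins becomes a single
  product. In this form the measurability of the event is evident.\<close>

lemma estimators_defined_iff:
  assumes "0 < nP" "0 < nQ"
    and nonneg: "0 \<le> weight_est nP DP nQ DQ 0" "0 \<le> weight_est nP DP nQ DQ 1"
  shows "estimators_defined f B nP DP nQ DQ \<longleftrightarrow>
    emp_class_prob nP DP 0 \<noteq> 0 \<and> emp_class_prob nP DP 1 \<noteq> 0 \<and> (\<Prod>b\<in>{1..B}. bin_count f nP DP B b) \<noteq> 0 \<and>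
    weight_est nP DP nQ DQ 0 \<noteq> 0 \<and> weight_est nP DP nQ DQ 1 \<noteq> 0"
proof -
  let ?w = "weight_est nP DP nQ DQ"
  have "(\<forall>z\<in>{0..1::real}. ?w 1 * z + ?w 0 * (1 - z) \<noteq> 0) \<longleftrightarrow> ?w 0 \<noteq> 0 \<and> ?w 1 \<noteq> 0"
  proof (intro iffI conjI ballI)
    assume *: "\<forall>z\<in>{0..1::real}. ?w 1 * z + ?w 0 * (1 - z) \<noteq> 0"
    show "?w 0 \<noteq> 0" using bspec[OF *, of 0] by simp
    show "?w 1 \<noteq> 0" using bspec[OF *, of 1] by simp
  next
    fix z :: real assume *: "?w 0 \<noteq> 0 \<and> ?w 1 \<noteq> 0" and z: "z \<in> {0..1}"
    have pos: "0 < ?w 0" "0 < ?w 1" using * nonneg by auto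
    have "0 < ?w 1 * z + ?w 0 * (1 - z)"
    proof (cases "z = 0")
      case False
      then have "0 < ?w 1 * z" "0 \<le> ?w 0 * (1 - z)" using z pos by auto
      then show ?thesis by linarith
    qed (use pos in simp)
    then show "?w 1 * z + ?w 0 * (1 - z) \<noteq> 0" by simp
  qed
  moreover have "(\<forall>b\<in>{1..B}. bin_count f nP DP B b \<noteq> 0) \<longleftrightarrow> (\<Prod>b\<in>{1..B}. bin_count f nP DP B b) \<noteq> 0"
    by (simp add: prod_zero_iff)
  ultimately show ?thesis unfolding estimators_defined_def using assms(1,2) by simp
qed

text \<open>Each failure event concerns one sample, so its probability under \<open>J\<close> is
  read off a marginal law, whatever the coupling of the two samples.\<close>

lemma (in labelled_score) sample_law_preimage:
  assumes J: "prob_space J" and g: "g \<in> J \<rightarrow>\<^sub>M samples n" and distr: "distr J (samples n) g = samples n"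
    and N: "N \<in> sets (samples n)"
  shows "g -` N \<inter> space J \<in> sets J" "emeasure J (g -` N \<inter> space J) = emeasure (samples n) N"
proof -
  show "g -` N \<inter> space J \<in> sets J" using g N by (rule measurable_sets)
  have "emeasure (samples n) N = emeasure (distr J (samples n) g) N" by (simp only: distr)
  then show "emeasure J (g -` N \<inter> space J) = emeasure (samples n) N"
    using emeasure_distr[OF g N] by simp
qed

section \<open>Risk bounds for both samples together\<close>

context label_shift
begin

lemma weight_est_nonneg: "0 \<le> weight_est nP DP nQ DQ k"
  unfolding weight_est_def by (intro divide_nonneg_nonneg P.emp_class_prob_nonneg)

text \<open>Definedness at the end points z = 0 and z = 1 makes both estimated weights nonzero,
  hence positive, as the deterministic bound requires.\<close>

lemma recal_risk_estimators_bound: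
  assumes DP: "DP \<in> space (P.samples nP)" and B: "1 \<le> B" and ed: "estimators_defined f B nP DP nQ DQ"
  defines "\<rho> \<equiv> \<lambda>k. weight_est nP DP nQ DQ k / weight P Q k"
  shows "recal_risk Q (shift_correction (weight_est nP DP nQ DQ) \<circ> recal_est f nP DP B) f
    \<le> 2 * (((\<rho> 0 - \<rho> 1) / (\<rho> 0 + \<rho> 1))\<^sup>2
        + weight_max P Q ^ 3 / (weight_min P Q)\<^sup>2 * recal_risk P (recal_est f nP DP B) f)"
  unfolding \<rho>_def
proof (rule recal_risk_shift_bound)
  have n: "0 < nP" "0 < nQ" using ed by (auto simp: estimators_defined_def)
  show "0 < weight_est nP DP nQ DQ 0" "0 < weight_est nP DP nQ DQ 1"
    using ed estimators_defined_iff[OF n weight_est_nonneg weight_est_nonneg, of f B] weight_est_nonneg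
    by (auto simp: less_le)
  show "recal_est f nP DP B z \<in> {0..1}" if "z \<in> {0..1}" for z
    using B by (intro P.recal_est_range[OF DP n(1) _ that]) simp
qed (rule P.recal_est_measurable)

text \<open>An error of \<epsilon> times the smaller class probability is a relative error of at
  most \<epsilon> for each class. Since \<epsilon> < 1, no empirical frequency vanishes.\<close>

lemma weight_est_accurate:
  assumes \<epsilon>: "0 \<le> \<epsilon>" "\<epsilon> < 1"
    and p: "\<And>k. k \<in> {0, 1} \<Longrightarrow> \<bar>emp_class_prob nP DP k - class_prob P k\<bar> \<le> \<epsilon> * class_prob_min P"
    and q: "\<And>k. k \<in> {0, 1} \<Longrightarrow> \<bar>emp_class_prob nQ DQ k - class_prob Q k\<bar> \<le> \<epsilon> * class_prob_min Q"
  defines "\<rho> \<equiv> \<lambda>k. weight_est nP DP nQ DQ k / weight P Q k"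
  shows "((\<rho> 0 - \<rho> 1) / (\<rho> 0 + \<rho> 1))\<^sup>2 \<le> 4 * \<epsilon>\<^sup>2"
    and "\<And>k. k \<in> {0, 1} \<Longrightarrow> emp_class_prob nP DP k \<noteq> 0"
    and "\<And>k. k \<in> {0, 1} \<Longrightarrow> weight_est nP DP nQ DQ k \<noteq> 0"
proof -
  define a where "a k = emp_class_prob nQ DQ k / class_prob Q k" for k
  define c where "c k = emp_class_prob nP DP k / class_prob P k" for k
  have rel: "\<bar>x / r - 1\<bar> \<le> \<epsilon>" if "\<bar>x - r\<bar> \<le> \<epsilon> * m" "0 < r" "m \<le> r" for x r m :: real
  proof -
    have "\<bar>x / r - 1\<bar> = \<bar>x - r\<bar> / r"
    proof -
      have "x / r - 1 = (x - r) / r" using that by (simp add: field_simps)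
      then show ?thesis using that by simp
    qed
    also have "\<dots> \<le> \<epsilon>"
    proof -
      have "\<bar>x - r\<bar> \<le> \<epsilon> * r" using that \<epsilon> by (meson mult_left_mono order_trans)
      then show ?thesis using that by (simp add: divide_le_eq)
    qed
    finally show ?thesis .
  qed
  have min_le: "class_prob_min P \<le> class_prob P k" "class_prob_min Q \<le> class_prob Q k" if "k \<in> {0, 1}" for k
    using that by (auto simp: class_prob_min_def)
  have a: "\<bar>a k - 1\<bar> \<le> \<epsilon>" if "k \<in> {0, 1}" for k
    unfolding a_def by (rule rel[OF q[OF that] class_prob_pos(2)[OF that] min_le(2)[OF that]])
  have c: "\<bar>c k - 1\<bar> \<le> \<epsilon>" if "k \<in> {0, 1}" for k
    unfolding c_def by (rule rel[OF p[OF that] class_prob_pos(1)[OF that] min_le(1)[OF that]])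
  have \<rho>: "\<rho> k = a k / c k" for k
    by (simp add: \<rho>_def a_def c_def weight_est_def weight_def)
  show "((\<rho> 0 - \<rho> 1) / (\<rho> 0 + \<rho> 1))\<^sup>2 \<le> 4 * \<epsilon>\<^sup>2"
    unfolding \<rho> by (rule relative_error_ratio[OF \<epsilon>]) (use a c in auto)
  have nz: "emp_class_prob nP DP k \<noteq> 0" "emp_class_prob nQ DQ k \<noteq> 0" if "k \<in> {0, 1}" for k
    using a[OF that] c[OF that] \<epsilon> by (auto simp: a_def c_def)
  then show "\<And>k. k \<in> {0, 1} \<Longrightarrow> emp_class_prob nP DP k \<noteq> 0"
    "\<And>k. k \<in> {0, 1} \<Longrightarrow> weight_est nP DP nQ DQ k \<noteq> 0"
    by (auto simp: weight_est_def)
qed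

text \<open>\<open>measure\<close> is 0 on non-measurable sets, so passing from the good samples to
  this event needs its measurability. The risk is measurable in the samples as an integral over a
  fresh point from \<open>Q\<close> of a jointly measurable function.\<close>

lemma risk_event_measurable:
  assumes n: "0 < nP" "0 < nQ"
    and fst: "fst \<in> N \<rightarrow>\<^sub>M P.samples nP" and snd: "snd \<in> N \<rightarrow>\<^sub>M Q.samples nQ"
  shows "{x \<in> space N. estimators_defined f B nP (fst x) nQ (snd x) \<and>
    recal_risk Q (shift_correction (weight_est nP (fst x) nQ (snd x)) \<circ> recal_est f nP (fst x) B) f \<le> R} \<in> sets N"
proof -
  let ?w = "\<lambda>x. weight_est nP (fst x) nQ (snd x)"
  let ?pr = "\<lambda>x. \<Prod>b\<in>{1..B}. bin_count f nP (fst x) B b"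
  have ecp [measurable]: "(\<lambda>x. emp_class_prob nP (fst x) k) \<in> borel_measurable N"
    "(\<lambda>x. emp_class_prob nQ (snd x) k) \<in> borel_measurable N" for k
    by (rule P.emp_class_prob_measurable[OF fst], rule Q.emp_class_prob_measurable[OF snd])
  have w [measurable]: "(\<lambda>x. ?w x k) \<in> borel_measurable N" for k
    unfolding weight_est_def by measurable
  have pr [measurable]: "?pr \<in> borel_measurable N"
    by (intro borel_measurable_prod P.recal_est_measurable_raw(2)[OF n(1) fst, of "\<lambda>_. 0"]) auto
  have est: "(\<lambda>y. recal_est f nP (fst (fst y)) B (f (fst (snd y)))) \<in> borel_measurable (N \<Otimes>\<^sub>M Q)"
    by (rule P.recal_est_measurable_raw(1)[OF n(1) measurable_compose[OF measurable_fst fst]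
          measurable_compose[OF measurable_snd Q.Z_measurable]])
  have w2: "(\<lambda>y. ?w (fst y) k) \<in> borel_measurable (N \<Otimes>\<^sub>M Q)" for k
    by (rule measurable_compose[OF measurable_fst w])
  have cl: "(\<lambda>y. cond_label Q f (snd y)) \<in> borel_measurable (N \<Otimes>\<^sub>M Q)"
    by (rule measurable_compose[OF measurable_snd Q.cond_label_measurable])
  have "(\<lambda>y. (shift_correction (?w (fst y)) (recal_est f nP (fst (fst y)) B (f (fst (snd y)))) - cond_label Q f (snd y))\<^sup>2)
      \<in> borel_measurable (N \<Otimes>\<^sub>M Q)"
    unfolding shift_correction_def using est w2 cl
    by (intro borel_measurable_power borel_measurable_diff borel_measurable_divide borel_measurable_times
        borel_measurable_add borel_measurable_const) auto
  then have [measurable]: "(\<lambda>x. recal_risk Q (shift_correction (?w x) \<circ> recal_est f nP (fst x) B) f) \<in> borel_measurable N"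
    unfolding recal_risk_def comp_def
    by (intro Q.borel_measurable_lebesgue_integral) (simp add: case_prod_beta')
  have "{x \<in> space N. estimators_defined f B nP (fst x) nQ (snd x) \<and>
      recal_risk Q (shift_correction (?w x) \<circ> recal_est f nP (fst x) B) f \<le> R}
    = {x \<in> space N. (emp_class_prob nP (fst x) 0 \<noteq> 0 \<and> emp_class_prob nP (fst x) 1 \<noteq> 0 \<and> ?pr x \<noteq> 0 \<and>
      ?w x 0 \<noteq> 0 \<and> ?w x 1 \<noteq> 0) \<and> recal_risk Q (shift_correction (?w x) \<circ> recal_est f nP (fst x) B) f \<le> R}"
    by (simp only: estimators_defined_iff[OF n weight_est_nonneg weight_est_nonneg])
  also have "\<dots> \<in> sets N" by measurable
  finally show ?thesis .
qed

lemma recal_risk_high_probability: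
  assumes opt: "optimal_recal P f h" and ac: "abs_continuous_fun (cdf (score_law P f))"
    and mono: "mono_on (measure_support (score_law P f)) h" and K: "0 < K"
    and lip: "\<And>z1 z2. z1 \<in> {0..1} \<Longrightarrow> z2 \<in> {0..1} \<Longrightarrow> z1 \<le> z2 \<Longrightarrow>
      h z2 - h z1 \<le> K * (cdf (score_law P f) z2 - cdf (score_law P f) z1)"
    and B: "1 \<le> B" and \<delta>: "0 < \<delta>" "\<delta> < 1"
    and nP: "max 16 (27 / class_prob_min P) * real B * ln (4 * real B / \<delta>) \<le> real nP"
    and nQ: "27 / class_prob_min Q * ln (16 / \<delta>) \<le> real nQ"
    and J: "iid_samples_law P nP Q nQ J"
  shows "1 - \<delta> \<le> measure J {x \<in> space J. estimators_defined f B nP (fst x) nQ (snd x) \<and>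
    recal_risk Q (shift_correction (weight_est nP (fst x) nQ (snd x)) \<circ> recal_est f nP (fst x) B) f
      \<le> 2 * (weight_max P Q ^ 3 / (weight_min P Q)\<^sup>2)
          * ((sqrt (1 / (2 * (real (nP div B) - 1)) * ln (8 * real B / \<delta>)) + 1 / real (nP div B))\<^sup>2
             + 8 * K\<^sup>2 / (real B)\<^sup>2)
        + 54 * max (1 / (class_prob_min P * real nP)) (1 / (class_prob_min Q * real nQ)) * ln (16 / \<delta>)}"
    (is "_ \<le> measure J ?E")
proof -
  let ?p = "class_prob_min P" and ?q = "class_prob_min Q"
  let ?C = "weight_max P Q ^ 3 / (weight_min P Q)\<^sup>2"
  define l4 where "l4 = ln (4 * real B / \<delta>)"
  define L where "L = ln (16 / \<delta>)"
  define Mx where "Mx = max (1 / (?p * real nP)) (1 / (?q * real nQ))"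
  define t where "t = sqrt (1 / (2 * (real (nP div B) - 1)) * ln (8 * real B / \<delta>))"
  have B1: "1 \<le> real B" using B by simp
  have p: "0 < ?p" and q: "0 < ?q" using class_prob_pos by (auto simp: class_prob_min_def)
  have \<delta>B: "4 \<le> 4 * real B / \<delta>" using B1 \<delta> by (simp add: le_divide_eq)
  have l4: "1 \<le> l4"
  proof -
    have "exp 1 \<le> 4 * real B / \<delta>" using exp_le \<delta>B by linarith
    then show ?thesis unfolding l4_def using \<delta>B by (subst ln_ge_iff) auto
  qed
  \<comment> \<open>By B \<ge> 1 and \<delta> < 1, 16/\<delta> is at most (4B/\<delta>)^2. The
    condition on \<open>nP\<close>, stated with ln (4B/\<delta>), thereby also controls ln
    (16/\<delta>).\<close>
  have L2: "L \<le> 2 * l4"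
  proof -
    have "16 / \<delta> \<le> (4 * real B / \<delta>)\<^sup>2"
    proof -
      have "16 / \<delta> \<le> (4 / \<delta>)\<^sup>2" using \<delta> by (simp add: power2_eq_square divide_simps)
      also have "\<dots> \<le> (4 * real B / \<delta>)\<^sup>2" using B1 \<delta> by (intro power_mono divide_right_mono) auto
      finally show ?thesis .
    qed
    then have "L \<le> ln ((4 * real B / \<delta>)\<^sup>2)" unfolding L_def using \<delta> B by (subst ln_le_cancel_iff) auto
    then show ?thesis using \<delta>B by (simp add: l4_def ln_realpow)
  qed
  have L1: "1 \<le> L"
  proof -
    have "4 \<le> 16 / \<delta>" using \<delta> by (simp add: le_divide_eq)
    then have "exp 1 \<le> 16 / \<delta>" using exp_le by linarith
    then show ?thesis unfolding L_def using \<delta> by (subst ln_ge_iff) auto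
  qed
  have Bl: "l4 \<le> real B * l4" using B1 l4 mult_right_mono[of 1 "real B" l4] by simp
  have nP16: "16 * (real B * l4) \<le> real nP"
  proof -
    have "16 * (real B * l4) \<le> max 16 (27 / ?p) * (real B * l4)" using B1 l4 by (intro mult_right_mono) auto
    then show ?thesis using nP by (simp add: l4_def mult.assoc)
  qed
  have nP27: "27 * l4 \<le> ?p * real nP"
  proof -
    have "27 / ?p * l4 \<le> max 16 (27 / ?p) * (real B * l4)"
      using Bl l4 p by (intro mult_mono) auto
    then have "27 / ?p * l4 \<le> real nP" using nP by (simp add: l4_def mult.assoc)
    then show ?thesis using p by (simp add: field_simps)
  qed
  have nQ27: "27 * L \<le> ?q * real nQ" using nQ q by (simp add: L_def field_simps)
  have nBq: "16 * l4 \<le> real nP / real B" using nP16 B1 by (simp add: field_simps)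
  have "0 < real nP" using nP16 Bl l4 by linarith
  then have nP0: "0 < nP" by simp
  have nQ0: "0 < nQ" using nQ27 L1 by (cases nQ) auto
  \<comment> \<open>Keeps floor(nP/B) - 1 positive under the square root.\<close>
  have m2: "2 \<le> nP div B"
  proof -
    have "real B * 1 \<le> real B * l4" using l4 by (intro mult_left_mono) auto
    then have "2 * real B \<le> real nP" using nP16 by linarith
    then have "2 * B \<le> nP" by linarith
    then show ?thesis using B by (simp add: less_eq_div_iff_mult_less_eq)
  qed
  have MxP: "1 / (?p * real nP) \<le> Mx" and MxQ: "1 / (?q * real nQ) \<le> Mx" by (auto simp: Mx_def)
  have pn: "0 < ?p * real nP" and qn: "0 < ?q * real nQ" using p q nP0 nQ0 by auto
  have Mx0: "0 < Mx" using MxP pn by (smt (verit) divide_pos_pos)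
  have LM: "L * Mx \<le> 2 / 27"
  proof -
    have "L / (?p * real nP) \<le> 2 / 27"
      using nP27 L2 pn by (simp add: divide_le_eq)
    moreover have "L / (?q * real nQ) \<le> 2 / 27" using nQ27 L1 qn by (simp add: divide_le_eq)
    ultimately show ?thesis unfolding Mx_def max_def by (auto split: if_splits)
  qed
  \<comment> \<open>Chosen so that each pair of tails, 2 exp (-N \<epsilon>^2 / 4), is at most 2 exp
    (-L) = \<delta>/8. By \<open>LM\<close>, \<epsilon>^2 is at most 8/27.\<close>
  define \<epsilon> where "\<epsilon> = sqrt (4 * L * Mx)"
  have \<epsilon>2: "\<epsilon>\<^sup>2 = 4 * L * Mx" using L1 Mx0 by (simp add: \<epsilon>_def)
  have \<epsilon>0: "0 \<le> \<epsilon>" using L1 Mx0 by (simp add: \<epsilon>_def)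
  have \<epsilon>1: "\<epsilon> < 1"
  proof -
    have "4 * L * Mx < 1" using LM by linarith
    then show ?thesis by (simp add: \<epsilon>_def)
  qed
  have tail: "2 * exp (- (N * \<epsilon>\<^sup>2 / 4)) \<le> \<delta> / 8" if "1 / N \<le> Mx" "0 < N" for N :: real
  proof -
    have "1 \<le> N * Mx" using that by (simp add: divide_le_eq mult.commute)
    then have "L * 1 \<le> L * (N * Mx)" using L1 by (intro mult_left_mono) auto
    then have "L \<le> N * \<epsilon>\<^sup>2 / 4" by (simp add: \<epsilon>2 mult_ac)
    then have "exp (- (N * \<epsilon>\<^sup>2 / 4)) \<le> exp (- L)" by simp
    also have "exp (- L) = \<delta> / 16" using \<delta> by (simp add: L_def exp_minus)
    finally show ?thesis by simp
  qed
  have ln8: "0 < ln (8 * real B / \<delta>)"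
  proof (rule ln_gt_zero)
    show "1 < 8 * real B / \<delta>" using B1 \<delta> by (simp add: less_divide_eq)
  qed
  have m1: "0 < real (nP div B) - 1" using m2 by linarith
  have t0: "0 < t" unfolding t_def using m1 ln8 by (intro real_sqrt_gt_zero mult_pos_pos) auto
  have t2: "2 * (real (nP div B) - 1) * t\<^sup>2 = ln (8 * real B / \<delta>)"
  proof -
    have "t\<^sup>2 = 1 / (2 * (real (nP div B) - 1)) * ln (8 * real B / \<delta>)"
      unfolding t_def using m1 ln8 by (intro real_sqrt_pow2) auto
    then show ?thesis using m1 by (simp add: field_simps)
  qed
  \<comment> \<open>The \<open>t\<close> of the statement solves 2 (floor(nP/B) - 1) t^2 = ln
    (8B/\<delta>), so the 2B tails sum to \<delta>/4.\<close>
  have dev: "2 * real B * exp (- (2 * (real (nP div B) - 1) * t\<^sup>2)) = \<delta> / 4"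
  proof -
    have "exp (- ln (8 * real B / \<delta>)) = \<delta> / (8 * real B)" using B1 \<delta> by (simp add: exp_minus)
    then show ?thesis unfolding t2 using B1 by simp
  qed
  \<comment> \<open>The universal constant 16 cancels the 16 in the tail of the cell counts and
    leaves B exp (-ln (4B/\<delta>)) = \<delta>/4.\<close>
  have cells: "real B * exp (- (real nP / real B / 16)) \<le> \<delta> / 4"
  proof -
    have "exp (- (real nP / real B / 16)) \<le> exp (- l4)" using nBq by simp
    also have "exp (- l4) = \<delta> / (4 * real B)" using B1 \<delta> by (simp add: l4_def exp_minus)
    finally have "real B * exp (- (real nP / real B / 16)) \<le> real B * (\<delta> / (4 * real B))"
      using B1 by (intro mult_left_mono) auto
    then show ?thesis using B1 by simp
  qed
  have n2: "2 \<le> real nP / real B" using nBq l4 by linarith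
  obtain N1 where N1: "N1 \<in> sets (P.samples nP)"
    "emeasure (P.samples nP) N1 \<le> ennreal (2 * real B * exp (- (2 * (real (nP div B) - 1) * t\<^sup>2)))
      + ennreal (real B * exp (- (real nP / real B / 16)))"
    "\<And>D. D \<in> space (P.samples nP) - N1 \<Longrightarrow>
      recal_risk P (recal_est f nP D B) f \<le> (t + 1 / real (nP div B))\<^sup>2 + 8 * K\<^sup>2 / (real B)\<^sup>2"
    "\<And>D b. D \<in> space (P.samples nP) - N1 \<Longrightarrow> b \<in> {1..B} \<Longrightarrow> bin_count f nP D B b \<noteq> 0"
  proof (rule P.recal_est_risk_high_prob[OF opt ac mono K _ B t0 n2], goal_cases)
    case (1 z1 z2)
    show ?case by (rule lip) (use 1 in auto)
  next
    case (2 N)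
    show ?case by (rule 2(1)[OF 2(2-5)])
  qed
  obtain N2 where N2: "N2 \<in> sets (P.samples nP)"
    "emeasure (P.samples nP) N2 \<le> ennreal (2 * exp (- (real nP * ?p * \<epsilon>\<^sup>2 / 4)))"
    "\<And>D k. D \<in> space (P.samples nP) - N2 \<Longrightarrow> k \<in> {0, 1} \<Longrightarrow>
      \<bar>emp_class_prob nP D k - class_prob P k\<bar> \<le> \<epsilon> * ?p"
  proof (rule P.class_probs_concentrate[OF \<epsilon>0 less_imp_le[OF \<epsilon>1] nP0], goal_cases)
    case (1 N)
    show ?case by (rule 1(1)[OF 1(2-4)])
  qed
  obtain N3 where N3: "N3 \<in> sets (Q.samples nQ)"
    "emeasure (Q.samples nQ) N3 \<le> ennreal (2 * exp (- (real nQ * ?q * \<epsilon>\<^sup>2 / 4)))"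
    "\<And>D k. D \<in> space (Q.samples nQ) - N3 \<Longrightarrow> k \<in> {0, 1} \<Longrightarrow>
      \<bar>emp_class_prob nQ D k - class_prob Q k\<bar> \<le> \<epsilon> * ?q"
  proof (rule Q.class_probs_concentrate[OF \<epsilon>0 less_imp_le[OF \<epsilon>1] nQ0], goal_cases)
    case (1 N)
    show ?case by (rule 1(1)[OF 1(2-4)])
  qed
  have e1: "emeasure (P.samples nP) N1 \<le> ennreal (\<delta> / 2)"
  proof -
    have "emeasure (P.samples nP) N1 \<le> ennreal (\<delta> / 4) + ennreal (\<delta> / 4)"
      using N1(2) cells unfolding dev by (meson add_left_mono ennreal_leI order_trans)
    then show ?thesis using \<delta> by (simp flip: ennreal_plus)
  qed
  have e2: "emeasure (P.samples nP) N2 \<le> ennreal (\<delta> / 8)"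
    by (rule order_trans[OF N2(2) ennreal_leI[OF tail]]) (use MxP pn in \<open>simp_all add: mult.commute\<close>)
  have e3: "emeasure (Q.samples nQ) N3 \<le> ennreal (\<delta> / 8)"
    by (rule order_trans[OF N3(2) ennreal_leI[OF tail]]) (use MxQ qn in \<open>simp_all add: mult.commute\<close>)
  interpret J: prob_space J using J by (simp add: iid_samples_law_def)
  have setsJ: "sets J = sets (P.samples nP \<Otimes>\<^sub>M Q.samples nQ)" using J by (simp add: iid_samples_law_def)
  have fstJ: "fst \<in> J \<rightarrow>\<^sub>M P.samples nP" and sndJ: "snd \<in> J \<rightarrow>\<^sub>M Q.samples nQ"
    unfolding measurable_cong_sets[OF setsJ refl] by (rule measurable_fst, rule measurable_snd)
  have dP: "distr J (P.samples nP) fst = P.samples nP" and dQ: "distr J (Q.samples nQ) snd = Q.samples nQ"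
    using J by (auto simp: iid_samples_law_def)
  note pre1 = P.sample_law_preimage[OF J.prob_space_axioms fstJ dP N1(1)]
  note pre2 = P.sample_law_preimage[OF J.prob_space_axioms fstJ dP N2(1)]
  note pre3 = Q.sample_law_preimage[OF J.prob_space_axioms sndJ dQ N3(1)]
  define Bad where "Bad = (fst -` N1 \<inter> space J) \<union> (fst -` N2 \<inter> space J) \<union> (snd -` N3 \<inter> space J)"
  have Bad: "Bad \<in> sets J" unfolding Bad_def by (intro sets.Un pre1(1) pre2(1) pre3(1))
  have mBad: "measure J Bad \<le> \<delta>"
  proof -
    have "measure J Bad \<le> measure J (fst -` N1 \<inter> space J) + measure J (fst -` N2 \<inter> space J) + measure J (snd -` N3 \<inter> space J)"
      unfolding Bad_def using pre1(1) pre2(1) pre3(1)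
      by (intro order_trans[OF measure_Un_le] add_right_mono measure_Un_le sets.Un)
    moreover have "measure J (fst -` N1 \<inter> space J) \<le> \<delta> / 2"
      using e1 \<delta> unfolding pre1(2)[symmetric] J.emeasure_eq_measure by simp
    moreover have "measure J (fst -` N2 \<inter> space J) \<le> \<delta> / 8"
      using e2 \<delta> unfolding pre2(2)[symmetric] J.emeasure_eq_measure by simp
    moreover have "measure J (snd -` N3 \<inter> space J) \<le> \<delta> / 8"
      using e3 \<delta> unfolding pre3(2)[symmetric] J.emeasure_eq_measure by simp
    ultimately show ?thesis using \<delta> by linarith
  qed
  have "space J - Bad \<subseteq> ?E"
  proof
    fix x assume x: "x \<in> space J - Bad"
    then have xs: "x \<in> space J" by simp
    have DP: "fst x \<in> space (P.samples nP)" and DQ: "snd x \<in> space (Q.samples nQ)"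
      using measurable_space[OF fstJ xs] measurable_space[OF sndJ xs] .
    have g1: "fst x \<in> space (P.samples nP) - N1" and g2: "fst x \<in> space (P.samples nP) - N2"
      and g3: "snd x \<in> space (Q.samples nQ) - N3"
      using x DP DQ by (auto simp: Bad_def)
    let ?w = "weight_est nP (fst x) nQ (snd x)"
    let ?r = "\<lambda>k. ?w k / weight P Q k"
    note acc = weight_est_accurate[OF \<epsilon>0 \<epsilon>1 N2(3)[OF g2] N3(3)[OF g3]]
    have "(\<Prod>b\<in>{1..B}. bin_count f nP (fst x) B b) \<noteq> 0"
      using N1(4)[OF g1] by (simp add: prod_zero_iff)
    then have ed: "estimators_defined f B nP (fst x) nQ (snd x)"
      using estimators_defined_iff[OF nP0 nQ0 weight_est_nonneg weight_est_nonneg, of f B "fst x" "snd x"]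
        acc(2)[of 0] acc(2)[of 1] acc(3)[of 0] acc(3)[of 1] by simp
    let ?R = "(t + 1 / real (nP div B))\<^sup>2 + 8 * K\<^sup>2 / (real B)\<^sup>2"
    have C0: "0 \<le> ?C" using w_pos by (simp add: weight_max_def)
    have "recal_risk Q (shift_correction ?w \<circ> recal_est f nP (fst x) B) f
        \<le> 2 * (((?r 0 - ?r 1) / (?r 0 + ?r 1))\<^sup>2 + ?C * recal_risk P (recal_est f nP (fst x) B) f)"
      by (rule recal_risk_estimators_bound[OF DP B ed])
    also have "\<dots> \<le> 2 * (4 * \<epsilon>\<^sup>2 + ?C * ?R)"
      using acc(1) N1(3)[OF g1] C0 by (intro mult_left_mono add_mono) auto
    also have "\<dots> = 2 * ?C * ?R + 32 * (Mx * L)" by (simp add: \<epsilon>2 algebra_simps)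
    \<comment> \<open>The weights contribute 2 * 4 \<epsilon>^2 = 32 \<open>Mx\<close>
      \<open>L\<close>, so the constant 54 leaves room.\<close>
    also have "\<dots> \<le> 2 * ?C * ?R + 54 * Mx * L" using Mx0 L1 by simp
    finally show "x \<in> ?E"
      using xs ed by (simp add: t_def Mx_def L_def)
  qed
  moreover have "?E \<in> sets J" by (rule risk_event_measurable[OF nP0 nQ0 fstJ sndJ])
  ultimately have "measure J (space J - Bad) \<le> measure J ?E" by (rule J.finite_measure_mono)
  moreover have "measure J (space J - Bad) = 1 - measure J Bad" by (rule J.prob_compl[OF Bad])
  ultimately show ?thesis using mBad by linarith
qed

end

theorem theorem2:
  shows "\<exists>c>0::real. \<forall>(d::nat) (S::(nat \<Rightarrow> real) set) (P::labelled measure) (Q::labelled measure)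
      (f::(nat \<Rightarrow> real) \<Rightarrow> real) (nP::nat) (nQ::nat) (B::nat).
    S \<subseteq> space (\<Pi>\<^sub>M i\<in>{..<d}. (borel :: real measure)) \<and>
    labelled_law d S P \<and> labelled_law d S Q \<and>
    f \<in> measurable (feature_space d S) (restrict_space borel {0..1}) \<and>
    (\<forall>k\<in>{0, 1}. \<forall>A\<in>sets (feature_space d S).
        \<P>(\<omega> in P. fst \<omega> \<in> A \<bar> snd \<omega> = k) = \<P>(\<omega> in Q. fst \<omega> \<in> A \<bar> snd \<omega> = k)) \<and>
    class_prob P 1 \<in> {0<..<1} \<and> class_prob Q 1 \<in> {0<..<1} \<and>
    B \<ge> 1 \<longrightarrow>
    (\<forall>DP\<in>space (\<Pi>\<^sub>M i\<in>{..<nP}. P). \<forall>DQ\<in>space (\<Pi>\<^sub>M i\<in>{..<nQ}. Q).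
       estimators_defined f B nP DP nQ DQ \<longrightarrow>
       (let \<rho> = (\<lambda>k. weight_est nP DP nQ DQ k / weight P Q k) in
        recal_risk Q (shift_correction (weight_est nP DP nQ DQ) \<circ> recal_est f nP DP B) f
          \<le> 2 * (((\<rho> 0 - \<rho> 1) / (\<rho> 0 + \<rho> 1))\<^sup>2
                 + weight_max P Q ^ 3 / (weight_min P Q)\<^sup>2 * recal_risk P (recal_est f nP DP B) f))) \<and>
    (\<forall>(h::real \<Rightarrow> real) (K::real).
       optimal_recal P f h \<and>
       abs_continuous_fun (cdf (score_law P f)) \<and>
       mono_on (measure_support (score_law P f)) h \<and>
       K > 0 \<and>
       (\<forall>z1\<in>{0..1}. \<forall>z2\<in>{0..1}. z1 \<le> z2 \<longrightarrow>
          h z2 - h z1 \<le> K * (cdf (score_law P f) z2 - cdf (score_law P f) z1)) \<longrightarrow>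
       (\<forall>\<delta>\<in>{0<..<1}.
          real nP \<ge> max c (27 / class_prob_min P) * real B * ln (4 * real B / \<delta>) \<and>
          real nQ \<ge> 27 / class_prob_min Q * ln (16 / \<delta>) \<longrightarrow>
          (\<forall>J. iid_samples_law P nP Q nQ J \<longrightarrow>
             \<P>((DP, DQ) in J.
                estimators_defined f B nP DP nQ DQ \<and>
                recal_risk Q (shift_correction (weight_est nP DP nQ DQ) \<circ> recal_est f nP DP B) f
                  \<le> 2 * (weight_max P Q ^ 3 / (weight_min P Q)\<^sup>2)
                      * ((sqrt (1 / (2 * (real (nP div B) - 1)) * ln (8 * real B / \<delta>))
                            + 1 / real (nP div B))\<^sup>2
                         + 8 * K\<^sup>2 / (real B)\<^sup>2)
                    + 54 * max (1 / (class_prob_min P * real nP)) (1 / (class_prob_min Q * real nQ))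
                      * ln (16 / \<delta>))
             \<ge> 1 - \<delta>)))"
proof (intro exI[of _ "16::real"] conjI allI impI, goal_cases)
  case 1
  show ?case by simp
next
  case (2 d S P Q f nP nQ B)
  interpret label_shift d S P Q f
    by (intro label_shift.intro labelled_score.intro label_shift_axioms.intro) (use 2 in blast)+
  show ?case
    unfolding Let_def
  proof (intro ballI impI)
    fix DP DQ
    assume "DP \<in> space (\<Pi>\<^sub>M i\<in>{..<nP}. P)" "estimators_defined f B nP DP nQ DQ"
    then show "recal_risk Q (shift_correction (weight_est nP DP nQ DQ) \<circ> recal_est f nP DP B) f
        \<le> 2 * (((weight_est nP DP nQ DQ 0 / weight P Q 0 - weight_est nP DP nQ DQ 1 / weight P Q 1)
              / (weight_est nP DP nQ DQ 0 / weight P Q 0 + weight_est nP DP nQ DQ 1 / weight P Q 1))\<^sup>2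
            + weight_max P Q ^ 3 / (weight_min P Q)\<^sup>2 * recal_risk P (recal_est f nP DP B) f)"
      using 2 by (intro recal_risk_estimators_bound) auto
  qed
next
  case (3 d S P Q f nP nQ B h K)
  interpret label_shift d S P Q f
    by (intro label_shift.intro labelled_score.intro label_shift_axioms.intro) (use 3 in blast)+
  show ?case (is "\<forall>\<delta>\<in>_. _ \<longrightarrow> (\<forall>J. _ \<longrightarrow> ?P \<delta> J)")
  proof (intro ballI impI allI)
    fix \<delta> J assume \<delta>: "\<delta> \<in> {0<..<1}" and J: "iid_samples_law P nP Q nQ J"
      and n: "max 16 (27 / class_prob_min P) * real B * ln (4 * real B / \<delta>) \<le> real nP \<and>
        27 / class_prob_min Q * ln (16 / \<delta>) \<le> real nQ"
    show "?P \<delta> J"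
      unfolding case_prod_beta prod.collapse
      by (rule recal_risk_high_probability[of h K B \<delta> nP nQ J]) (use 3 \<delta> n J in auto)
  qed
qed

end
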